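(* Let $\phi:(\mathbb{P}^1)^3\dashrightarrow\mathbb{P}^3$ be a scaffold trilinear rational map (with $\Sigma_0,\Sigma_1$ the planar boundary surfaces). Then $\phi$ is birational of type $(1,2,2)$ if and only if one of the following conditions holds for some points $(\alpha_{0m}:\alpha_{1m})$ ($m=0,1$), $(\beta_{0m}:\beta_{1m})$ and $(\gamma_{0m}:\gamma_{1m})$ ($m=0,1,2$) in $\mathbb{P}^1_{\mathbb{R}}$: 1. $w_{ijk}=\alpha_{i0}\,\beta_{j0}\,\gamma_{k2}\,\Delta_{ijk}(0,y)$ for each $0\le i,j,k\le1$; 2. $w_{ijk}=\alpha_{i1}\,\beta_{j1}\,\gamma_{k2}\,\Delta_{ijk}(1,y)$ for each $0\le i,j,k\le1$; 3. $w_{ijk}=\alpha_{i0}\,\beta_{j2}\,\gamma_{k0}\,\Delta_{ijk}(0,z)$ for each $0\le i,j,k\le1$; 4. $w_{ijk}=\alpha_{i1}\,\beta_{j2}\,\gamma_{k1}\,\Delta_{ijk}(1,z)$ for each $0\le i,j,k\le1$. Moreover, if one of these conditions holds then all four hold, for a simultaneous choice of the points above, up to a nonzero scalar multiplying all the weights.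
   Context: Setting. $\mathbb{P}^n$ is complex and $\mathbb{P}^n_{\mathbb{R}}$ real projective $n$-space. $\phi:\mathbb{P}^1\times\mathbb{P}^1\times\mathbb{P}^1\dashrightarrow\mathbb{P}^3$ is the trilinear rational map given by $$\mathbf{f}=(f_0,f_1,f_2,f_3)=\sum_{0\le i,j,k\le 1} w_{ijk}\,\mathbf{P}_{ijk}\,s_it_ju_k,$$ with control points $\mathbf{P}_{ijk}=(1,x_{ijk},y_{ijk},z_{ijk})\in\mathbb{R}^4$ (identified with points of $\mathbb{P}^3$) and weights $w_{ijk}\in\mathbb{R}$, which matter only up to a common nonzero scalar. Boundary surfaces. $\Sigma_0$ (resp. $\Sigma_1$) is the closure of the image of $\phi$ restricted to $(s_0:s_1)=(1:0)$ (resp. $(0:1)$). $T_0,T_1$ and $Y_0,Y_1$ are defined in the same way using $(t_0:t_1)$ and $(u_0:u_1)$. So $\mathbf{P}_{ijk}\in\Sigma_i\cap T_j\cap Y_k$. Boundary lines: $s_{jk}$ joins $\mathbf{P}_{0jk},\mathbf{P}_{1jk}$; $t_{ik}$ joins $\mathbf{P}_{i0k},\mathbf{P}_{i1k}$; $u_{ij}$ joins $\mathbf{P}_{ij0},\mathbf{P}_{ij1}$ (images of the corresponding coordinate lines). Each boundary surface is a plane or a quadric. Standing nondegeneracy assumption: the surfaces $\Sigma_i,T_j,Y_k$ are smooth surfaces, pairwise distinct, and $s_{jk},t_{ik},u_{ij}$ are lines, pairwise distinct. $\phi$ is scaffold if all the boundary surfaces are quadrics except for one of the three parameters, for which (1)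 the two boundary surfaces are planes, that intersect at a line $\ell$, and (2) the four boundary lines intersect two lines $r_0,r_1$, and these two intersect $\ell$. Convention: this parameter is $s$, so $\Sigma_0,\Sigma_1$ are planes, $\ell=s:=\Sigma_0\cap\Sigma_1$, and $r_0,r_1$ meet $s_{jk}$ for all $0\le j,k\le1$. Let $y$ be the line through the points $u_{00}\cap u_{01}$ and $u_{10}\cap u_{11}$, and $z$ the line through the points $t_{00}\cap t_{01}$ and $t_{10}\cap t_{11}$. For $j,k\in\{0,1\}$ let $\Theta_j$ be the plane containing $y$ and $r_j$, defined by $\boldsymbol{\theta}_j\cdot\mathbf{x}^T=0$, and $P_k$ the plane containing $z$ and $r_k$, defined by $\boldsymbol{\rho}_k\cdot\mathbf{x}^T=0$, with $\boldsymbol{\theta}_j,\boldsymbol{\rho}_k\in\mathbb{R}^4$. For $l=0,1$ set $$\Delta_{ijk}(l,y)=\frac{1}{\langle\boldsymbol{\theta}_l,\mathbf{P}_{ijk}\rangle},\qquad \Delta_{ijk}(l,z)=\frac{1}{\langle\boldsymbol{\rho}_l,\mathbf{P}_{ijk}\rangle}$$ (well defined under the standing assumption), where $\langle\cdot,\cdot\rangle$ is the usual scalar product. Type. If $\phi$ is birational, its inverse is $\mathbf{x}\mapsto(A_0:A_1)\times(B_0:B_1)\times(C_0:C_1)$ with $A_0,A_1$ (resp. $B_0,B_1$; $C_0,C_1$) homogeneous of the same degree in $\mathbf{x}=(x_0,\dots,x_3)$ without common factor; the type of $\phi$ is $(\deg A_i,\deg B_j,\deg C_k)$. *)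

theory Defs
  imports "HOL-Analysis.Analysis" "HOL-Library.Poly_Mapping"
begin

text \<open>
  Points of \<open>n\<close>-dimensional complex projective space are given by nonzero vectors with
  \<open>n + 1\<close> coordinates, up to \<open>proj_eq\<close>. Coordinates are numbered from 0: the index types
  are \<open>2 = {0, 1}\<close> for the projective line and \<open>4 = {0, 1, 2, 3}\<close> for projective 3-space.
  A closed subset of projective 3-space (a point, line, plane, surface) is represented by its
  affine cone in \<open>complex^4\<close>, with the zero vector included. In particular, a projective line
  is a complex linear subspace of dimension 2, and two projective lines meet iff their cones
  have a nonzero common vector. Complex linear notions are those of the interpretation \<open>vec\<close>.
\<close>

definition proj_eq :: "complex^'n \<Rightarrow> complex^'n \<Rightarrow> bool" where
  "proj_eq v v' \<longleftrightarrow> (\<exists>c. c \<noteq> 0 \<and> v = c *s v')"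

definition cvec :: "real^'n \<Rightarrow> complex^'n" where
  "cvec v = (\<chi> i. complex_of_real (v $ i))"


subsection \<open>Forms in four variables\<close>

type_synonym poly4 = "(4 \<Rightarrow>\<^sub>0 nat) \<Rightarrow>\<^sub>0 complex"

definition peval :: "poly4 \<Rightarrow> complex^4 \<Rightarrow> complex" where
  "peval F x = (\<Sum>m\<in>Poly_Mapping.keys F. Poly_Mapping.lookup F m * (\<Prod>i\<in>UNIV. (x $ i) ^ Poly_Mapping.lookup m i))"

definition homogeneous :: "nat \<Rightarrow> poly4 \<Rightarrow> bool" where
  "homogeneous d F \<longleftrightarrow> (\<forall>m\<in>Poly_Mapping.keys F. (\<Sum>i\<in>UNIV. Poly_Mapping.lookup m i) = d)"

definition no_common_factor :: "poly4 \<Rightarrow> poly4 \<Rightarrow> bool" where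
  "no_common_factor F G \<longleftrightarrow> (\<forall>D. D dvd F \<and> D dvd G \<longrightarrow> D dvd 1)"

definition pderiv4 :: "poly4 \<Rightarrow> 4 \<Rightarrow> complex^4 \<Rightarrow> complex" where
  "pderiv4 F i x = deriv (\<lambda>z. peval F (x + z *s axis i 1)) 0"


subsection \<open>Subvarieties of projective 3-space\<close>

definition zariski_closure :: "(complex^4) set \<Rightarrow> (complex^4) set" where
  "zariski_closure S =
     {x. \<forall>d F. homogeneous d F \<and> (\<forall>v\<in>S. peval F v = 0) \<longrightarrow> peval F x = 0}"

definition is_surface :: "nat \<Rightarrow> (complex^4) set \<Rightarrow> bool" where
  "is_surface d S \<longleftrightarrow>
     (\<exists>F. homogeneous d F \<and> irreducible F \<and> S = {x. peval F x = 0})"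

abbreviation is_plane :: "(complex^4) set \<Rightarrow> bool" where
  "is_plane \<equiv> is_surface 1"

abbreviation is_quadric :: "(complex^4) set \<Rightarrow> bool" where
  "is_quadric \<equiv> is_surface 2"

definition smooth_surface :: "(complex^4) set \<Rightarrow> bool" where
  "smooth_surface S \<longleftrightarrow>
     (\<exists>d F. homogeneous d F \<and> irreducible F \<and> S = {x. peval F x = 0} \<and>
            (\<forall>x\<in>S. x \<noteq> 0 \<longrightarrow> (\<exists>i. pderiv4 F i x \<noteq> 0)))"

definition is_line :: "(complex^4) set \<Rightarrow> bool" where
  "is_line L \<longleftrightarrow> vec.subspace L \<and> vec.dim L = 2"

definition meets :: "(complex^4) set \<Rightarrow> (complex^4) set \<Rightarrow> bool" where
  "meets L M \<longleftrightarrow> (\<exists>x. x \<noteq> 0 \<and> x \<in> L \<and> x \<in> M)"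

definition hyperplane :: "real^4 \<Rightarrow> (complex^4) set" where
  "hyperplane n = {x. (\<Sum>i\<in>UNIV. complex_of_real (n $ i) * x $ i) = 0}"

definition plane_through :: "real^4 \<Rightarrow> (complex^4) set \<Rightarrow> (complex^4) set \<Rightarrow> bool" where
  "plane_through n L M \<longleftrightarrow> n \<noteq> 0 \<and> L \<subseteq> hyperplane n \<and> M \<subseteq> hyperplane n"


subsection \<open>The trilinear rational map, its boundary surfaces and its boundary lines\<close>

type_synonym weights = "2 \<Rightarrow> 2 \<Rightarrow> 2 \<Rightarrow> real"
type_synonym control_points = "2 \<Rightarrow> 2 \<Rightarrow> 2 \<Rightarrow> real^4"

definition trilinear ::
    "weights \<Rightarrow> control_points \<Rightarrow> complex^2 \<Rightarrow> complex^2 \<Rightarrow> complex^2 \<Rightarrow> complex^4" where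
  "trilinear w P s t u =
     (\<Sum>i\<in>UNIV. \<Sum>j\<in>UNIV. \<Sum>k\<in>UNIV.
        (complex_of_real (w i j k) * (s $ i) * (t $ j) * (u $ k)) *s cvec (P i j k))"

text \<open>\<open>axis 0 1\<close> is the point \<open>(1:0)\<close> and \<open>axis 1 1\<close> is the point \<open>(0:1)\<close>.\<close>

definition Sigma_surf :: "weights \<Rightarrow> control_points \<Rightarrow> 2 \<Rightarrow> (complex^4) set" where
  "Sigma_surf w P i =
     zariski_closure {x. x \<noteq> 0 \<and> (\<exists>t u. x = trilinear w P (axis i 1) t u)}"

definition T_surf :: "weights \<Rightarrow> control_points \<Rightarrow> 2 \<Rightarrow> (complex^4) set" where
  "T_surf w P j =
     zariski_closure {x. x \<noteq> 0 \<and> (\<exists>s u. x = trilinear w P s (axis j 1) u)}"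

definition Y_surf :: "weights \<Rightarrow> control_points \<Rightarrow> 2 \<Rightarrow> (complex^4) set" where
  "Y_surf w P k =
     zariski_closure {x. x \<noteq> 0 \<and> (\<exists>s t. x = trilinear w P s t (axis k 1))}"

definition join :: "real^4 \<Rightarrow> real^4 \<Rightarrow> (complex^4) set" where
  "join p q = vec.span {cvec p, cvec q}"

definition s_line :: "control_points \<Rightarrow> 2 \<Rightarrow> 2 \<Rightarrow> (complex^4) set" where
  "s_line P j k = join (P 0 j k) (P 1 j k)"

definition t_line :: "control_points \<Rightarrow> 2 \<Rightarrow> 2 \<Rightarrow> (complex^4) set" where
  "t_line P i k = join (P i 0 k) (P i 1 k)"

definition u_line :: "control_points \<Rightarrow> 2 \<Rightarrow> 2 \<Rightarrow> (complex^4) set" where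
  "u_line P i j = join (P i j 0) (P i j 1)"

definition boundary_surfaces :: "weights \<Rightarrow> control_points \<Rightarrow> (complex^4) set list" where
  "boundary_surfaces w P =
     [Sigma_surf w P 0, Sigma_surf w P 1, T_surf w P 0, T_surf w P 1, Y_surf w P 0, Y_surf w P 1]"

definition boundary_lines :: "control_points \<Rightarrow> (complex^4) set list" where
  "boundary_lines P =
     [s_line P 0 0, s_line P 0 1, s_line P 1 0, s_line P 1 1,
      t_line P 0 0, t_line P 0 1, t_line P 1 0, t_line P 1 1,
      u_line P 0 0, u_line P 0 1, u_line P 1 0, u_line P 1 1]"

definition nondegenerate :: "weights \<Rightarrow> control_points \<Rightarrow> bool" where
  "nondegenerate w P \<longleftrightarrow>
     (\<forall>S\<in>set (boundary_surfaces w P). smooth_surface S) \<and> distinct (boundary_surfaces w P) \<and>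
     (\<forall>L\<in>set (boundary_lines P). is_line L) \<and> distinct (boundary_lines P)"


subsection \<open>Scaffold maps\<close>

text \<open>
  The distinguished parameter is \<open>s\<close>. The two lines \<open>r 0\<close>, \<open>r 1\<close> are not determined by the
  map (at least their order is not), so they are an argument; the map is scaffold if they exist.
\<close>

definition scaffold ::
    "weights \<Rightarrow> control_points \<Rightarrow> (2 \<Rightarrow> (complex^4) set) \<Rightarrow> bool" where
  "scaffold w P r \<longleftrightarrow>
     (\<forall>i. is_plane (Sigma_surf w P i)) \<and>
     (\<forall>j. is_quadric (T_surf w P j)) \<and> (\<forall>k. is_quadric (Y_surf w P k)) \<and>
     is_line (Sigma_surf w P 0 \<inter> Sigma_surf w P 1) \<and>
     (\<forall>l. is_line (r l)) \<and> r 0 \<noteq> r 1 \<and>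
     (\<forall>l j k. meets (s_line P j k) (r l)) \<and>
     (\<forall>l. meets (r l) (Sigma_surf w P 0 \<inter> Sigma_surf w P 1))"

text \<open>The line through two points is the span of the union of their cones.\<close>

definition y_line :: "control_points \<Rightarrow> (complex^4) set" where
  "y_line P = vec.span ((u_line P 0 0 \<inter> u_line P 0 1) \<union> (u_line P 1 0 \<inter> u_line P 1 1))"

definition z_line :: "control_points \<Rightarrow> (complex^4) set" where
  "z_line P = vec.span ((t_line P 0 0 \<inter> t_line P 0 1) \<union> (t_line P 1 0 \<inter> t_line P 1 1))"

definition Delta :: "control_points \<Rightarrow> real^4 \<Rightarrow> 2 \<Rightarrow> 2 \<Rightarrow> 2 \<Rightarrow> real" where
  "Delta P n i j k = 1 / (n \<bullet> P i j k)"

text \<open>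
  \<open>a\<close>, \<open>b\<close>, \<open>g\<close> are homogeneous coordinates of points of the real projective line, and the weights
  only matter up to a common nonzero factor \<open>c\<close>.
\<close>

definition weights_factor ::
    "weights \<Rightarrow> real^2 \<Rightarrow> real^2 \<Rightarrow> real^2 \<Rightarrow> (2 \<Rightarrow> 2 \<Rightarrow> 2 \<Rightarrow> real) \<Rightarrow> bool" where
  "weights_factor w a b g D \<longleftrightarrow>
     (\<exists>c. c \<noteq> 0 \<and> (\<forall>i j k. w i j k = c * (a $ i * b $ j * g $ k * D i j k)))"


definition P1_points :: "('m \<Rightarrow> real^2) \<Rightarrow> bool" where
  "P1_points \<alpha> \<longleftrightarrow> (\<forall>m. \<alpha> m \<noteq> 0)"


subsection \<open>Birationality and type\<close>

definition pencil :: "(2 \<Rightarrow> poly4) \<Rightarrow> complex^4 \<Rightarrow> complex^2" where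
  "pencil A x = (\<chi> i. peval (A i) x)"

text \<open>
  Both composites are the identity as rational maps: the set of points where a composite is
  defined by the given formulas is Zariski open in an irreducible variety, hence dense as soon
  as it is nonempty, and the composite is the identity there.
\<close>

definition mutually_inverse ::
    "(complex^2 \<Rightarrow> complex^2 \<Rightarrow> complex^2 \<Rightarrow> complex^4) \<Rightarrow>
     (complex^4 \<Rightarrow> complex^2) \<Rightarrow> (complex^4 \<Rightarrow> complex^2) \<Rightarrow> (complex^4 \<Rightarrow> complex^2) \<Rightarrow> bool" where
  "mutually_inverse f a b c \<longleftrightarrow>
     (let dom1 = (\<lambda>s t u. s \<noteq> 0 \<and> t \<noteq> 0 \<and> u \<noteq> 0 \<and> f s t u \<noteq> 0 \<and>
                    a (f s t u) \<noteq> 0 \<and> b (f s t u) \<noteq> 0 \<and> c (f s t u) \<noteq> 0);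
          dom2 = (\<lambda>x. x \<noteq> 0 \<and> a x \<noteq> 0 \<and> b x \<noteq> 0 \<and> c x \<noteq> 0 \<and> f (a x) (b x) (c x) \<noteq> 0)
      in (\<exists>s t u. dom1 s t u) \<and>
         (\<forall>s t u. dom1 s t u \<longrightarrow>
            proj_eq (a (f s t u)) s \<and> proj_eq (b (f s t u)) t \<and> proj_eq (c (f s t u)) u) \<and>
         (\<exists>x. dom2 x) \<and>
         (\<forall>x. dom2 x \<longrightarrow> proj_eq (f (a x) (b x) (c x)) x))"

definition birational_of_type :: "weights \<Rightarrow> control_points \<Rightarrow> nat \<times> nat \<times> nat \<Rightarrow> bool" where
  "birational_of_type w P = (\<lambda>(d1, d2, d3).
     \<exists>A B C :: 2 \<Rightarrow> poly4.
       (\<forall>i. homogeneous d1 (A i)) \<and> (\<forall>j. homogeneous d2 (B j)) \<and> (\<forall>k. homogeneous d3 (C k)) \<and>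
       no_common_factor (A 0) (A 1) \<and> no_common_factor (B 0) (B 1) \<and> no_common_factor (C 0) (C 1) \<and>
       mutually_inverse (trilinear w P) (pencil A) (pencil B) (pencil C))"

end

theory Submission
  imports Defs "HOL-Computational_Algebra.Fundamental_Theorem_Algebra"
begin

text \<open>
  On each boundary plane the four control points satisfy one linear relation; scaling them by real
  factors \<open>c\<close> makes it \<open>v\<^sub>i\<^sub>0\<^sub>0 - v\<^sub>i\<^sub>0\<^sub>1 - v\<^sub>i\<^sub>1\<^sub>0 + v\<^sub>i\<^sub>1\<^sub>1 = 0\<close>. All conditions turn out to say that
  the tensor \<open>\<omega> = w / c\<close> has rank one.

  The planes \<open>\<theta>\<^sub>l\<close> and \<open>\<rho>\<^sub>l\<close> contain the diagonal points \<open>v\<^sub>i\<^sub>j\<^sub>0 - v\<^sub>i\<^sub>j\<^sub>1\<close> and \<open>v\<^sub>i\<^sub>0\<^sub>k - v\<^sub>i\<^sub>1\<^sub>k\<close>, and the ratio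
  \<open>\<theta>\<^sub>l / \<rho>\<^sub>l\<close> is constant along the lines \<open>s\<^sub>j\<^sub>k\<close>, which meet \<open>r\<^sub>l\<close>. Hence \<open>\<theta>\<^sub>l(v\<^sub>i\<^sub>j\<^sub>k) = A\<^sub>i \<tau>\<^sub>j\<close> and
  \<open>\<rho>\<^sub>l(v\<^sub>i\<^sub>j\<^sub>k) = A\<^sub>i \<kappa>\<^sub>k\<close> with the same \<open>A\<close>, so each weight condition says that \<open>\<omega>\<close> has rank one, and
  then all four hold simultaneously.

  Since \<open>r\<^sub>l\<close> also meets the intersection of the two boundary planes, the values \<open>\<sigma>\<^sub>0(v\<^sub>1\<^sub>j\<^sub>k)\<close> and
  \<open>\<sigma>\<^sub>1(v\<^sub>0\<^sub>j\<^sub>k)\<close> of their equations are proportional. If \<open>\<omega>\<close> has rank one, the control points can be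
  brought to a normal form in which the inverse is explicit. Conversely, the linear component of an
  inverse of type \<open>(1,2,2)\<close> forces \<open>\<omega>\<^sub>1\<^sub>j\<^sub>k\<close> to be proportional to \<open>\<omega>\<^sub>0\<^sub>j\<^sub>k\<close> for all but at most one \<open>(j,k)\<close>, and
  unless \<open>\<omega>\<^sub>i\<^sub>j\<^sub>k\<close> is a singular matrix for fixed \<open>i\<close>, both quadrics of the second component
  contain the boundary plane \<open>i\<close>, against the absence of a common factor.
\<close>

subsection \<open>The polynomial ring in four variables\<close>

lemma poly_mapping_sum_singles:
  fixes F :: "'k \<Rightarrow>\<^sub>0 'c::comm_monoid_add"
  shows "(\<Sum>m\<in>Poly_Mapping.keys F. Poly_Mapping.single m (Poly_Mapping.lookup F m)) = F"
  by (intro poly_mapping_eqI) (auto simp: lookup_sum lookup_single when_def in_keys_iff)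

text \<open>A map given on single terms and extended additively. Evaluation at a point and
  \<open>grade\<close> both have this shape, so additivity and multiplicativity are proved once,
  from the three laws of \<open>additive_coeffs\<close>.\<close>

definition msum :: "('k \<Rightarrow> 'c \<Rightarrow> 'b) \<Rightarrow> ('k \<Rightarrow>\<^sub>0 'c::zero) \<Rightarrow> 'b::comm_monoid_add" where
  "msum \<phi> F = (\<Sum>m\<in>Poly_Mapping.keys F. \<phi> m (Poly_Mapping.lookup F m))"

locale additive_coeffs =
  fixes \<phi> :: "'k::comm_monoid_add \<Rightarrow> 'c::comm_semiring_1 \<Rightarrow> 'b::comm_semiring_1"
  assumes zero: "\<phi> m 0 = 0"
    and add: "\<phi> m (c + d) = \<phi> m c + \<phi> m d"
    and mult: "\<phi> (m + n) (c * d) = \<phi> m c * \<phi> n d"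
begin

lemma msum_superset:
  assumes "finite K" "Poly_Mapping.keys F \<subseteq> K"
  shows "msum \<phi> F = (\<Sum>m\<in>K. \<phi> m (Poly_Mapping.lookup F m))"
  unfolding msum_def
  by (rule sum.mono_neutral_left) (use assms in \<open>auto simp: in_keys_iff zero\<close>)

lemma msum_zero: "msum \<phi> 0 = 0"
  by (simp add: msum_def)

lemma msum_add: "msum \<phi> (F + G) = msum \<phi> F + msum \<phi> G"
proof -
  let ?K = "Poly_Mapping.keys F \<union> Poly_Mapping.keys G"
  have "Poly_Mapping.keys (F + G) \<subseteq> ?K" by (rule Poly_Mapping.keys_add)
  then show ?thesis
    by (simp add: msum_superset[of ?K] lookup_add add sum.distrib)
qed

lemma msum_sum: "msum \<phi> (\<Sum>a\<in>A. F a) = (\<Sum>a\<in>A. msum \<phi> (F a))"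
  by (induction A rule: infinite_finite_induct) (auto simp: msum_add msum_zero)

lemma msum_single: "msum \<phi> (Poly_Mapping.single m c) = \<phi> m c"
  by (simp add: msum_def zero)

lemma msum_mult: "msum \<phi> (F * G) = msum \<phi> F * msum \<phi> G"
proof -
  have "F * G = (\<Sum>m\<in>Poly_Mapping.keys F. Poly_Mapping.single m (Poly_Mapping.lookup F m)) *
                (\<Sum>n\<in>Poly_Mapping.keys G. Poly_Mapping.single n (Poly_Mapping.lookup G n))"
    by (simp add: poly_mapping_sum_singles)
  also have "\<dots> = (\<Sum>m\<in>Poly_Mapping.keys F. \<Sum>n\<in>Poly_Mapping.keys G.
      Poly_Mapping.single (m + n) (Poly_Mapping.lookup F m * Poly_Mapping.lookup G n))"
    by (simp add: sum_product mult_single)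
  finally have "msum \<phi> (F * G) = (\<Sum>m\<in>Poly_Mapping.keys F. \<Sum>n\<in>Poly_Mapping.keys G.
      \<phi> m (Poly_Mapping.lookup F m) * \<phi> n (Poly_Mapping.lookup G n))"
    by (simp add: msum_sum msum_single mult)
  then show ?thesis by (simp add: msum_def sum_product)
qed

end

section \<open>Evaluation of polynomials\<close>

abbreviation mon :: "(4 \<Rightarrow>\<^sub>0 nat) \<Rightarrow> complex^4 \<Rightarrow> complex" where
  "mon m x \<equiv> (\<Prod>i\<in>UNIV. (x $ i) ^ Poly_Mapping.lookup m i)"

abbreviation tdeg :: "(4 \<Rightarrow>\<^sub>0 nat) \<Rightarrow> nat" where
  "tdeg m \<equiv> (\<Sum>i\<in>UNIV. Poly_Mapping.lookup m i)"

lemma tdeg_add: "tdeg (m + n) = tdeg m + tdeg n"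
  by (simp add: lookup_add sum.distrib)

lemma tdeg_single: "tdeg (Poly_Mapping.single i k) = k"
  by (simp add: lookup_single when_def)

interpretation peval: additive_coeffs "\<lambda>m c. c * mon m x" for x
  by standard (auto simp: lookup_add power_add prod.distrib algebra_simps)

lemma peval_msum: "peval F x = msum (\<lambda>m c. c * mon m x) F"
  by (simp add: peval_def msum_def)

lemma peval_simps:
  "peval 0 x = 0"
  "peval (F + G) x = peval F x + peval G x"
  "peval (F * G) x = peval F x * peval G x"
  "peval (Poly_Mapping.single m c) x = c * mon m x"
  by (simp_all add: peval_msum peval.msum_zero peval.msum_add peval.msum_mult peval.msum_single)

lemma peval_sum: "peval (\<Sum>a\<in>A. F a) x = (\<Sum>a\<in>A. peval (F a) x)"
  by (simp add: peval_msum peval.msum_sum)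

lemma peval_one: "peval 1 x = 1"
  using peval_simps(4)[of 0 1 x] by simp

lemma peval_uminus: "peval (- F) x = - peval F x"
  using peval_simps(2)[of F "- F" x] by (simp add: peval_simps add_eq_0_iff2)

lemma peval_diff: "peval (F - G) x = peval F x - peval G x"
  using peval_simps(2)[of F "- G" x] by (simp add: peval_uminus)

text \<open>Kronecker substitution: distinct monomials become distinct powers of one variable.\<close>

lemma digit_eq:
  fixes a b c d N :: nat
  assumes "a + N * b = c + N * d" "a < N" "c < N"
  shows "a = c \<and> b = d"
proof -
  have "(a + N * b) mod N = (c + N * d) mod N" "(a + N * b) div N = (c + N * d) div N"
    using assms(1) by simp_all
  then show ?thesis using assms(2,3) by simp
qed

lemma peval_eq_zero_imp:
  assumes "\<And>x. peval F x = 0"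
  shows "F = 0"
proof (rule ccontr)
  assume "F \<noteq> 0"
  then obtain m0 where m0: "m0 \<in> Poly_Mapping.keys F"
    by (metis keys_eq_empty ex_in_conv)
  \<comment> \<open>Larger than every exponent occurring in \<open>F\<close>, so that the exponents
    of a monomial are digits in base \<open>N\<close>.\<close>
  define N where "N = Suc (\<Sum>m\<in>Poly_Mapping.keys F. tdeg m)"
  have less: "Poly_Mapping.lookup m i < N" if "m \<in> Poly_Mapping.keys F" for m i
  proof -
    have "Poly_Mapping.lookup m i \<le> tdeg m" by (rule member_le_sum) auto
    also have "\<dots> \<le> (\<Sum>m\<in>Poly_Mapping.keys F. tdeg m)"
      using that by (intro member_le_sum) auto
    finally show ?thesis by (simp add: N_def)
  qed
  define e where "e m = Poly_Mapping.lookup m 1 + N * (Poly_Mapping.lookup m 2 +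
      N * (Poly_Mapping.lookup m 3 + N * Poly_Mapping.lookup m 4))" for m :: "4 \<Rightarrow>\<^sub>0 nat"
  have inj: "inj_on e (Poly_Mapping.keys F)"
  proof (rule inj_onI)
    fix m n assume m: "m \<in> Poly_Mapping.keys F" and n: "n \<in> Poly_Mapping.keys F" and eq: "e m = e n"
    note step = digit_eq[OF _ less[OF m] less[OF n]]
    from step[OF eq[unfolded e_def]] have 1: "Poly_Mapping.lookup m 1 = Poly_Mapping.lookup n 1"
      and "Poly_Mapping.lookup m 2 + N * (Poly_Mapping.lookup m 3 + N * Poly_Mapping.lookup m 4) =
           Poly_Mapping.lookup n 2 + N * (Poly_Mapping.lookup n 3 + N * Poly_Mapping.lookup n 4)"
      by auto
    from step[OF this(2)] have 2: "Poly_Mapping.lookup m 2 = Poly_Mapping.lookup n 2"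
      and "Poly_Mapping.lookup m 3 + N * Poly_Mapping.lookup m 4 =
           Poly_Mapping.lookup n 3 + N * Poly_Mapping.lookup n 4"
      by auto
    from step[OF this(2)] have 3: "Poly_Mapping.lookup m 3 = Poly_Mapping.lookup n 3"
      and 4: "Poly_Mapping.lookup m 4 = Poly_Mapping.lookup n 4"
      by auto
    have "Poly_Mapping.lookup m i = Poly_Mapping.lookup n i" for i
      using exhaust_4[of i] 1 2 3 4 by auto
    then show "m = n" by (simp add: poly_mapping_eqI)
  qed
  define p where "p = (\<Sum>m\<in>Poly_Mapping.keys F. Polynomial.monom (Poly_Mapping.lookup F m) (e m))"
  have "poly p z = 0" for z
  proof -
    \<comment> \<open>With the coordinates \<open>z\<close>, \<open>z ^ N\<close>,
      \<open>z ^ (N * N)\<close>, \<open>z ^ (N * N * N)\<close> the monomial \<open>m\<close>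
      becomes \<open>z ^ e m\<close>. The index \<open>4\<close> is the coordinate
      \<open>0\<close>.\<close>
    define x :: "complex^4" where
      "x = (\<chi> i. if i = 1 then z else if i = 2 then z ^ N else if i = 3 then z ^ (N * N) else z ^ (N * N * N))"
    have "mon m x = z ^ e m" for m
    proof -
      have x: "x $ 1 = z" "x $ 2 = z ^ N" "x $ 3 = z ^ (N * N)" "x $ 4 = z ^ (N * N * N)"
        by (simp_all add: x_def)
      have "e m = Poly_Mapping.lookup m 1 + (N * Poly_Mapping.lookup m 2 +
          (N * N * Poly_Mapping.lookup m 3 + N * N * N * Poly_Mapping.lookup m 4))"
        by (simp add: e_def distrib_left mult.assoc)
      then show ?thesis
        by (simp only: UNIV_4 power_add power_mult) (simp add: x power_mult)
    qed
    then have "poly p z = peval F x"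
      by (simp add: p_def peval_def poly_sum poly_monom)
    with assms show ?thesis by simp
  qed
  then have "p = 0" using poly_all_0_iff_0 by blast
  moreover have "coeff p (e m0) = Poly_Mapping.lookup F m0"
  proof -
    have "coeff p (e m0) = (\<Sum>m\<in>Poly_Mapping.keys F. if m = m0 then Poly_Mapping.lookup F m else 0)"
      unfolding p_def coeff_sum
      using inj m0 by (intro sum.cong) (auto dest: inj_onD)
    then show ?thesis using m0 by simp
  qed
  ultimately show False using m0 by (simp add: in_keys_iff)
qed

lemma peval_inject:
  assumes "\<And>x. peval F x = peval G x"
  shows "F = G"
  using peval_eq_zero_imp[of "F - G"] assms by (simp add: peval_diff)

text \<open>\<open>grade F\<close> is \<open>F (z x)\<close> as a polynomial in \<open>z\<close>; homogeneous polynomials become monomials in \<open>z\<close>,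
  and in a domain every factor of a monomial is a monomial.\<close>

abbreviation grade :: "poly4 \<Rightarrow> poly4 Polynomial.poly" where
  "grade \<equiv> msum (\<lambda>m c. Polynomial.monom (Poly_Mapping.single m c) (tdeg m))"

interpretation grade: additive_coeffs "\<lambda>m c. Polynomial.monom (Poly_Mapping.single m (c::complex)) (tdeg m)"
  by standard (auto simp: single_add add_monom mult_monom mult_single tdeg_add[simplified])

lemma lookup_coeff_grade:
  "Poly_Mapping.lookup (coeff (grade F) k) m = (Poly_Mapping.lookup F m when tdeg m = k)"
proof -
  have "Poly_Mapping.lookup (coeff (grade F) k) m =
      (\<Sum>n\<in>Poly_Mapping.keys F. if n = m then (Poly_Mapping.lookup F m when tdeg m = k) else 0)"
    unfolding msum_def coeff_sum lookup_sum
    by (intro sum.cong) (auto simp: lookup_single when_def)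
  also have "\<dots> = (Poly_Mapping.lookup F m when tdeg m = k)"
    by (auto simp: in_keys_iff when_def)
  finally show ?thesis .
qed

lemma grade_homogeneous:
  assumes "homogeneous d F"
  shows "grade F = Polynomial.monom F d"
  using assms
  by (intro poly_eqI poly_mapping_eqI)
     (auto simp: lookup_coeff_grade homogeneous_def when_def in_keys_iff)

lemma homogeneous_if_grade_monom:
  assumes "grade F = Polynomial.monom G d"
  shows "homogeneous d F"
  unfolding homogeneous_def
proof
  fix m assume "m \<in> Poly_Mapping.keys F"
  then have "Poly_Mapping.lookup (coeff (grade F) (tdeg m)) m \<noteq> 0"
    by (subst lookup_coeff_grade) (simp add: in_keys_iff)
  then show "tdeg m = d" unfolding assms by (auto split: if_splits)
qed

text \<open>The order of vanishing at 0 is at most the degree, and both are additive on products.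
  They agree for a monomial, hence for each factor, and a polynomial whose order equals its degree
  is a monomial.\<close>

lemma factors_of_monom:
  fixes p q :: "'a::idom Polynomial.poly"
  assumes "p * q = Polynomial.monom c n" "c \<noteq> 0"
  shows "p = Polynomial.monom (lead_coeff p) (Polynomial.degree p)"
proof -
  have nz: "p \<noteq> 0" "q \<noteq> 0" and nz': "p * q \<noteq> 0"
    using assms by auto
  have "n = Polynomial.degree p + Polynomial.degree q"
    using degree_mult_eq[OF nz] assms by (simp add: degree_monom_eq)
  moreover have "order 0 p + order 0 q = n"
  proof -
    have "order 0 (Polynomial.monom c n) = n"
      using assms(2) by (metis order_0_monom)
    then show ?thesis using order_mult[OF nz'] assms(1) by simp
  qed
  moreover have "order 0 p \<le> Polynomial.degree p" "order 0 q \<le> Polynomial.degree q"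
    using nz by (auto intro: order_degree)
  ultimately have ord: "order 0 p = Polynomial.degree p" by linarith
  have "[:- 0, 1:] ^ order 0 p dvd p" by (rule order_1)
  then have dv: "Polynomial.monom 1 (Polynomial.degree p) dvd p"
    by (simp add: ord monom_altdef)
  then have "coeff p k = 0" if "k < Polynomial.degree p" for k
    using that by (simp add: monom_1_dvd_iff')
  then show ?thesis
    by (intro poly_eqI) (metis coeff_eq_0 coeff_monom linorder_neqE_nat)
qed

text \<open>\<open>grade\<close> is multiplicative, so \<open>grade D\<close> and
  \<open>grade E\<close> are factors of a monomial; their degrees in the extra variable are
  \<open>k\<close> and \<open>l\<close>.\<close>

lemma homogeneous_factor:
  assumes "homogeneous d (D * E)" "D * E \<noteq> 0"
  obtains k l where "k + l = d" "homogeneous k D" "homogeneous l E"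
proof -
  have eq: "grade D * grade E = Polynomial.monom (D * E) d"
    using grade_homogeneous[OF assms(1)] by (simp add: grade.msum_mult)
  have D: "grade D = Polynomial.monom (lead_coeff (grade D)) (Polynomial.degree (grade D))"
    by (rule factors_of_monom[OF eq assms(2)])
  have E: "grade E = Polynomial.monom (lead_coeff (grade E)) (Polynomial.degree (grade E))"
    by (rule factors_of_monom[of _ "grade D"]) (use eq assms(2) in \<open>auto simp: mult.commute\<close>)
  have nz: "grade D \<noteq> 0" "grade E \<noteq> 0" using eq assms(2) by auto
  have "Polynomial.degree (grade D) + Polynomial.degree (grade E) = d"
    using degree_mult_eq[OF nz] eq assms(2) by (simp add: degree_monom_eq)
  then show ?thesis
    using that homogeneous_if_grade_monom[OF D] homogeneous_if_grade_monom[OF E] by blast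
qed

section \<open>Forms of degree zero, one and two\<close>

lemma homogeneous_0:
  assumes "homogeneous 0 F"
  obtains c where "F = Poly_Mapping.single 0 c"
proof -
  have "m = 0" if "m \<in> Poly_Mapping.keys F" for m
    using assms that by (intro poly_mapping_eqI) (auto simp: homogeneous_def)
  then have "F = Poly_Mapping.single 0 (Poly_Mapping.lookup F 0)"
    by (intro poly_mapping_eqI) (metis in_keys_iff lookup_single_eq lookup_single_not_eq)
  with that show ?thesis .
qed

lemma homogeneous_unique:
  assumes "homogeneous d F" "homogeneous e F" "F \<noteq> 0"
  shows "d = e"
  using assms unfolding homogeneous_def by (metis keys_eq_empty ex_in_conv)

lemma homogeneous_add: "homogeneous d F \<Longrightarrow> homogeneous d G \<Longrightarrow> homogeneous d (F + G)"
  using Poly_Mapping.keys_add[of F G] unfolding homogeneous_def by blast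

lemma homogeneous_uminus: "homogeneous d F \<Longrightarrow> homogeneous d (- F)"
  by (auto simp: homogeneous_def in_keys_iff)

lemma homogeneous_diff: "homogeneous d F \<Longrightarrow> homogeneous d G \<Longrightarrow> homogeneous d (F - G)"
  using homogeneous_add[of d F "- G"] homogeneous_uminus[of d G] by simp

lemma homogeneous_mult: "homogeneous d F \<Longrightarrow> homogeneous e G \<Longrightarrow> homogeneous (d + e) (F * G)"
  by (rule homogeneous_if_grade_monom[where G = "F * G"])
     (simp add: grade.msum_mult grade_homogeneous mult_monom)

text \<open>The bilinear pairing without conjugation: vectors and linear forms share one type, and
  either argument may play the role of the form.\<close>

definition lform :: "complex^'n \<Rightarrow> complex^'n \<Rightarrow> complex" where
  "lform c x = (\<Sum>i\<in>UNIV. c $ i * x $ i)"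

lemma lform_simps:
  "lform c (x + y) = lform c x + lform c y"
  "lform c (x - y) = lform c x - lform c y"
  "lform c (- x) = - lform c x"
  "lform c (a *s x) = a * lform c x"
  "lform c 0 = 0"
  by (simp_all add: lform_def algebra_simps sum.distrib sum_subtractf sum_negf sum_distrib_left)

lemma lform_simps_left:
  "lform (c + d) x = lform c x + lform d x"
  "lform (c - d) x = lform c x - lform d x"
  "lform (- c) x = - lform c x"
  "lform (a *s c) x = a * lform c x"
  "lform 0 x = 0"
  by (simp_all add: lform_def algebra_simps sum.distrib sum_subtractf sum_negf sum_distrib_left)

lemma lform_sum: "lform c (\<Sum>a\<in>A. x a) = (\<Sum>a\<in>A. lform c (x a))"
  by (induction A rule: infinite_finite_induct) (auto simp: lform_simps)

lemma lform_axis: "lform c (axis i 1) = c $ i"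
  by (simp add: lform_def axis_def if_distrib[of "\<lambda>y. _ * y"] cong: if_cong)

lemma lform_axis_left: "lform (axis i 1) x = x $ i"
  by (simp add: lform_def axis_def if_distrib[of "\<lambda>y. y * _"] cong: if_cong)

lemma lform_eq_zero_imp: "(\<And>x. lform c x = 0) \<Longrightarrow> c = 0"
  by (metis lform_axis vec_eq_iff zero_index)

definition lpoly :: "complex^4 \<Rightarrow> poly4" where
  "lpoly c = (\<Sum>i\<in>UNIV. Poly_Mapping.single (Poly_Mapping.single i 1) (c $ i))"

lemma mon_single: "mon (Poly_Mapping.single i 1) x = x $ i"
proof -
  have "mon (Poly_Mapping.single i 1) x = (\<Prod>j\<in>UNIV. if j = i then x $ i else 1)"
    by (intro prod.cong) (auto simp: lookup_single when_def)
  then show ?thesis by simp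
qed

lemma peval_lpoly: "peval (lpoly c) x = lform c x"
  unfolding lpoly_def lform_def peval_sum peval_simps mon_single ..

lemma homogeneous_single: "tdeg m = d \<Longrightarrow> homogeneous d (Poly_Mapping.single m c)"
  by (auto simp: homogeneous_def)

lemma homogeneous_zero: "homogeneous d 0"
  by (simp add: homogeneous_def)

lemma homogeneous_sum: "(\<And>a. a \<in> A \<Longrightarrow> homogeneous d (F a)) \<Longrightarrow> homogeneous d (\<Sum>a\<in>A. F a)"
  by (induction A rule: infinite_finite_induct)
     (auto intro: homogeneous_add homogeneous_zero)

lemma homogeneous_lpoly: "homogeneous 1 (lpoly c)"
  unfolding lpoly_def by (intro homogeneous_sum homogeneous_single tdeg_single)

lemma tdeg_Suc_obtain:
  assumes "tdeg m = Suc k"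
  obtains i n where "m = Poly_Mapping.single i 1 + n" "tdeg n = k"
proof -
  obtain i where i: "Poly_Mapping.lookup m i \<noteq> 0"
    using assms by (metis sum.neutral nat.distinct(1))
  define n where "n = m - Poly_Mapping.single i 1"
  have "m = Poly_Mapping.single i 1 + n"
    using i by (intro poly_mapping_eqI) (auto simp: n_def lookup_add lookup_minus lookup_single when_def)
  moreover from this have "tdeg n = k"
    using assms tdeg_add[of "Poly_Mapping.single i 1" n] tdeg_single[of i 1] by simp
  ultimately show ?thesis using that by blast
qed

lemma tdeg_0: "tdeg m = 0 \<Longrightarrow> m = 0"
  by (intro poly_mapping_eqI) auto

lemma homogeneous_1:
  assumes "homogeneous 1 F"
  obtains c where "F = lpoly c"
proof -
  have "\<exists>c. lpoly c = Poly_Mapping.single m a" if m: "tdeg m = 1" for m a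
  proof -
    obtain i where i: "m = Poly_Mapping.single i 1"
      using m tdeg_Suc_obtain[of m 0] tdeg_0 by (metis One_nat_def add.right_neutral)
    have "lpoly (a *s axis i 1) = Poly_Mapping.single m a"
      by (rule peval_inject) (simp add: i peval_lpoly peval_simps mon_single[simplified]
          lform_simps_left lform_axis_left)
    then show ?thesis by blast
  qed
  then have "\<forall>m. \<exists>c. tdeg m = 1 \<longrightarrow> lpoly c = Poly_Mapping.single m (Poly_Mapping.lookup F m)"
    by blast
  from choice[OF this] obtain c where
    c: "tdeg m = 1 \<Longrightarrow> lpoly (c m) = Poly_Mapping.single m (Poly_Mapping.lookup F m)" for m
    by blast
  have "F = (\<Sum>m\<in>Poly_Mapping.keys F. lpoly (c m))"
    using assms by (subst poly_mapping_sum_singles[symmetric]) (simp add: c homogeneous_def)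
  also have "\<dots> = lpoly (\<Sum>m\<in>Poly_Mapping.keys F. c m)"
    by (rule peval_inject) (simp add: peval_sum peval_lpoly lform_def sum_distrib_right sum.swap[of _ UNIV])
  finally show ?thesis using that by blast
qed

text \<open>Linearity in the second argument is encoded by a representing vector, which also gives
  the linear form needed as a cofactor later; linearity in the first argument follows by
  symmetry.\<close>

definition symmetric_bilinear :: "(complex^4 \<Rightarrow> complex^4 \<Rightarrow> complex) \<Rightarrow> bool" where
  "symmetric_bilinear Q \<longleftrightarrow> (\<forall>x y. Q x y = Q y x) \<and> (\<forall>x. \<exists>c. \<forall>y. Q x y = lform c y)"

lemma homogeneous_2:
  assumes "homogeneous 2 F"
  obtains Q where "symmetric_bilinear Q" "\<And>x. peval F x = Q x x"
proof -
  have "\<exists>Q. symmetric_bilinear Q \<and> (\<forall>x. peval (Poly_Mapping.single m a) x = Q x x)" if m: "tdeg m = 2" for m a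
  proof -
    obtain i n where i: "m = Poly_Mapping.single i 1 + n" "tdeg n = 1"
      using m tdeg_Suc_obtain[of m 1] by (metis Suc_1)
    obtain j where j: "n = Poly_Mapping.single j 1"
      using i(2) tdeg_Suc_obtain[of n 0] tdeg_0 by (metis One_nat_def add.right_neutral)
    \<comment> \<open>The symmetrized monomial; the factor one half makes its diagonal equal to
      \<open>a * x $ i * x $ j\<close>, also for \<open>i = j\<close>.\<close>
    define Q where "Q x y = a / 2 * (x $ i * y $ j + x $ j * y $ i)" for x y :: "complex^4"
    have "\<exists>c. \<forall>y. Q x y = lform c y" for x
    proof (intro exI allI)
      fix y
      show "Q x y = lform ((a / 2 * x $ i) *s axis j 1 + (a / 2 * x $ j) *s axis i 1) y"
        by (simp add: lform_simps_left Q_def lform_axis_left algebra_simps)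
    qed
    moreover have "mon m x = x $ i * x $ j" for x
      unfolding i(1) j using mon_single[where i = i and x = x] mon_single[where i = j and x = x]
      by (simp add: lookup_add power_add prod.distrib)
    ultimately show ?thesis
      by (intro exI[of _ Q]) (auto simp: symmetric_bilinear_def peval_simps Q_def)
  qed
  then have "\<forall>m. \<exists>Q. tdeg m = 2 \<longrightarrow> symmetric_bilinear Q \<and>
      (\<forall>x. peval (Poly_Mapping.single m (Poly_Mapping.lookup F m)) x = Q x x)"
    by blast
  from choice[OF this] obtain Q where Q: "tdeg m = 2 \<Longrightarrow> symmetric_bilinear (Q m) \<and>
      (\<forall>x. peval (Poly_Mapping.single m (Poly_Mapping.lookup F m)) x = Q m x x)" for m
    by blast
  have Qk: "symmetric_bilinear (Q m)" "peval (Poly_Mapping.single m (Poly_Mapping.lookup F m)) x = Q m x x"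
    if "m \<in> Poly_Mapping.keys F" for m x
    using assms that Q unfolding homogeneous_def by blast+
  define R where "R x y = (\<Sum>m\<in>Poly_Mapping.keys F. Q m x y)" for x y
  have "peval F x = R x x" for x
    using Qk(2) by (subst poly_mapping_sum_singles[symmetric]) (simp add: peval_sum R_def)
  moreover have "symmetric_bilinear R"
    unfolding symmetric_bilinear_def
  proof (intro conjI allI)
    show "R x y = R y x" for x y
      unfolding R_def using Qk(1) by (intro sum.cong) (auto simp: symmetric_bilinear_def)
    fix x
    have "\<forall>m. \<exists>c. m \<in> Poly_Mapping.keys F \<longrightarrow> (\<forall>y. Q m x y = lform c y)"
      using Qk(1) unfolding symmetric_bilinear_def by blast
    from choice[OF this] obtain c where
      c: "m \<in> Poly_Mapping.keys F \<Longrightarrow> Q m x y = lform (c m) y" for m y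
      by blast
    have "R x y = lform (\<Sum>m\<in>Poly_Mapping.keys F. c m) y" for y
      by (simp add: R_def c lform_def sum_distrib_right sum.swap[of _ UNIV])
    then show "\<exists>c. \<forall>y. R x y = lform c y" by blast
  qed
  ultimately show ?thesis using that by blast
qed

lemma symmetric_bilinear_simps:
  assumes "symmetric_bilinear Q"
  shows "Q x (y + z) = Q x y + Q x z" "Q (x + y) z = Q x z + Q y z"
    "Q x (y - z) = Q x y - Q x z" "Q (x - y) z = Q x z - Q y z"
    "Q x (a *s y) = a * Q x y" "Q (a *s x) y = a * Q x y"
proof -
  have sym: "\<And>x y. Q x y = Q y x" using assms by (simp add: symmetric_bilinear_def)
  obtain c where c: "\<And>x y. Q x y = lform (c x) y"
    using assms unfolding symmetric_bilinear_def by metis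
  show right: "Q x (y + z) = Q x y + Q x z" "Q x (y - z) = Q x y - Q x z" "Q x (a *s y) = a * Q x y"
    for x y z a
    by (simp_all add: c lform_simps)
  show "Q (x + y) z = Q x z + Q y z" "Q (x - y) z = Q x z - Q y z" "Q (a *s x) y = a * Q x y"
    using right sym by metis+
qed

section \<open>Quadrics and planes\<close>

text \<open>Split \<open>x = a *s e + y\<close> with \<open>y\<close> in the plane and
  \<open>a = lform \<sigma> x\<close>. The term \<open>Q y y\<close> vanishes and the other terms
  contain the factor \<open>a\<close>.\<close>

lemma lpoly_dvd_quadratic:
  assumes F: "homogeneous 2 F" and "\<sigma> \<noteq> 0" and van: "\<And>x. lform \<sigma> x = 0 \<Longrightarrow> peval F x = 0"
  obtains c where "F = lpoly \<sigma> * lpoly c"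
proof -
  obtain Q where Q: "symmetric_bilinear Q" and FQ: "\<And>x. peval F x = Q x x"
    using homogeneous_2[OF F] by blast
  note Qs = symmetric_bilinear_simps[OF Q]
  have sym: "\<And>x y. Q x y = Q y x" using Q by (simp add: symmetric_bilinear_def)
  obtain e0 where "lform \<sigma> e0 \<noteq> 0" using lform_eq_zero_imp \<open>\<sigma> \<noteq> 0\<close> by blast
  then obtain e where e: "lform \<sigma> e = 1"
    using that by (metis lform_simps(4) left_inverse)
  obtain c where c: "\<And>y. Q e y = lform c y"
    using Q unfolding symmetric_bilinear_def by metis
  \<comment> \<open>The cofactor is \<open>a * Q e e + 2 * Q e y\<close>, rewritten in
    \<open>x\<close> by means of \<open>Q e y = lform c x - a * Q e e\<close>.\<close>
  have "F = lpoly \<sigma> * lpoly (2 *s c - Q e e *s \<sigma>)"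
  proof (rule peval_inject)
    fix x
    define a where "a = lform \<sigma> x"
    define y where "y = x - a *s e"
    have x: "x = a *s e + y" by (simp add: y_def)
    have "Q y y = 0" using van[of y] by (simp add: y_def lform_simps e a_def FQ)
    then have "peval F x = a * (a * Q e e + 2 * Q e y)"
      by (simp add: FQ x Qs sym[of y e] algebra_simps)
    also have "Q e y = lform c x - a * Q e e"
      by (simp add: y_def Qs c)
    finally show "peval F x = peval (lpoly \<sigma> * lpoly (2 *s c - Q e e *s \<sigma>)) x"
      by (simp add: peval_simps peval_lpoly lform_simps_left a_def algebra_simps)
  qed
  then show ?thesis using that by blast
qed

text \<open>A linear form vanishes at the origin and a unit does not.\<close>

lemma not_unit_lpoly: "\<not> lpoly c dvd 1"
proof
  assume "lpoly c dvd 1"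
  then obtain D where "1 = lpoly c * D" by (auto simp: dvd_def)
  then have "peval 1 0 = peval (lpoly c * D) 0" by simp
  then show False by (simp add: peval_one peval_simps peval_lpoly lform_simps)
qed

text \<open>For \<open>x\<close> off the plane and \<open>v\<close> in it, the line
  \<open>x + z *s v\<close> never meets the plane, so \<open>F\<close> has no zero on it. If
  \<open>peval F v\<close> were nonzero, this would be a nonconstant polynomial in \<open>z\<close>
  without a root. Hence \<open>F\<close> vanishes on the plane and splits into two linear
  factors.\<close>

lemma irreducible_quadric_not_in_plane:
  assumes F: "homogeneous 2 F" "irreducible F" and "\<sigma> \<noteq> 0"
    and sub: "\<And>x. peval F x = 0 \<Longrightarrow> lform \<sigma> x = 0"
  shows False
proof -
  obtain Q where Q: "symmetric_bilinear Q" and FQ: "\<And>x. peval F x = Q x x"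
    using homogeneous_2[OF F(1)] by blast
  note Qs = symmetric_bilinear_simps[OF Q]
  have sym: "\<And>x y. Q x y = Q y x" using Q by (simp add: symmetric_bilinear_def)
  obtain x where x: "lform \<sigma> x \<noteq> 0" using lform_eq_zero_imp \<open>\<sigma> \<noteq> 0\<close> by blast
  have van: "peval F v = 0" if v: "lform \<sigma> v = 0" for v
  proof (rule ccontr)
    assume nz: "peval F v \<noteq> 0"
    define p where "p = [:Q x x, 2 * Q x v, Q v v:]"
    have "Polynomial.degree p \<noteq> 0" using nz by (simp add: p_def FQ)
    then obtain z where "poly p z = 0"
      using fundamental_theorem_of_algebra[of p] by (auto simp: constant_degree)
    then have "peval F (x + z *s v) = 0"
      by (simp add: FQ Qs sym[of v x] p_def algebra_simps)
    then have "lform \<sigma> (x + z *s v) = 0" by (rule sub)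
    with v x show False by (simp add: lform_simps)
  qed
  obtain c where "F = lpoly \<sigma> * lpoly c"
    using lpoly_dvd_quadratic[OF F(1) \<open>\<sigma> \<noteq> 0\<close> van] by blast
  with F(2) show False using not_unit_lpoly by (auto dest: irreducibleD)
qed

subsection \<open>Linear forms and bases\<close>

text \<open>The library enumerates the type \<open>2\<close> as 1 and 2, whereas the indices here
  are 0 and 1; this equation translates between the two.\<close>

lemma two_eq_zero: "(2::2) = 0"
  by simp

lemma forall_2': "(\<forall>i::2. P i) \<longleftrightarrow> P 0 \<and> P 1"
  using forall_2[of P] two_eq_zero by auto

lemma sum_2': "sum f (UNIV::2 set) = f 0 + f 1"
  by (simp add: sum_2 two_eq_zero add.commute)

lemma vec_eq_2: "x = y \<longleftrightarrow> x $ 0 = y $ 0 \<and> x $ 1 = y $ 1" for x y :: "'a^2"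
  by (simp add: vec_eq_iff forall_2')

definition vec2 :: "'a \<Rightarrow> 'a \<Rightarrow> 'a^2" where
  "vec2 x y = (\<chi> i. if i = 0 then x else y)"

lemma vec2_nth [simp]: "vec2 x y $ 0 = x" "vec2 x y $ 1 = y"
  by (simp_all add: vec2_def)

text \<open>Spanning is stated dually, as the absence of a plane through the four vectors, because
  this is the form in which it follows from a boundary surface being a quadric.\<close>

definition spanning4 :: "complex^4 \<Rightarrow> complex^4 \<Rightarrow> complex^4 \<Rightarrow> complex^4 \<Rightarrow> bool" where
  "spanning4 v1 v2 v3 v4 \<longleftrightarrow>
     (\<forall>c. lform c v1 = 0 \<and> lform c v2 = 0 \<and> lform c v3 = 0 \<and> lform c v4 = 0 \<longrightarrow> c = 0)"

definition dual_basis ::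
    "(complex^4) \<times> (complex^4) \<times> (complex^4) \<times> (complex^4) \<Rightarrow> complex^4 \<Rightarrow> complex^4 \<Rightarrow> complex^4 \<Rightarrow> complex^4 \<Rightarrow> bool" where
  "dual_basis = (\<lambda>(c1, c2, c3, c4) v1 v2 v3 v4.
     lform c1 v1 = 1 \<and> lform c1 v2 = 0 \<and> lform c1 v3 = 0 \<and> lform c1 v4 = 0 \<and>
     lform c2 v1 = 0 \<and> lform c2 v2 = 1 \<and> lform c2 v3 = 0 \<and> lform c2 v4 = 0 \<and>
     lform c3 v1 = 0 \<and> lform c3 v2 = 0 \<and> lform c3 v3 = 1 \<and> lform c3 v4 = 0 \<and>
     lform c4 v1 = 0 \<and> lform c4 v2 = 0 \<and> lform c4 v3 = 0 \<and> lform c4 v4 = 1 \<and>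
     (\<forall>x. x = lform c1 x *s v1 + lform c2 x *s v2 + lform c3 x *s v3 + lform c4 x *s v4))"

lemma lform_commute: "lform c x = lform x c"
  by (simp add: lform_def mult.commute)

lemma matrix_vector_lform: "(A *v x) $ i = lform (A $ i) x"
  by (simp add: matrix_vector_mult_def lform_def)

text \<open>The matrix with rows \<open>v1\<close>, ..., \<open>v4\<close> has trivial kernel, hence
  is invertible; the columns of its inverse are the dual basis.\<close>

lemma spanning4_dual_basis:
  assumes "spanning4 v1 v2 v3 v4"
  obtains c1 c2 c3 c4 where "dual_basis (c1, c2, c3, c4) v1 v2 v3 v4"
proof -
  define v :: "4 \<Rightarrow> complex^4" where
    "v i = (if i = 1 then v1 else if i = 2 then v2 else if i = 3 then v3 else v4)" for i
  define A :: "complex^4^4" where "A = (\<chi> i. v i)"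
  have v: "v 1 = v1" "v 2 = v2" "v 3 = v3" "v 4 = v4"
    by (simp_all add: v_def)
  have "\<forall>x. A *v x = 0 \<longrightarrow> x = 0"
  proof (intro allI impI)
    fix x assume "A *v x = 0"
    then have "lform x (v i) = 0" for i
      using matrix_vector_lform[of A x i] by (simp add: A_def lform_commute)
    from this[of 1] this[of 2] this[of 3] this[of 4] show "x = 0"
      using assms unfolding spanning4_def v by blast
  qed
  then obtain B where BA: "B ** A = mat 1"
    unfolding matrix_left_invertible_ker[symmetric] by blast
  then have AB: "A ** B = mat 1" by (simp add: matrix_left_right_inverse)
  define c where "c j = (\<chi> i. B $ i $ j)" for j
  have delta: "lform (c j) (v i) = (if i = j then 1 else 0)" for i j
  proof -
    have "lform (c j) (v i) = (A ** B) $ i $ j"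
      by (simp add: lform_def c_def matrix_matrix_mult_def A_def mult.commute)
    then show ?thesis by (simp add: AB mat_def)
  qed
  have "x = (\<Sum>j\<in>UNIV. lform (c j) x *s v j)" for x
  proof -
    have "x = x v* (B ** A)" by (simp add: BA)
    also have "\<dots> = (x v* B) v* A" by (simp add: vector_matrix_mul_assoc)
    also have "\<dots> = (\<Sum>j\<in>UNIV. lform (c j) x *s v j)"
      by (simp add: vec_eq_iff vector_matrix_mult_def lform_def c_def A_def mult.commute)
    finally show ?thesis .
  qed
  then have "\<forall>x. x = lform (c 1) x *s v 1 + lform (c 2) x *s v 2 + lform (c 3) x *s v 3 + lform (c 4) x *s v 4"
    by (simp add: sum_4)
  then have "dual_basis (c 1, c 2, c 3, c 4) (v 1) (v 2) (v 3) (v 4)"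
    unfolding dual_basis_def prod.case by (simp add: delta)
  then show ?thesis unfolding v by (rule that)
qed

lemma spanning4_independent:
  assumes "spanning4 v1 v2 v3 v4" "x1 *s v1 + x2 *s v2 + x3 *s v3 + x4 *s v4 = 0"
  shows "x1 = 0 \<and> x2 = 0 \<and> x3 = 0 \<and> x4 = 0"
proof -
  obtain c1 c2 c3 c4 where "dual_basis (c1, c2, c3, c4) v1 v2 v3 v4"
    using spanning4_dual_basis[OF assms(1)] .
  then have
    "lform c1 (x1 *s v1 + x2 *s v2 + x3 *s v3 + x4 *s v4) = x1"
    "lform c2 (x1 *s v1 + x2 *s v2 + x3 *s v3 + x4 *s v4) = x2"
    "lform c3 (x1 *s v1 + x2 *s v2 + x3 *s v3 + x4 *s v4) = x3"
    "lform c4 (x1 *s v1 + x2 *s v2 + x3 *s v3 + x4 *s v4) = x4"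
    by (simp_all add: dual_basis_def lform_simps)
  then show ?thesis unfolding assms(2) by (simp add: lform_simps)
qed

text \<open>Listing the third form twice gives four dependent vectors, which cannot span; the
  witness that they do not is the common zero.\<close>

lemma common_zero_of_three_forms:
  fixes c1 c2 c3 :: "complex^4"
  obtains x where "x \<noteq> 0" "lform c1 x = 0" "lform c2 x = 0" "lform c3 x = 0"
proof -
  have "\<not> spanning4 c1 c2 c3 c3"
  proof
    assume "spanning4 c1 c2 c3 c3"
    from spanning4_independent[OF this, of 0 0 1 "-1"] show False by simp
  qed
  then show ?thesis using that unfolding spanning4_def by (metis lform_commute)
qed

subsection \<open>Common factors\<close>

lemma homogeneous_0_unit:
  assumes "homogeneous 0 D" "D \<noteq> 0"
  shows "D dvd 1"
proof -
  obtain c where c: "D = Poly_Mapping.single 0 c" using assms homogeneous_0 by blast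
  with assms have "c \<noteq> 0" by auto
  then have "1 = D * Poly_Mapping.single 0 (inverse c)"
    by (simp add: c mult_single flip: single_one)
  then show ?thesis by (rule dvdI)
qed

text \<open>A common factor is homogeneous of degree 0, 1 or 2. In degree 0 it is a unit, in degree
  1 it splits \<open>X\<close> into linear forms, and in degree 2 it makes \<open>Y\<close> a
  constant multiple of \<open>X\<close>.\<close>

lemma no_common_factor_quadratic:
  assumes X: "homogeneous 2 X" and Y: "homogeneous 2 Y"
    and irred: "\<And>c d. X \<noteq> lpoly c * lpoly d"
    and notprop: "\<And>c. Y \<noteq> Poly_Mapping.single 0 c * X"
  shows "no_common_factor Y X"
  unfolding no_common_factor_def
proof (intro allI impI)
  fix D assume "D dvd Y \<and> D dvd X"
  then obtain E E' where XE: "X = D * E" and YE: "Y = D * E'" by (auto simp: dvd_def)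
  have X0: "X \<noteq> 0" using irred[of 0 0] by (auto simp: lpoly_def)
  have Y0: "Y \<noteq> 0" using notprop[of 0] by auto
  obtain k l where kl: "k + l = 2" and D: "homogeneous k D" and E: "homogeneous l E"
    using homogeneous_factor[of 2 D E] X X0 XE by metis
  obtain k' l' where kl': "k' + l' = 2" and D': "homogeneous k' D" and E': "homogeneous l' E'"
    using homogeneous_factor[of 2 D E'] Y Y0 YE by metis
  have "D \<noteq> 0" using X0 XE by auto
  then have "k' = k" using homogeneous_unique[OF D' D] by simp
  consider "k = 0" | "k = 1" "l = 1" | "k = 2" "l = 0" "l' = 0"
    using kl kl' \<open>k' = k\<close> by force
  then show "D dvd 1"
  proof cases
    case 1
    then show ?thesis using homogeneous_0_unit D \<open>D \<noteq> 0\<close> by blast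
  next
    case 2
    then show ?thesis using D E XE irred homogeneous_1 by metis
  next
    case 3
    then obtain c c' where c: "E = Poly_Mapping.single 0 c" "E' = Poly_Mapping.single 0 c'"
      using E E' homogeneous_0 by metis
    have "c \<noteq> 0" using X0 XE c by auto
    then have "Y = Poly_Mapping.single 0 (c' / c) * X"
      by (simp add: XE YE c mult.left_commute[of _ D] mult_single)
    then show ?thesis using notprop by blast
  qed
qed

text \<open>A common factor of degree 1 would make the two forms proportional, so only units
  remain.\<close>

lemma no_common_factor_linear:
  assumes indep: "\<And>x y. x *s a + y *s b = 0 \<Longrightarrow> x = 0 \<and> y = 0"
  shows "no_common_factor (lpoly a) (lpoly b)"
  unfolding no_common_factor_def
proof (intro allI impI)
  fix D assume "D dvd lpoly a \<and> D dvd lpoly b"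
  then obtain E E' where XE: "lpoly a = D * E" and YE: "lpoly b = D * E'" by (auto simp: dvd_def)
  have nz: "lpoly c \<noteq> 0" if "c \<noteq> 0" for c
    using that lform_eq_zero_imp[of c] peval_lpoly[of c] by (auto simp: peval_simps)
  have X0: "lpoly a \<noteq> 0" using indep[of 1 0] by (intro nz) auto
  have Y0: "lpoly b \<noteq> 0" using indep[of 0 1] by (intro nz) auto
  obtain k l where kl: "k + l = 1" and D: "homogeneous k D" and E: "homogeneous l E"
    using homogeneous_factor[of 1 D E] X0 XE homogeneous_lpoly[of a] by metis
  obtain k' l' where kl': "k' + l' = 1" and D': "homogeneous k' D" and E': "homogeneous l' E'"
    using homogeneous_factor[of 1 D E'] Y0 YE homogeneous_lpoly[of b] by metis
  have "D \<noteq> 0" using X0 XE by auto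
  then have "k' = k" using homogeneous_unique[OF D' D] by simp
  consider "k = 0" | "l = 0" "l' = 0"
    using kl kl' \<open>k' = k\<close> by force
  then show "D dvd 1"
  proof cases
    case 1
    then show ?thesis using homogeneous_0_unit D \<open>D \<noteq> 0\<close> by blast
  next
    case 2
    then obtain c c' where c: "E = Poly_Mapping.single 0 c" "E' = Poly_Mapping.single 0 c'"
      using E E' homogeneous_0 by metis
    have "c \<noteq> 0" using X0 XE c by auto
    have eq: "Poly_Mapping.single 0 c' * lpoly a = Poly_Mapping.single 0 c * lpoly b"
      by (simp add: XE YE c mult.left_commute[of _ D] mult_single mult.commute)
    have "lform (c' *s a + (- c) *s b) x = 0" for x
      using arg_cong[OF eq, of "\<lambda>F. peval F x"] by (simp add: peval_simps peval_lpoly lform_simps_left)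
    then have "c' *s a + (- c) *s b = 0" by (rule lform_eq_zero_imp)
    from indep[OF this] show ?thesis using \<open>c \<noteq> 0\<close> by simp
  qed
qed

lemma peval_const: "peval (Poly_Mapping.single 0 c) x = c"
  by (simp add: peval_simps)

text \<open>A product of two linear forms has rank at most two, so in four variables its radical is
  nonzero. This serves to exclude that \<open>QB\<close> or \<open>QD\<close> splits.\<close>

lemma product_of_linear_degenerate:
  assumes "F = lpoly c * lpoly d"
  obtains x where "x \<noteq> 0" "\<And>y. peval F (x + y) = peval F y"
proof -
  obtain x where "x \<noteq> 0" "lform c x = 0" "lform d x = 0"
    using common_zero_of_three_forms[of c d d] by blast
  then show ?thesis using that[of x] assms by (simp add: peval_simps peval_lpoly lform_simps)
qed

subsection \<open>The inverse in normal form\<close>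

text \<open>\<open>point\<close> is the trilinear map with unit weights and control points \<open>a\<^sub>i\<close>, \<open>a\<^sub>i + b\<^sub>i\<close>, \<open>a\<^sub>i + d\<^sub>i\<close>,
  \<open>a\<^sub>i + b\<^sub>i + d\<^sub>i\<close>. A point of the plane with parameter \<open>s\<close> is \<open>A a(s) + B b(s) + D d(s)\<close>, where
  \<open>a(s) = s\<^sub>0 a\<^sub>0 + s\<^sub>1 a\<^sub>1\<close> etc. The linear forms \<open>S0\<close>, \<open>S1\<close> recover \<open>s\<close> and the quadratic forms \<open>QA\<close>, \<open>QB\<close>,
  \<open>QD\<close> recover \<open>(A : B : D)\<close>, all up to the common factors in \<open>forms_comb\<close>.\<close>

locale normal_form =
  fixes m n \<kappa> \<nu> e g :: complex and \<xi>0 \<eta>0 \<xi>1 \<eta>1 a0 d0 a1 d1 :: "complex^4"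
  assumes dual: "dual_basis (\<xi>0, \<eta>0, \<xi>1, \<eta>1) a0 d0 a1 d1"
    and \<kappa>: "\<kappa> \<noteq> 0" and mn: "m \<noteq> 0 \<or> n \<noteq> 0" and nd: "g * (g + \<nu> * n) - \<kappa> * n * n \<noteq> 0"
begin

text \<open>The coefficients of \<open>b0\<close> at \<open>a1\<close>, \<open>d1\<close> are a
  multiple of \<open>(m, n)\<close>, and the coefficients of \<open>b1\<close> at \<open>a1\<close>,
  \<open>d1\<close> differ from \<open>(e, g)\<close> by a multiple of \<open>(m, n)\<close>. The
  compatibility of the two boundary planes yields exactly this pattern in
  \<open>inverse_exists\<close>.\<close>

definition "b0 = e *s a0 + g *s d0 + (\<kappa> * m) *s a1 + (\<kappa> * n) *s d1"
definition "b1 = m *s a0 + n *s d0 + (e + \<nu> * m) *s a1 + (g + \<nu> * n) *s d1"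

definition point :: "complex^2 \<Rightarrow> complex^2 \<Rightarrow> complex^2 \<Rightarrow> complex^4" where
  "point s t u =
     (let T = t $ 0 + t $ 1; U = u $ 0 + u $ 1; A = T * U; B = t $ 1 * U; D = T * u $ 1 in
      A *s (s $ 0 *s a0 + s $ 1 *s a1) + B *s (s $ 0 *s b0 + s $ 1 *s b1) + D *s (s $ 0 *s d0 + s $ 1 *s d1))"

definition "S0 = n *s \<xi>0 - m *s \<eta>0"
definition "S1 = n *s \<xi>1 - m *s \<eta>1"

text \<open>The determinant of the coordinates arranged as a two-by-two matrix. For
  \<open>B = 0\<close> that matrix is the product of the column \<open>s\<close> and the row
  \<open>(A, D)\<close>, so \<open>QB\<close> vanishes.\<close>

definition "QB = lpoly \<xi>0 * lpoly \<eta>1 - lpoly \<xi>1 * lpoly \<eta>0"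
definition "QA = lpoly (\<kappa> *s S0) * lpoly \<xi>0 + lpoly (\<nu> *s S0 - S1) * lpoly \<xi>1
  - (lpoly ((e + \<nu> * m) *s \<xi>0) * lpoly \<eta>1 - lpoly ((e + \<nu> * m) *s \<xi>1) * lpoly \<eta>0)"
definition "QD = lpoly (\<kappa> *s S0) * lpoly \<eta>0 + lpoly (\<nu> *s S0 - S1) * lpoly \<eta>1
  - (lpoly ((g + \<nu> * n) *s \<xi>0) * lpoly \<eta>1 - lpoly ((g + \<nu> * n) *s \<xi>1) * lpoly \<eta>0)"

lemma basis_simps:
  "lform \<xi>0 a0 = 1" "lform \<xi>0 d0 = 0" "lform \<xi>0 a1 = 0" "lform \<xi>0 d1 = 0"
  "lform \<eta>0 a0 = 0" "lform \<eta>0 d0 = 1" "lform \<eta>0 a1 = 0" "lform \<eta>0 d1 = 0"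
  "lform \<xi>1 a0 = 0" "lform \<xi>1 d0 = 0" "lform \<xi>1 a1 = 1" "lform \<xi>1 d1 = 0"
  "lform \<eta>1 a0 = 0" "lform \<eta>1 d0 = 0" "lform \<eta>1 a1 = 0" "lform \<eta>1 d1 = 1"
  using dual by (simp_all add: dual_basis_def)

lemma expand: "x = lform \<xi>0 x *s a0 + lform \<eta>0 x *s d0 + lform \<xi>1 x *s a1 + lform \<eta>1 x *s d1"
  using dual by (simp add: dual_basis_def)

lemma coords_eqI:
  assumes "lform \<xi>0 x = lform \<xi>0 y" "lform \<eta>0 x = lform \<eta>0 y" "lform \<xi>1 x = lform \<xi>1 y" "lform \<eta>1 x = lform \<eta>1 y"
  shows "x = y"
  by (subst expand[of x], subst expand[of y]) (simp add: assms)

lemma peval_Q: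
  "peval QB x = lform \<xi>0 x * lform \<eta>1 x - lform \<xi>1 x * lform \<eta>0 x"
  "peval QA x = \<kappa> * lform S0 x * lform \<xi>0 x + (\<nu> * lform S0 x - lform S1 x) * lform \<xi>1 x
     - (e + \<nu> * m) * (lform \<xi>0 x * lform \<eta>1 x - lform \<xi>1 x * lform \<eta>0 x)"
  "peval QD x = \<kappa> * lform S0 x * lform \<eta>0 x + (\<nu> * lform S0 x - lform S1 x) * lform \<eta>1 x
     - (g + \<nu> * n) * (lform \<xi>0 x * lform \<eta>1 x - lform \<xi>1 x * lform \<eta>0 x)"
  by (simp_all add: QB_def QA_def QD_def peval_simps peval_diff peval_lpoly lform_simps_left algebra_simps)

lemma lform_S:
  "lform S0 x = n * lform \<xi>0 x - m * lform \<eta>0 x"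
  "lform S1 x = n * lform \<xi>1 x - m * lform \<eta>1 x"
  by (simp_all add: S0_def S1_def lform_simps_left)

lemma homogeneous_Q: "homogeneous 2 QA" "homogeneous 2 QB" "homogeneous 2 QD"
  unfolding QA_def QB_def QD_def one_add_one[symmetric]
  by (intro homogeneous_diff homogeneous_add homogeneous_mult homogeneous_lpoly)+

text \<open>A spurious factor depending on \<open>s\<close> alone. It is common to
  \<open>QA\<close>, \<open>QB\<close> and \<open>QD\<close> along the parametrization, so it
  disappears projectively.\<close>

definition "q s = \<kappa> * s $ 0 * s $ 0 + \<nu> * s $ 0 * s $ 1 - s $ 1 * s $ 1" for s :: "complex^2"

lemma lform_comb:
  fixes s :: "complex^2" and A B D :: complex
  defines "x \<equiv> A *s (s $ 0 *s a0 + s $ 1 *s a1) + B *s (s $ 0 *s b0 + s $ 1 *s b1) + D *s (s $ 0 *s d0 + s $ 1 *s d1)"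
  shows "lform \<xi>0 x = A * s $ 0 + B * (s $ 0 * e + s $ 1 * m)"
    "lform \<eta>0 x = D * s $ 0 + B * (s $ 0 * g + s $ 1 * n)"
    "lform \<xi>1 x = A * s $ 1 + B * (s $ 0 * \<kappa> * m + s $ 1 * (e + \<nu> * m))"
    "lform \<eta>1 x = D * s $ 1 + B * (s $ 0 * \<kappa> * n + s $ 1 * (g + \<nu> * n))"
  by (simp_all add: x_def b0_def b1_def lform_simps basis_simps algebra_simps)

lemma forms_comb:
  fixes s :: "complex^2" and A B D :: complex
  defines "x \<equiv> A *s (s $ 0 *s a0 + s $ 1 *s a1) + B *s (s $ 0 *s b0 + s $ 1 *s b1) + D *s (s $ 0 *s d0 + s $ 1 *s d1)"
  defines "h \<equiv> n * A - m * D + (e * n - m * g) * B"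
  shows "lform S0 x = s $ 0 * h" "lform S1 x = s $ 1 * h"
    "peval QA x = A * q s * h" "peval QB x = B * q s * h" "peval QD x = D * q s * h"
proof -
  note c = lform_comb[of A s B D, folded x_def]
  show S: "lform S0 x = s $ 0 * h" "lform S1 x = s $ 1 * h"
    unfolding lform_S c h_def by algebra+
  show "peval QA x = A * q s * h" "peval QB x = B * q s * h" "peval QD x = D * q s * h"
    unfolding peval_Q S c h_def q_def by algebra+
qed

text \<open>This is the composite in the other order: a polynomial identity in the four coordinates
  of \<open>x\<close>, with the same factor \<open>q\<close>.\<close>

lemma comb_forms:
  fixes x :: "complex^4"
  defines "s \<equiv> vec2 (lform S0 x) (lform S1 x)"
  shows "peval QA x *s (s $ 0 *s a0 + s $ 1 *s a1) + peval QB x *s (s $ 0 *s b0 + s $ 1 *s b1)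
     + peval QD x *s (s $ 0 *s d0 + s $ 1 *s d1) = q s *s x" (is "?y = _")
proof -
  have s: "s $ 0 = lform S0 x" "s $ 1 = lform S1 x" by (simp_all add: s_def)
  show ?thesis
    by (rule coords_eqI; simp only: lform_comb; simp only: lform_simps q_def peval_Q s lform_S; algebra)
qed

text \<open>Pairing a radical vector with the four basis vectors gives its four coordinates up to
  sign, so the radical is zero.\<close>

lemma QB_not_product: "QB \<noteq> lpoly c * lpoly d"
proof
  assume "QB = lpoly c * lpoly d"
  then obtain x where x: "x \<noteq> 0" "\<And>y. peval QB (x + y) = peval QB y"
    using product_of_linear_degenerate by blast
  note eq = x(2)[unfolded peval_Q lform_simps]
  have z: "lform \<xi>0 x * lform \<eta>1 x - lform \<xi>1 x * lform \<eta>0 x = 0"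
    using eq[of 0] by (simp add: lform_simps)
  have "lform \<eta>1 x = 0" "lform \<xi>1 x = 0" "lform \<eta>0 x = 0" "lform \<xi>0 x = 0"
    using z eq[of a0] eq[of d0] eq[of a1] eq[of d1] unfolding basis_simps by algebra+
  then have "x = 0" by (intro coords_eqI) (simp_all add: lform_simps)
  with x show False by simp
qed

text \<open>The equations of the radical split into a two-by-two system for \<open>Y0\<close>,
  \<open>Y1\<close> and another for \<open>X0\<close>, \<open>X1\<close>; up to sign both have the
  determinant that \<open>nd\<close> assumes to be nonzero.\<close>

lemma QD_not_product: "QD \<noteq> lpoly c * lpoly d"
proof
  assume "QD = lpoly c * lpoly d"
  then obtain x where x: "x \<noteq> 0" "\<And>y. peval QD (x + y) = peval QD y"
    using product_of_linear_degenerate by blast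
  note eq = x(2)[unfolded peval_Q lform_simps lform_S]
  define X0 Y0 X1 Y1 where X: "X0 = lform \<xi>0 x" "Y0 = lform \<eta>0 x" "X1 = lform \<xi>1 x" "Y1 = lform \<eta>1 x"
  note eq' = eq[folded X]
  have z: "\<kappa> * (n * X0 - m * Y0) * Y0 + (\<nu> * (n * X0 - m * Y0) - (n * X1 - m * Y1)) * Y1
     - (g + \<nu> * n) * (X0 * Y1 - X1 * Y0) = 0"
    using eq'[of 0] by (simp add: lform_simps)
  have 1: "\<kappa> * n * Y0 - g * Y1 = 0"
    using z eq'[of a0] by (simp add: basis_simps) algebra
  have 2: "(g + \<nu> * n) * Y0 - n * Y1 = 0"
    using z eq'[of a1] by (simp add: basis_simps) algebra
  have Y: "Y0 = 0" "Y1 = 0"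
  proof -
    have "(g * (g + \<nu> * n) - \<kappa> * n * n) * Y0 = 0" "(g * (g + \<nu> * n) - \<kappa> * n * n) * Y1 = 0"
      using 1 2 by algebra+
    then show "Y0 = 0" "Y1 = 0" using nd by auto
  qed
  have 3: "\<kappa> * n * X0 + (g + \<nu> * n) * X1 = 0"
    using z eq'[of d0] by (simp add: basis_simps Y algebra_simps)
  have 4: "g * X0 + n * X1 = 0"
    using z eq'[of d1] by (simp add: basis_simps Y algebra_simps)
  have "(g * (g + \<nu> * n) - \<kappa> * n * n) * X0 = 0" "(g * (g + \<nu> * n) - \<kappa> * n * n) * X1 = 0"
    using 3 4 by algebra+
  then have "X0 = 0" "X1 = 0" using nd by auto
  with Y have "x = 0" by (intro coords_eqI) (simp_all add: X lform_simps)
  with x show False by simp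
qed

lemma no_common_factor_BC:
  "no_common_factor (QA - QB) QB" "no_common_factor (QA - QD) QD"
proof -
  have pt: "\<exists>x. peval QA x = A * q s * h \<and> peval QB x = B * q s * h \<and> peval QD x = D * q s * h"
    if "h = n * A - m * D + (e * n - m * g) * B" for s A B D h
    using forms_comb[of A s B D] that by blast
  have q: "q (vec2 1 0) = \<kappa>" by (simp add: q_def)
  show "no_common_factor (QA - QB) QB"
  proof (rule no_common_factor_quadratic[OF _ _ QB_not_product])
    fix c
    show "QA - QB \<noteq> Poly_Mapping.single 0 c * QB"
    proof
      assume "QA - QB = Poly_Mapping.single 0 c * QB"
      then have eq: "peval QA x - peval QB x = c * peval QB x" for x
        by (metis peval_diff peval_simps(3) peval_const)
      show False
      \<comment> \<open>A point with \<open>QB = 0\<close> and \<open>QA\<close> nonzero: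
        \<open>A = 1\<close>, \<open>B = D = 0\<close> has \<open>h = n\<close>, and for
        \<open>n = 0\<close> the choice \<open>A = D = 1\<close>, \<open>B = 0\<close> has
        \<open>h = - m\<close>. In both cases \<open>q\<close> takes the value
        \<open>\<kappa>\<close>.\<close>
      proof (cases "n = 0")
        case False
        then show False
          using pt[of n 1 0 0 "vec2 1 0"] eq \<kappa> by (auto simp: q) (metis diff_zero mult_eq_0_iff)
      next
        case True
        then show False
          using pt[of "- m" 1 1 0 "vec2 1 0"] eq \<kappa> mn
          by (auto simp: q) (metis diff_zero mult_eq_0_iff neg_equal_0_iff_equal)
      qed
    qed
  qed (auto intro: homogeneous_diff homogeneous_Q)
  show "no_common_factor (QA - QD) QD"
  proof (rule no_common_factor_quadratic[OF _ _ QD_not_product])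
    fix c
    show "QA - QD \<noteq> Poly_Mapping.single 0 c * QD"
    proof
      assume "QA - QD = Poly_Mapping.single 0 c * QD"
      then have eq: "peval QA x - peval QD x = c * peval QD x" for x
        by (metis peval_diff peval_simps(3) peval_const)
      show False
      \<comment> \<open>As before with \<open>QD = 0\<close>. For \<open>n = 0\<close> the choice
        \<open>A = B = 1\<close>, \<open>D = 0\<close> has \<open>h = - m * g\<close>, which is
        nonzero because \<open>nd\<close> then reads \<open>g * g \<noteq> 0\<close>.\<close>
      proof (cases "n = 0")
        case False
        then show False
          using pt[of n 1 0 0 "vec2 1 0"] eq \<kappa> by (auto simp: q) (metis diff_zero mult_eq_0_iff)
      next
        case True
        then show False
          using pt[of "- m * g" 1 0 1 "vec2 1 0"] eq \<kappa> mn nd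
          by (auto simp: q) (metis diff_zero mult_eq_0_iff neg_equal_0_iff_equal)
      qed
    qed
  qed (auto intro: homogeneous_diff homogeneous_Q)
qed

definition "formsA = (\<lambda>i::2. if i = 0 then lpoly S0 else lpoly S1)"
definition "formsB = (\<lambda>j::2. if j = 0 then QA - QB else QB)"
definition "formsC = (\<lambda>k::2. if k = 0 then QA - QD else QD)"

lemma forms_properties:
  "homogeneous 1 (formsA i)" "homogeneous 2 (formsB i)" "homogeneous 2 (formsC i)"
  "no_common_factor (formsA 0) (formsA 1)"
  "no_common_factor (formsB 0) (formsB 1)"
  "no_common_factor (formsC 0) (formsC 1)"
proof -
  show "homogeneous 1 (formsA i)" "homogeneous 2 (formsB i)" "homogeneous 2 (formsC i)"
    unfolding formsA_def formsB_def formsC_def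
    by (auto simp del: One_nat_def intro: homogeneous_lpoly homogeneous_diff homogeneous_Q)
  have "no_common_factor (lpoly S0) (lpoly S1)"
  proof (rule no_common_factor_linear)
    fix x y assume eq: "x *s S0 + y *s S1 = 0"
    have "lform (x *s S0 + y *s S1) v = 0" for v by (simp add: eq lform_simps_left)
    note this[of a0] this[of d0] this[of a1] this[of d1]
    then show "x = 0 \<and> y = 0"
      using mn by (auto simp: lform_simps_left lform_S basis_simps)
  qed
  then show "no_common_factor (formsA 0) (formsA 1)" by (simp add: formsA_def)
  show "no_common_factor (formsB 0) (formsB 1)" "no_common_factor (formsC 0) (formsC 1)"
    using no_common_factor_BC by (simp_all add: formsB_def formsC_def)
qed

lemma pencil_point:
  fixes s t u :: "complex^2"
  defines "T \<equiv> t $ 0 + t $ 1" and "U \<equiv> u $ 0 + u $ 1"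
  defines "h \<equiv> n * (T * U) - m * (T * u $ 1) + (e * n - m * g) * (t $ 1 * U)"
  shows "pencil formsA (point s t u) = h *s s"
    "pencil formsB (point s t u) = (U * q s * h) *s t"
    "pencil formsC (point s t u) = (T * q s * h) *s u"
proof -
  define x where "x = point s t u"
  have x: "x = (T * U) *s (s $ 0 *s a0 + s $ 1 *s a1) + (t $ 1 * U) *s (s $ 0 *s b0 + s $ 1 *s b1) +
      (T * u $ 1) *s (s $ 0 *s d0 + s $ 1 *s d1)"
    by (simp only: x_def point_def Let_def T_def U_def)
  have eqs: "lform S0 x = s $ 0 * h" "lform S1 x = s $ 1 * h"
    "peval QA x = T * U * q s * h" "peval QB x = t $ 1 * U * q s * h" "peval QD x = T * u $ 1 * q s * h"
    unfolding x forms_comb h_def by (rule refl)+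
  show "pencil formsA (point s t u) = h *s s"
    "pencil formsB (point s t u) = (U * q s * h) *s t"
    "pencil formsC (point s t u) = (T * q s * h) *s u"
    unfolding x_def[symmetric] vec_eq_2
    by (simp_all add: pencil_def formsA_def formsB_def formsC_def peval_diff peval_lpoly eqs)
       (simp_all add: T_def U_def algebra_simps)
qed

lemma point_pencil:
  "point (pencil formsA x) (pencil formsB x) (pencil formsC x) =
     (peval QA x * q (pencil formsA x)) *s x"
proof -
  have A: "pencil formsA x = vec2 (lform S0 x) (lform S1 x)"
    by (simp add: vec_eq_2 pencil_def formsA_def peval_lpoly)
  have BC: "pencil formsB x $ 0 + pencil formsB x $ 1 = peval QA x" "pencil formsB x $ 1 = peval QB x"
    "pencil formsC x $ 0 + pencil formsC x $ 1 = peval QA x" "pencil formsC x $ 1 = peval QD x"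
    by (simp_all add: pencil_def formsB_def formsC_def peval_diff)
  have dist: "(c * A) *s v + (c * B) *s v' + (c * D) *s v'' = c *s (A *s v + B *s v' + D *s v'')"
    for c A B D and v v' v'' :: "complex^4"
    by (simp add: vec_eq_iff algebra_simps)
  show ?thesis
    unfolding point_def Let_def BC(1,3) unfolding BC(2,4) mult.commute[of "peval QB x"] dist A comb_forms
    by (simp add: vec_eq_iff)
qed

lemma mutually_inverse_point: "mutually_inverse point (pencil formsA) (pencil formsB) (pencil formsC)"
proof -
  have smul: "c *s v \<noteq> 0 \<longleftrightarrow> c \<noteq> 0 \<and> v \<noteq> 0" for c :: complex and v :: "complex^'n"
    by (auto simp: vec_eq_iff)
  have point_smul: "point (x *s s) (y *s t) (z *s u) = (x * y * z) *s point s t u" for x y z s t u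
    by (simp add: point_def Let_def vec_eq_iff algebra_simps)
  \<comment> \<open>With \<open>s = t = (1, 0)\<close> the factor \<open>h\<close> of
    \<open>pencil_point\<close> equals \<open>- m\<close> if \<open>n = 0\<close> and
    \<open>n\<close> otherwise, hence is nonzero; the remaining factors are 1 and
    \<open>\<kappa>\<close>.\<close>
  define u :: "complex^2" where "u = (if n = 0 then vec2 0 1 else vec2 1 0)"
  define s t :: "complex^2" where "s = vec2 1 0" and "t = vec2 1 0"
  have nz: "s \<noteq> 0" "t \<noteq> 0" "u \<noteq> 0" by (auto simp: s_def t_def u_def vec_eq_2)
  have pA: "pencil formsA (point s t u) \<noteq> 0"
    and pB: "pencil formsB (point s t u) \<noteq> 0"
    and pC: "pencil formsC (point s t u) \<noteq> 0"
    unfolding pencil_point smul using nz \<kappa> mn by (auto simp: s_def t_def u_def q_def)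
  have p: "point s t u \<noteq> 0"
    using pA by (auto simp: pencil_def formsA_def peval_lpoly lform_simps vec_eq_2)
  have pr: "proj_eq (c *s v) v" if "c *s v \<noteq> 0" for c and v :: "complex^'n"
    using that unfolding proj_eq_def smul by blast
  show ?thesis
    unfolding mutually_inverse_def Let_def
  proof (intro conjI allI impI)
    show "\<exists>s t u. s \<noteq> 0 \<and> t \<noteq> 0 \<and> u \<noteq> 0 \<and> point s t u \<noteq> 0 \<and> pencil formsA (point s t u) \<noteq> 0 \<and>
        pencil formsB (point s t u) \<noteq> 0 \<and> pencil formsC (point s t u) \<noteq> 0"
      using nz p pA pB pC by blast
    show "\<exists>x. x \<noteq> 0 \<and> pencil formsA x \<noteq> 0 \<and> pencil formsB x \<noteq> 0 \<and> pencil formsC x \<noteq> 0 \<and>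
        point (pencil formsA x) (pencil formsB x) (pencil formsC x) \<noteq> 0"
    proof (intro exI[of _ "point s t u"] conjI)
      show "point (pencil formsA (point s t u)) (pencil formsB (point s t u)) (pencil formsC (point s t u)) \<noteq> 0"
        using p pA pB pC unfolding pencil_point point_smul smul by simp
    qed (fact p pA pB pC)+
  next
    fix s t u
    assume "s \<noteq> 0 \<and> t \<noteq> 0 \<and> u \<noteq> 0 \<and> point s t u \<noteq> 0 \<and> pencil formsA (point s t u) \<noteq> 0 \<and>
        pencil formsB (point s t u) \<noteq> 0 \<and> pencil formsC (point s t u) \<noteq> 0"
    then show "proj_eq (pencil formsA (point s t u)) s" "proj_eq (pencil formsB (point s t u)) t"
      "proj_eq (pencil formsC (point s t u)) u"
      unfolding pencil_point using pr by blast+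
  next
    fix x
    assume "x \<noteq> 0 \<and> pencil formsA x \<noteq> 0 \<and> pencil formsB x \<noteq> 0 \<and> pencil formsC x \<noteq> 0 \<and>
        point (pencil formsA x) (pencil formsB x) (pencil formsC x) \<noteq> 0"
    then show "proj_eq (point (pencil formsA x) (pencil formsB x) (pencil formsC x)) x"
      unfolding point_pencil using pr by blast
  qed
qed

end

section \<open>Rescaling the coordinates of the projective lines\<close>

definition vscale :: "complex^2 \<Rightarrow> complex^2 \<Rightarrow> complex^2" where
  "vscale a s = (\<chi> i. a $ i * s $ i)"

lemma no_common_factor_scale:
  assumes "no_common_factor F G" "c \<noteq> 0" "d \<noteq> 0"
  shows "no_common_factor (Poly_Mapping.single 0 c * F) (Poly_Mapping.single 0 d * G)"
proof -
  have "F = Poly_Mapping.single 0 (inverse c) * (Poly_Mapping.single 0 c * F)" if "c \<noteq> 0" for c and F :: poly4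
    using that by (simp add: mult.assoc[symmetric] mult_single)
  then show ?thesis
    using assms unfolding no_common_factor_def by (metis dvd_mult)
qed

text \<open>Diagonal changes of coordinates on the three projective lines preserve invertibility.
  This is how a rank-one tensor of weights is reduced to unit weights.\<close>

lemma mutually_inverse_scale:
  assumes f: "\<And>s t u. f s t u = p (vscale a s) (vscale b t) (vscale g u)"
    and nz: "\<And>i. a $ i \<noteq> 0" "\<And>i. b $ i \<noteq> 0" "\<And>i. g $ i \<noteq> 0"
    and inv: "mutually_inverse p A B C"
    and A': "\<And>x. vscale a (A' x) = A x" "\<And>x. vscale b (B' x) = B x" "\<And>x. vscale g (C' x) = C x"
  shows "mutually_inverse f A' B' C'"
proof -
  have vs0: "vscale a s = 0 \<longleftrightarrow> s = 0" if "\<And>i. a $ i \<noteq> 0" for a s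
    using that by (auto simp: vscale_def vec_eq_iff)
  have vsp: "proj_eq (vscale a s) (vscale a s') \<longleftrightarrow> proj_eq s s'" if nz: "\<And>i. a $ i \<noteq> 0" for a s s'
  proof -
    have "vscale a s = c *s vscale a s' \<longleftrightarrow> s = c *s s'" for c
      using nz by (auto simp: vscale_def vec_eq_iff)
    then show ?thesis by (simp add: proj_eq_def)
  qed
  have surj: "\<exists>s'. vscale a s' = s" if "\<And>i. a $ i \<noteq> 0" for a s
    by (rule exI[of _ "\<chi> i. s $ i / a $ i"]) (use that in \<open>auto simp: vscale_def vec_eq_iff\<close>)
  have z: "A' x = 0 \<longleftrightarrow> A x = 0" "B' x = 0 \<longleftrightarrow> B x = 0" "C' x = 0 \<longleftrightarrow> C x = 0" for x
    using vs0[OF nz(1), of "A' x"] vs0[OF nz(2), of "B' x"] vs0[OF nz(3), of "C' x"] by (simp_all add: A')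
  have pe: "proj_eq (A' x) s \<longleftrightarrow> proj_eq (A x) (vscale a s)" "proj_eq (B' x) s \<longleftrightarrow> proj_eq (B x) (vscale b s)"
    "proj_eq (C' x) s \<longleftrightarrow> proj_eq (C x) (vscale g s)" for x s
    using vsp[OF nz(1), of "A' x" s] vsp[OF nz(2), of "B' x" s] vsp[OF nz(3), of "C' x" s] by (simp_all add: A')
  have 1: "\<exists>s t u. s \<noteq> 0 \<and> t \<noteq> 0 \<and> u \<noteq> 0 \<and> p s t u \<noteq> 0 \<and> A (p s t u) \<noteq> 0 \<and> B (p s t u) \<noteq> 0 \<and> C (p s t u) \<noteq> 0"
    and 2: "s \<noteq> 0 \<and> t \<noteq> 0 \<and> u \<noteq> 0 \<and> p s t u \<noteq> 0 \<and> A (p s t u) \<noteq> 0 \<and> B (p s t u) \<noteq> 0 \<and> C (p s t u) \<noteq> 0 \<Longrightarrow>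
      proj_eq (A (p s t u)) s \<and> proj_eq (B (p s t u)) t \<and> proj_eq (C (p s t u)) u"
    and 3: "\<exists>x. x \<noteq> 0 \<and> A x \<noteq> 0 \<and> B x \<noteq> 0 \<and> C x \<noteq> 0 \<and> p (A x) (B x) (C x) \<noteq> 0"
    and 4: "x \<noteq> 0 \<and> A x \<noteq> 0 \<and> B x \<noteq> 0 \<and> C x \<noteq> 0 \<and> p (A x) (B x) (C x) \<noteq> 0 \<Longrightarrow> proj_eq (p (A x) (B x) (C x)) x"
    for s t u x
    using inv unfolding mutually_inverse_def Let_def by blast+
  show ?thesis
    unfolding mutually_inverse_def Let_def f A' z pe
  proof (intro conjI allI impI)
    obtain s t u where st: "s \<noteq> 0 \<and> t \<noteq> 0 \<and> u \<noteq> 0 \<and> p s t u \<noteq> 0 \<and> A (p s t u) \<noteq> 0 \<and> B (p s t u) \<noteq> 0 \<and> C (p s t u) \<noteq> 0"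
      using 1 by blast
    obtain s' t' u' where "vscale a s' = s" "vscale b t' = t" "vscale g u' = u"
      using surj[OF nz(1), of s] surj[OF nz(2), of t] surj[OF nz(3), of u] by blast
    then show "\<exists>s t u. s \<noteq> 0 \<and> t \<noteq> 0 \<and> u \<noteq> 0 \<and> p (vscale a s) (vscale b t) (vscale g u) \<noteq> 0 \<and>
       A (p (vscale a s) (vscale b t) (vscale g u)) \<noteq> 0 \<and>
       B (p (vscale a s) (vscale b t) (vscale g u)) \<noteq> 0 \<and> C (p (vscale a s) (vscale b t) (vscale g u)) \<noteq> 0"
      using st vs0[OF nz(1), of s'] vs0[OF nz(2), of t'] vs0[OF nz(3), of u']
      by (intro exI[of _ s'] exI[of _ t'] exI[of _ u']) auto
  next
    fix s t u
    assume "s \<noteq> 0 \<and> t \<noteq> 0 \<and> u \<noteq> 0 \<and> p (vscale a s) (vscale b t) (vscale g u) \<noteq> 0 \<and>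
       A (p (vscale a s) (vscale b t) (vscale g u)) \<noteq> 0 \<and>
       B (p (vscale a s) (vscale b t) (vscale g u)) \<noteq> 0 \<and> C (p (vscale a s) (vscale b t) (vscale g u)) \<noteq> 0"
    then have "vscale a s \<noteq> 0 \<and> vscale b t \<noteq> 0 \<and> vscale g u \<noteq> 0 \<and> p (vscale a s) (vscale b t) (vscale g u) \<noteq> 0 \<and>
       A (p (vscale a s) (vscale b t) (vscale g u)) \<noteq> 0 \<and>
       B (p (vscale a s) (vscale b t) (vscale g u)) \<noteq> 0 \<and> C (p (vscale a s) (vscale b t) (vscale g u)) \<noteq> 0"
      using vs0[OF nz(1), of s] vs0[OF nz(2), of t] vs0[OF nz(3), of u] by simp
    from 2[OF this] show "proj_eq (A (p (vscale a s) (vscale b t) (vscale g u))) (vscale a s)"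
      "proj_eq (B (p (vscale a s) (vscale b t) (vscale g u))) (vscale b t)"
      "proj_eq (C (p (vscale a s) (vscale b t) (vscale g u))) (vscale g u)"
      by blast+
  qed (use 3 4 in blast)+
qed

subsection \<open>Geometry of the boundary lines and their transversals\<close>

lemma line_span:
  assumes L: "is_line L" "p \<in> L" "r \<in> L"
    and indep: "\<And>x y. x *s p + y *s r = 0 \<Longrightarrow> x = 0 \<and> y = 0"
    and "z \<in> L"
  obtains x y where "z = x *s p + y *s r"
proof -
  have sub: "{p, r} \<subseteq> L" using L by auto
  have "r \<noteq> 0" using indep[of 0 1] by auto
  have "p \<noteq> r" using indep[of 1 "-1"] by auto
  have "p \<notin> vec.span {r}"
  proof
    assume "p \<in> vec.span {r}"
    then obtain k where "p = k *s r" by (auto simp: vec.span_singleton)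
    then show False using indep[of 1 "- k"] by simp
  qed
  then have "vec.independent {p, r}"
    using \<open>r \<noteq> 0\<close> by (simp add: vec.independent_insert)
  then have "L \<subseteq> vec.span {p, r}"
    using L(1) sub \<open>p \<noteq> r\<close> by (intro vec.card_ge_dim_independent) (auto simp: is_line_def)
  with \<open>z \<in> L\<close> have "z \<in> vec.span {p, r}" by blast
  then obtain x where "z - x *s p \<in> vec.span {r}" by (auto simp: vec.span_breakdown_eq)
  then obtain y where "z - x *s p = y *s r" by (auto simp: vec.span_singleton)
  then have "z = x *s p + y *s r" by (simp add: algebra_simps)
  with that show ?thesis .
qed

lemma mem_span_pair:
  "z \<in> vec.span {p, r} \<longleftrightarrow> (\<exists>x y. z = x *s p + y *s r)"
proof -
  have "z \<in> vec.span {p, r} \<longleftrightarrow> (\<exists>x y. z - x *s p = y *s r)"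
    by (auto simp: vec.span_breakdown_eq vec.span_singleton)
  then show ?thesis by (simp add: diff_eq_eq add.commute)
qed

lemma is_line_span_independent:
  assumes "is_line (vec.span {p, r})" "x *s p + y *s r = 0"
  shows "x = 0 \<and> y = 0"
proof -
  have dim: "vec.dim {p, r} = 2" using assms(1) by (simp add: is_line_def)
  have small: "vec.dim {p, r} \<le> 1" if "{p, r} \<subseteq> vec.span {q}" for q
    using vec.dim_le_card[OF that] by simp
  show ?thesis
  proof (rule ccontr)
    assume "\<not> (x = 0 \<and> y = 0)"
    then consider "x \<noteq> 0" | "y \<noteq> 0" by blast
    then show False
    proof cases
      case 1
      have "p = (- y / x) *s r"
        using assms(2) 1 by (simp add: vec_eq_iff field_simps eq_neg_iff_add_eq_0)
      then have "{p, r} \<subseteq> vec.span {r}"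
        using vec.span_base[of r "{r}"] vec.span_scale[of r "{r}" "- y / x"] by simp
      with small dim show False by fastforce
    next
      case 2
      have "r = (- x / y) *s p"
        using assms(2) 2 by (simp add: vec_eq_iff field_simps eq_neg_iff_add_eq_0)
      then have "{p, r} \<subseteq> vec.span {p}"
        using vec.span_base[of p "{p}"] vec.span_scale[of p "{p}" "- x / y"] by simp
      with small dim show False by fastforce
    qed
  qed
qed

lemma two_cases: "k = 0 \<or> k = 1" for k :: 2
  using exhaust_2[of k] two_eq_zero by auto

lemma ex_other_2: "\<exists>j. j \<noteq> i" for i :: 2
  by (metis zero_neq_one)

lemma other_2: "i \<noteq> j \<Longrightarrow> k = i \<or> k = j" for i j k :: 2
  using exhaust_2[of i] exhaust_2[of j] exhaust_2[of k] by auto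

text \<open>The control points of a scaffold map after scaling. The relation in each boundary plane
  has coefficients 1 and -1, \<open>\<sigma> i\<close> is the equation of the plane, and the two
  spanning conditions record that the boundary quadrics lie in no plane.\<close>

locale frame =
  fixes v :: "2 \<Rightarrow> 2 \<Rightarrow> 2 \<Rightarrow> complex^4" and \<sigma> :: "2 \<Rightarrow> complex^4"
  assumes alternating: "v i 1 1 = v i 1 0 + v i 0 1 - v i 0 0"
    and triple: "x *s v i 0 0 + y *s v i 0 1 + z *s v i 1 0 = 0 \<Longrightarrow> x = 0 \<and> y = 0 \<and> z = 0"
    and T_spanning: "(\<And>i k. lform c (v i j k) = 0) \<Longrightarrow> c = 0"
    and Y_spanning: "(\<And>i j. lform c (v i j k) = 0) \<Longrightarrow> c = 0"
    and sigma: "lform (\<sigma> i) (v i j k) = 0" "\<sigma> i \<noteq> 0"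
begin

text \<open>Exchanging the second and third parameters preserves a frame, so facts about \<rho>
  follow from those about \<theta>.\<close>

lemma swap: "frame (\<lambda>i j k. v i k j) \<sigma>"
proof
  show "v i 1 1 = v i 0 1 + v i 1 0 - v i 0 0" for i
    using alternating[of i] by (simp add: add.commute)
  show "x = 0 \<and> y = 0 \<and> z = 0" if "x *s v i 0 0 + y *s v i 1 0 + z *s v i 0 1 = 0" for x y z i
    using triple[of x i z y] that by (auto simp: algebra_simps)
qed (use T_spanning Y_spanning sigma in blast)+

text \<open>Every relation among the four points of a plane is a multiple of the alternating one, so
  a relation that omits one of the points is trivial.\<close>

lemma edge_independent:
  assumes "j' \<noteq> j" "x *s v i j' k = p *s v i j 0 + r *s v i j 1"
  shows "x = 0"
proof -
  have rel: "y0 *s v i 0 0 + y1 *s v i 0 1 + y2 *s v i 1 0 + y3 *s v i 1 1 = 0 \<Longrightarrow>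
      y0 - y3 = 0 \<and> y1 + y3 = 0 \<and> y2 + y3 = 0" for y0 y1 y2 y3
    by (rule triple[of "y0 - y3" i "y1 + y3" "y2 + y3"])
       (simp add: alternating algebra_simps vec.scale_right_diff_distrib vec.scale_left_diff_distrib
         vec.scale_right_distrib vec.scale_left_distrib)
  have 2: "k = 0 \<or> k = 1" "j = 0 \<and> j' = 1 \<or> j = 1 \<and> j' = 0"
    using assms(1) two_cases[of k] two_cases[of j] two_cases[of j'] by auto
  show ?thesis
    using 2 rel[of "-p" "-r" x 0] rel[of "-p" "-r" 0 x] rel[of x 0 "-p" "-r"] rel[of 0 x "-p" "-r"] assms(2)
    by (auto simp: algebra_simps)
qed

lemma T_pair_independent:
  assumes "x0 *s v 0 j 0 + x1 *s v 0 j 1 + y0 *s v 1 j 0 + y1 *s v 1 j 1 = 0"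
  shows "x0 = 0 \<and> x1 = 0 \<and> y0 = 0 \<and> y1 = 0"
proof -
  have "spanning4 (v 0 j 0) (v 0 j 1) (v 1 j 0) (v 1 j 1)"
    unfolding spanning4_def
  proof (intro allI impI)
    fix c assume "lform c (v 0 j 0) = 0 \<and> lform c (v 0 j 1) = 0 \<and> lform c (v 1 j 0) = 0 \<and> lform c (v 1 j 1) = 0"
    then have "\<forall>i k. lform c (v i j k) = 0" by (simp add: forall_2')
    then show "c = 0" using T_spanning[of c j] by blast
  qed
  from spanning4_independent[OF this assms] show ?thesis .
qed

end

lemma orthogonal_proportional:
  fixes m n m' n' S R :: complex
  assumes "m * S + n * R = 0" "m' * S + n' * R = 0" "S \<noteq> 0 \<or> R \<noteq> 0" "m \<noteq> 0 \<or> n \<noteq> 0"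
  obtains k where "m' = k * m" "n' = k * n"
proof -
  have "S * (m * n' - n * m') = 0" "R * (m * n' - n * m') = 0"
    using assms(1,2) by algebra+
  then have eq: "m * n' = n * m'" using assms(3) by auto
  show ?thesis
  proof (cases "m = 0")
    case True
    then show ?thesis using that[of "n' / n"] assms(4) eq by simp
  next
    case False
    then show ?thesis using that[of "m' / m"] eq by (simp add: field_simps)
  qed
qed

text \<open>Expand the directions \<open>b 0\<close>, \<open>b 1\<close> in the basis
  \<open>a 0\<close>, \<open>d 0\<close>, \<open>a 1\<close>, \<open>d 1\<close>. Since the plane
  forms take proportional values, the pairs \<open>(m, n)\<close>, \<open>(m', n')\<close> and
  \<open>(e' - e, g' - g)\<close> are all orthogonal to the nonzero pair \<open>(S, R)\<close>.
  Their proportionality yields \<kappa> and \<nu>, and with them the normal form.\<close>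

lemma (in frame) inverse_exists:
  assumes "\<mu> \<noteq> 0" and proportional: "\<And>j k. lform (\<sigma> 0) (v 1 j k) = \<mu> * lform (\<sigma> 1) (v 0 j k)"
  shows "\<exists>A B C. (\<forall>i. homogeneous 1 (A i)) \<and> (\<forall>i. homogeneous 2 (B i)) \<and> (\<forall>i. homogeneous 2 (C i)) \<and>
    no_common_factor (A 0) (A 1) \<and> no_common_factor (B 0) (B 1) \<and> no_common_factor (C 0) (C 1) \<and>
    mutually_inverse (\<lambda>s t u. \<Sum>i\<in>UNIV. \<Sum>j\<in>UNIV. \<Sum>k\<in>UNIV. (s $ i * t $ j * u $ k) *s v i j k)
      (pencil A) (pencil B) (pencil C)"
proof -
  define a b d where "a i = v i 0 0" and "b i = v i 1 0 - v i 0 0" and "d i = v i 0 1 - v i 0 0" for i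
  have vabd: "v i 0 0 = a i" "v i 1 0 = a i + b i" "v i 0 1 = a i + d i" "v i 1 1 = a i + b i + d i" for i
    by (simp_all add: a_def b_def d_def alternating)
  have indep: "x = 0 \<and> y = 0 \<and> z = 0" if "x *s a i + y *s d i + z *s b i = 0" for i x y z
    using triple[of "x - y - z" i y z] that by (auto simp: a_def b_def d_def vec_eq_iff algebra_simps)
  have T: "c = 0" if "lform c (a 0) = 0" "lform c (d 0) = 0" "lform c (a 1) = 0" "lform c (d 1) = 0" for c
  proof -
    have "\<forall>i k. lform c (v i 0 k) = 0"
      using that by (simp add: forall_2' vabd lform_simps)
    then show ?thesis using T_spanning[of c 0] by blast
  qed
  then have "spanning4 (a 0) (d 0) (a 1) (d 1)" by (simp add: spanning4_def)
  then obtain \<xi>0 \<eta>0 \<xi>1 \<eta>1 where dual: "dual_basis (\<xi>0, \<eta>0, \<xi>1, \<eta>1) (a 0) (d 0) (a 1) (d 1)"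
    by (rule spanning4_dual_basis)
  then have expand: "x = lform \<xi>0 x *s a 0 + lform \<eta>0 x *s d 0 + lform \<xi>1 x *s a 1 + lform \<eta>1 x *s d 1" for x
    by (simp add: dual_basis_def)
  define e g m' n' m n e' g' where coords:
    "e = lform \<xi>0 (b 0)" "g = lform \<eta>0 (b 0)" "m' = lform \<xi>1 (b 0)" "n' = lform \<eta>1 (b 0)"
    "m = lform \<xi>0 (b 1)" "n = lform \<eta>0 (b 1)" "e' = lform \<xi>1 (b 1)" "g' = lform \<eta>1 (b 1)"
  have b0: "b 0 = e *s a 0 + g *s d 0 + m' *s a 1 + n' *s d 1"
    and b1: "b 1 = m *s a 0 + n *s d 0 + e' *s a 1 + g' *s d 1"
    unfolding coords by (rule expand)+
  define S R where "S = lform (\<sigma> 1) (a 0)" and "R = lform (\<sigma> 1) (d 0)"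
  have sig: "lform (\<sigma> i) (a i) = 0" "lform (\<sigma> i) (b i) = 0" "lform (\<sigma> i) (d i) = 0" for i
    by (simp_all add: a_def b_def d_def lform_simps sigma)
  have sig0: "lform (\<sigma> 0) (a 1) = \<mu> * S" "lform (\<sigma> 0) (d 1) = \<mu> * R"
    "lform (\<sigma> 0) (b 1) = \<mu> * lform (\<sigma> 1) (b 0)"
    by (simp_all add: S_def R_def a_def b_def d_def lform_simps proportional algebra_simps)
  have SR: "S \<noteq> 0 \<or> R \<noteq> 0"
    using T[of "\<sigma> 1"] sigma(2)[of 1] sig[of 1] by (auto simp: S_def R_def)
  have mn: "m \<noteq> 0 \<or> n \<noteq> 0"
    using indep[of e' 1 g' "-1"] b1 by auto
  have mn': "m' \<noteq> 0 \<or> n' \<noteq> 0"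
    using indep[of e 0 g "-1"] b0 by auto
  have eq1: "m * S + n * R = 0"
    using sig(2)[of 1] by (simp add: b1 lform_simps sig S_def R_def)
  have eq0: "m' * S + n' * R = 0"
  proof -
    have "\<mu> * (m' * S + n' * R) = 0"
      using sig(2)[of 0] by (simp add: b0 lform_simps sig sig0 algebra_simps)
    then show ?thesis using \<open>\<mu> \<noteq> 0\<close> by simp
  qed
  obtain \<kappa> where \<kappa>: "m' = \<kappa> * m" "n' = \<kappa> * n"
    using orthogonal_proportional[OF eq1 eq0 SR mn] .
  have "\<kappa> \<noteq> 0" using mn' \<kappa> by auto
  have eq2: "(e' - e) * S + (g' - g) * R = 0"
  proof -
    have "lform (\<sigma> 1) (b 0) = e * S + g * R"
      by (simp add: b0 lform_simps sig S_def R_def)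
    moreover have "lform (\<sigma> 0) (b 1) = \<mu> * (e' * S + g' * R)"
      by (simp add: b1 lform_simps sig sig0 algebra_simps)
    ultimately have "\<mu> * ((e' - e) * S + (g' - g) * R) = 0"
      using sig0(3) by (simp add: algebra_simps)
    then show ?thesis using \<open>\<mu> \<noteq> 0\<close> by simp
  qed
  obtain \<nu> where \<nu>: "e' - e = \<nu> * m" "g' - g = \<nu> * n"
    using orthogonal_proportional[OF eq1 eq2 SR mn] .
  have e'g': "e' = e + \<nu> * m" "g' = g + \<nu> * n" using \<nu> by (simp_all add: algebra_simps)
  \<comment> \<open>Otherwise a combination of \<open>\<eta>0\<close> and \<open>\<eta>1\<close>
    kills all points \<open>v i j 0\<close>, against \<open>Y_spanning\<close>. Its coefficients
    \<open>p\<close>, \<open>r\<close> are a kernel vector of the two-by-two matrix with this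
    determinant.\<close>
  have "g * (g + \<nu> * n) - \<kappa> * n * n \<noteq> 0"
  proof
    assume z: "g * (g + \<nu> * n) - \<kappa> * n * n = 0"
    have "\<exists>p r. (p \<noteq> 0 \<or> r \<noteq> 0) \<and> p * g + r * (\<kappa> * n) = 0 \<and> p * n + r * (g + \<nu> * n) = 0"
    proof (cases "n = 0")
      case True
      then show ?thesis using z by (intro exI[of _ 1] exI[of _ 0]) simp
    next
      case False
      then show ?thesis
        using z \<open>\<kappa> \<noteq> 0\<close> by (intro exI[of _ "\<kappa> * n"] exI[of _ "- g"]) (simp add: algebra_simps)
    qed
    then obtain p r where pr: "p \<noteq> 0 \<or> r \<noteq> 0" "p * g + r * (\<kappa> * n) = 0" "p * n + r * (g + \<nu> * n) = 0"
      by blast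
    define c where "c = p *s \<eta>0 + r *s \<eta>1"
    have c: "lform c (a 0) = 0" "lform c (d 0) = p" "lform c (a 1) = 0" "lform c (d 1) = r"
      using dual by (simp_all add: c_def lform_simps_left dual_basis_def)
    have "lform c (b 0) = 0" "lform c (b 1) = 0"
      using pr(2,3) by (simp_all add: b0 b1 lform_simps c \<kappa> e'g' algebra_simps)
    then have "\<forall>i j. lform c (v i j 0) = 0"
      using c by (simp add: forall_2' vabd lform_simps)
    then have "c = 0" using Y_spanning[of c 0] by blast
    with c pr(1) show False by (simp add: lform_simps_left)
  qed
  then interpret nf: normal_form m n \<kappa> \<nu> e g \<xi>0 \<eta>0 \<xi>1 \<eta>1 "a 0" "d 0" "a 1" "d 1"
    using dual \<open>\<kappa> \<noteq> 0\<close> mn by unfold_locales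
  have nb: "nf.b0 = b 0" "nf.b1 = b 1"
    unfolding nf.b0_def nf.b1_def b0 b1 \<kappa> e'g' by simp_all
  have "nf.point = (\<lambda>s t u. \<Sum>i\<in>UNIV. \<Sum>j\<in>UNIV. \<Sum>k\<in>UNIV. (s $ i * t $ j * u $ k) *s v i j k)"
    by (intro ext) (simp add: nf.point_def Let_def nb sum_2' vabd vec_eq_iff algebra_simps)
  then show ?thesis
    using nf.forms_properties nf.mutually_inverse_point
    by (intro exI[of _ nf.formsA] exI[of _ nf.formsB] exI[of _ nf.formsC]) simp
qed

text \<open>One of the lines \<open>r l\<close> together with its planes. The differences
  \<open>v i j 1 - v i j 0\<close> lie on the line \<open>y\<close> and the differences
  \<open>v i 1 k - v i 0 k\<close> on the line \<open>z\<close>, so containment of \<open>y\<close>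
  or \<open>z\<close> becomes independence of \<open>k\<close> or of \<open>j\<close>.\<close>

locale transversal = frame +
  fixes R :: "(complex^4) set" and \<theta> \<rho> :: "complex^4"
  assumes line: "is_line R"
    and meets_edges: "\<exists>x y. (x \<noteq> 0 \<or> y \<noteq> 0) \<and> x *s v 0 j k + y *s v 1 j k \<in> R"
    and theta: "\<theta> \<noteq> 0" "\<And>z. z \<in> R \<Longrightarrow> lform \<theta> z = 0" "lform \<theta> (v i j 1) = lform \<theta> (v i j 0)"
    and rho: "\<rho> \<noteq> 0" "\<And>z. z \<in> R \<Longrightarrow> lform \<rho> z = 0" "lform \<rho> (v i 1 k) = lform \<rho> (v i 0 k)"
begin

lemma swap_transversal: "transversal (\<lambda>i j k. v i k j) \<sigma> R \<rho> \<theta>"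
proof -
  interpret s: frame "\<lambda>i j k. v i k j" \<sigma> by (rule swap)
  show ?thesis by unfold_locales (use line meets_edges theta rho in blast)+
qed

lemma meets_edge:
  assumes "i \<noteq> i'"
  obtains x y where "x \<noteq> 0 \<or> y \<noteq> 0" "x *s v i j k + y *s v i' j k \<in> R"
proof -
  have "i = 0 \<and> i' = 1 \<or> i = 1 \<and> i' = 0" using assms two_cases[of i] two_cases[of i'] by auto
  moreover obtain x y where "x \<noteq> 0 \<or> y \<noteq> 0" "x *s v 0 j k + y *s v 1 j k \<in> R"
    using meets_edges by blast
  ultimately show ?thesis using that[of x y] that[of y x] by (auto simp: add.commute)
qed

lemma theta_const: "lform \<theta> (v i j k) = lform \<theta> (v i j 0)"
  using two_cases[of k] theta(3)[of i j] by auto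

lemma rho_const: "lform \<rho> (v i j k) = lform \<rho> (v i 0 k)"
  using two_cases[of j] rho(3)[of i k] by auto

text \<open>If \<theta> vanishes at \<open>v i j k\<close>, it does so for both \<open>k\<close>,
  and at neither point \<open>v i' j k\<close> since these four points span. The line
  \<open>R\<close> then meets the edges over \<open>(j, k)\<close> at \<open>v i j k\<close> and
  lies in plane \<open>i\<close>. Its points on the edges over \<open>(j', k)\<close> cannot be
  \<open>v i j' k\<close>, so \<open>v i' j' k\<close> lies in plane \<open>i\<close> too, which
  puts all points with index \<open>j'\<close> in that plane.\<close>

lemma theta_nonzero: "lform \<theta> (v i j k) \<noteq> 0"
proof
  assume "lform \<theta> (v i j k) = 0"
  then have zero: "lform \<theta> (v i j k) = 0" for k
    using theta_const[of i j] by metis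
  obtain i' where i': "i \<noteq> i'" using ex_other_2[of i] by metis
  obtain j' where j': "j' \<noteq> j" using ex_other_2 by blast
  have nz: "lform \<theta> (v i' j k) \<noteq> 0" for k
  proof
    assume "lform \<theta> (v i' j k) = 0"
    then have "lform \<theta> (v i' j k) = 0" for k
      using theta_const[of i' j] by metis
    then have "lform \<theta> (v l j k) = 0" for l k
      using zero other_2[OF i', of l] by auto
    then show False using T_spanning[of \<theta> j] theta(1) by blast
  qed
  have inR: "v i j k \<in> R" for k
  proof -
    obtain x y where xy: "x \<noteq> 0 \<or> y \<noteq> 0" "x *s v i j k + y *s v i' j k \<in> R"
      using meets_edge[OF i'] by blast
    have "y = 0" using theta(2)[OF xy(2)] zero nz by (simp add: lform_simps)
    with xy have "x \<noteq> 0" "x *s v i j k \<in> R" by auto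
    then have "inverse x *s (x *s v i j k) \<in> R"
      using line unfolding is_line_def by (meson vec.subspace_scale)
    then show ?thesis using \<open>x \<noteq> 0\<close> by simp
  qed
  have "lform (\<sigma> i) (v i' j' k) = 0" for k
  proof (rule ccontr)
    assume s: "lform (\<sigma> i) (v i' j' k) \<noteq> 0"
    obtain x y where xy: "x \<noteq> 0 \<or> y \<noteq> 0" "x *s v i j' k + y *s v i' j' k \<in> R"
      using meets_edge[OF i'] by blast
    have indep: "p = 0 \<and> r = 0" if "p *s v i j 0 + r *s v i j 1 = 0" for p r
      using T_pair_independent[of p j r 0 0] T_pair_independent[of 0 j 0 p r] that two_cases[of i]
      by auto
    obtain p r where pr: "x *s v i j' k + y *s v i' j' k = p *s v i j 0 + r *s v i j 1"
      using line_span[OF line inR inR indep xy(2)] .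
    then have "lform (\<sigma> i) (x *s v i j' k + y *s v i' j' k) = lform (\<sigma> i) (p *s v i j 0 + r *s v i j 1)"
      by simp
    then have "y = 0" using s by (simp add: lform_simps sigma)
    with pr have "x = 0" using edge_independent[OF j', of x i k p r] by simp
    with \<open>y = 0\<close> xy show False by simp
  qed
  then have "lform (\<sigma> i) (v l j' k) = 0" for l k
    using sigma other_2[OF i', of l] by auto
  then show False using T_spanning[of "\<sigma> i" j'] sigma by blast
qed

lemma rho_nonzero: "lform \<rho> (v i j k) \<noteq> 0"
proof -
  interpret s: transversal "\<lambda>i j k. v i k j" \<sigma> R \<rho> \<theta> by (rule swap_transversal)
  show ?thesis by (rule s.theta_nonzero)
qed

text \<open>The point where \<open>R\<close> meets the edge is a common zero of both forms, so their
  restrictions to the edge are proportional.\<close>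

lemma theta_rho_ratio:
  "lform \<theta> (v 0 j k) * lform \<rho> (v 1 j k) = lform \<theta> (v 1 j k) * lform \<rho> (v 0 j k)"
proof -
  obtain x y where xy: "x \<noteq> 0 \<or> y \<noteq> 0" "x *s v 0 j k + y *s v 1 j k \<in> R"
    using meets_edges by blast
  have "x * lform \<theta> (v 0 j k) + y * lform \<theta> (v 1 j k) = 0" "x * lform \<rho> (v 0 j k) + y * lform \<rho> (v 1 j k) = 0"
    using theta(2)[OF xy(2)] rho(2)[OF xy(2)] by (simp_all add: lform_simps)
  then have "x * (lform \<theta> (v 0 j k) * lform \<rho> (v 1 j k) - lform \<theta> (v 1 j k) * lform \<rho> (v 0 j k)) = 0"
    "y * (lform \<theta> (v 0 j k) * lform \<rho> (v 1 j k) - lform \<theta> (v 1 j k) * lform \<rho> (v 0 j k)) = 0"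
    by algebra+
  with xy(1) show ?thesis by auto
qed

text \<open>The ratio of the values at \<open>v 1 j k\<close> and \<open>v 0 j k\<close> is the same
  for both forms. It does not depend on \<open>k\<close> for \<theta> and not on \<open>j\<close>
  for \<rho>, so it is constant.\<close>

lemma ratio:
  defines "C \<equiv> lform \<theta> (v 1 0 0) / lform \<theta> (v 0 0 0)"
  shows "C \<noteq> 0" "lform \<theta> (v 1 j k) = C * lform \<theta> (v 0 j k)" "lform \<rho> (v 1 j k) = C * lform \<rho> (v 0 j k)"
proof -
  note nz = theta_nonzero rho_nonzero
  show "C \<noteq> 0" using nz by (simp add: C_def)
  have eq: "lform \<theta> (v 1 j k) / lform \<theta> (v 0 j k) = lform \<rho> (v 1 j k) / lform \<rho> (v 0 j k)" for j k
    using theta_rho_ratio[of j k] nz by (simp add: field_simps)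
  have "lform \<rho> (v 1 j k) / lform \<rho> (v 0 j k) = C" for j k
    using eq[of 0 k] unfolding theta_const[of _ 0 k] rho_const[of _ j k] by (simp add: C_def)
  then show "lform \<theta> (v 1 j k) = C * lform \<theta> (v 0 j k)" "lform \<rho> (v 1 j k) = C * lform \<rho> (v 0 j k)"
    using eq[of j k] nz by (simp_all add: field_simps)
qed

text \<open>The transversal is spanned by the points where it meets the edges, all of which are
  combinations \<open>C v\<^sub>0 - v\<^sub>1\<close> with the same \<open>C\<close>; a point of it on both planes then forces the
  linear forms of the two planes to take proportional values.\<close>

lemma plane_forms_proportional:
  assumes z: "z \<noteq> 0" "z \<in> R" "lform (\<sigma> 0) z = 0" "lform (\<sigma> 1) z = 0"
  obtains \<mu> where "\<mu> \<noteq> 0" "\<And>j k. lform (\<sigma> 0) (v 1 j k) = \<mu> * lform (\<sigma> 1) (v 0 j k)"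
proof -
  define C where "C = lform \<theta> (v 1 0 0) / lform \<theta> (v 0 0 0)"
  have C: "C \<noteq> 0" "lform \<theta> (v 1 j k) = C * lform \<theta> (v 0 j k)" for j k
    by (fact ratio[folded C_def])+
  define M where "M j k = C *s v 0 j k - v 1 j k" for j k
  have MR: "M j k \<in> R" for j k
  proof -
    obtain x y where xy: "x \<noteq> 0 \<or> y \<noteq> 0" "x *s v 0 j k + y *s v 1 j k \<in> R"
      using meets_edges by blast
    have "(x + y * C) * lform \<theta> (v 0 j k) = 0"
      using theta(2)[OF xy(2)] by (simp add: lform_simps C algebra_simps)
    then have x: "x = - y * C" using theta_nonzero by (simp add: eq_neg_iff_add_eq_0)
    with xy have "y \<noteq> 0" by auto
    have "(- inverse y) *s (x *s v 0 j k + y *s v 1 j k) \<in> R"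
      using line xy(2) unfolding is_line_def by (meson vec.subspace_scale)
    also have "(- inverse y) *s (x *s v 0 j k + y *s v 1 j k) = M j k"
      using \<open>y \<noteq> 0\<close> by (simp add: M_def x vec_eq_iff field_simps)
    finally show ?thesis .
  qed
  have indep: "x = 0 \<and> y = 0" if "x *s M 0 0 + y *s M 0 1 = 0" for x y
  proof -
    have "(x * C) *s v 0 0 0 + (y * C) *s v 0 0 1 + (- x) *s v 1 0 0 + (- y) *s v 1 0 1 = 0"
      using that by (simp add: M_def vec_eq_iff algebra_simps)
    from T_pair_independent[OF this] show ?thesis by simp
  qed
  define S R' where "S j k = lform (\<sigma> 0) (v 1 j k)" and "R' j k = lform (\<sigma> 1) (v 0 j k)" for j k
  have sM: "lform (\<sigma> 0) (M j k) = - S j k" "lform (\<sigma> 1) (M j k) = C * R' j k" for j k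
    by (simp_all add: M_def lform_simps sigma S_def R'_def)
  obtain \<alpha> \<delta> where ad: "z = \<alpha> *s M 0 0 + \<delta> *s M 0 1"
    using line_span[OF line MR MR indep z(2)] .
  obtain x y where xy: "M 1 0 = x *s M 0 0 + y *s M 0 1"
    using line_span[OF line MR MR indep MR] .
  have 1: "\<alpha> * S 0 0 + \<delta> * S 0 1 = 0" "\<alpha> * R' 0 0 + \<delta> * R' 0 1 = 0"
  proof -
    have "lform (\<sigma> 0) z = - (\<alpha> * S 0 0 + \<delta> * S 0 1)" "lform (\<sigma> 1) z = C * (\<alpha> * R' 0 0 + \<delta> * R' 0 1)"
      by (simp_all add: ad lform_simps sM algebra_simps)
    then show "\<alpha> * S 0 0 + \<delta> * S 0 1 = 0" "\<alpha> * R' 0 0 + \<delta> * R' 0 1 = 0"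
      unfolding z(3,4) using C(1) by (metis neg_equal_0_iff_equal, metis mult_eq_0_iff)
  qed
  have 2: "S 1 0 = x * S 0 0 + y * S 0 1" "R' 1 0 = x * R' 0 0 + y * R' 0 1"
  proof -
    have "lform (\<sigma> 0) (M 1 0) = - (x * S 0 0 + y * S 0 1)" "lform (\<sigma> 1) (M 1 0) = C * (x * R' 0 0 + y * R' 0 1)"
      by (simp_all add: xy lform_simps sM algebra_simps)
    then show "S 1 0 = x * S 0 0 + y * S 0 1" "R' 1 0 = x * R' 0 0 + y * R' 0 1"
      using C(1) unfolding sM neg_equal_iff_equal by simp_all
  qed
  have 3: "S 1 1 = S 1 0 + S 0 1 - S 0 0" "R' 1 1 = R' 1 0 + R' 0 1 - R' 0 0"
    by (simp_all add: S_def R'_def alternating lform_simps)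
  \<comment> \<open>The coordinates of \<open>z\<close> give a nontrivial relation between the pairs
    \<open>(S 0 0, R' 0 0)\<close> and \<open>(S 0 1, R' 0 1)\<close>, and the other two pairs are
    combinations of these. Hence all four are multiples of one pair \<open>(p, r)\<close>.\<close>
  have "\<exists>t p r. \<forall>j k. S j k = t j k * p \<and> R' j k = t j k * r"
  proof (cases "\<alpha> = 0")
    case True
    then have "\<delta> \<noteq> 0" using ad z(1) by auto
    with True 1 have "S 0 1 = 0" "R' 0 1 = 0" by auto
    then show ?thesis
      using 2 3
      by (intro exI[of _ "\<lambda>j k. if j = 0 then (if k = 0 then 1 else 0) else (if k = 0 then x else x - 1)"]
            exI[of _ "S 0 0"] exI[of _ "R' 0 0"]) (auto simp: forall_2' algebra_simps)
  next
    case False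
    define q where "q = - \<delta> / \<alpha>"
    have "S 0 0 = q * S 0 1" "R' 0 0 = q * R' 0 1"
      using 1 False by (simp_all add: q_def field_simps eq_neg_iff_add_eq_0)
    then show ?thesis
      using 2 3
      by (intro exI[of _ "\<lambda>j k. if j = 0 then (if k = 0 then q else 1) else (if k = 0 then x * q + y else x * q + y + 1 - q)"]
            exI[of _ "S 0 1"] exI[of _ "R' 0 1"]) (auto simp: forall_2' algebra_simps)
  qed
  then obtain t p r where t: "S j k = t j k * p" "R' j k = t j k * r" for j k
    by blast
  have "p \<noteq> 0"
  proof
    assume "p = 0"
    then have "lform (\<sigma> 0) (v i j k) = 0" for i j k
      using t(1)[of j k] sigma(1)[of 0] two_cases[of i] by (auto simp: S_def)
    then show False using T_spanning[of "\<sigma> 0" 0] sigma(2) by blast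
  qed
  have "r \<noteq> 0"
  proof
    assume "r = 0"
    then have "lform (\<sigma> 1) (v i j k) = 0" for i j k
      using t(2)[of j k] sigma(1)[of 1] two_cases[of i] by (auto simp: R'_def)
    then show False using T_spanning[of "\<sigma> 1" 0] sigma(2) by blast
  qed
  show ?thesis
    by (rule that[of "p / r"]) (use \<open>p \<noteq> 0\<close> \<open>r \<noteq> 0\<close> t in \<open>simp_all add: S_def R'_def\<close>)
qed

end

subsection \<open>Pencils of conics in a boundary plane\<close>

text \<open>Comparison of coefficients, first in \<open>t0\<close>, \<open>t1\<close> and then in
  \<open>u0\<close>, \<open>u1\<close>. With \<open>V 1 1\<close> eliminated, the unknowns are six
  values of each of the two forms, and their linear system has only the zero solution because the
  determinant of \<omega> is nonzero.\<close>

lemma conics_vanish: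
  fixes V :: "2 \<Rightarrow> 2 \<Rightarrow> complex^4" and \<omega> :: "2 \<Rightarrow> 2 \<Rightarrow> complex"
  assumes Q0: "symmetric_bilinear Q0" and Q1: "symmetric_bilinear Q1"
    and V: "V 1 1 = V 1 0 + V 0 1 - V 0 0"
    and nz: "\<And>j k. \<omega> j k \<noteq> 0"
    and det: "\<omega> 0 0 * \<omega> 1 1 \<noteq> \<omega> 0 1 * \<omega> 1 0"
    and eq: "\<And>t0 t1 u0 u1 x. x = (\<omega> 0 0 * t0 * u0) *s V 0 0 + (\<omega> 0 1 * t0 * u1) *s V 0 1 +
        (\<omega> 1 0 * t1 * u0) *s V 1 0 + (\<omega> 1 1 * t1 * u1) *s V 1 1 \<Longrightarrow> t1 * Q0 x x = t0 * Q1 x x"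
  shows "Q0 (V j k) (V j' k') = 0 \<and> Q1 (V j k) (V j' k') = 0"
proof -
  have sym: "\<And>x y. Q0 x y = Q0 y x" "\<And>x y. Q1 x y = Q1 y x"
    using Q0 Q1 by (simp_all add: symmetric_bilinear_def)
  note bil = symmetric_bilinear_simps[OF Q0] symmetric_bilinear_simps[OF Q1]
  define f where "f j u0 u1 = (\<omega> j 0 * u0) *s V j 0 + (\<omega> j 1 * u1) *s V j 1" for j u0 u1
  have e: "t1 * Q0 (t0 *s f 0 u0 u1 + t1 *s f 1 u0 u1) (t0 *s f 0 u0 u1 + t1 *s f 1 u0 u1) =
      t0 * Q1 (t0 *s f 0 u0 u1 + t1 *s f 1 u0 u1) (t0 *s f 0 u0 u1 + t1 *s f 1 u0 u1)" for t0 t1 u0 u1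
    by (rule eq[of _ t0 u0 u1 t1]) (simp add: f_def vec_eq_iff algebra_simps)
  \<comment> \<open>Both sides of \<open>e\<close> are cubic in \<open>(t0, t1)\<close>; the values
    at \<open>(1, 0)\<close>, \<open>(0, 1)\<close>, \<open>(1, 1)\<close> and
    \<open>(1, -1)\<close> determine the four coefficients.\<close>
  have q: "Q1 (f 0 u0 u1) (f 0 u0 u1) = 0" "Q0 (f 1 u0 u1) (f 1 u0 u1) = 0"
    "Q0 (f 0 u0 u1) (f 0 u0 u1) = 2 * Q1 (f 0 u0 u1) (f 1 u0 u1)"
    "2 * Q0 (f 0 u0 u1) (f 1 u0 u1) = Q1 (f 1 u0 u1) (f 1 u0 u1)" for u0 u1
  proof -
    note sy = sym(1)[of "f 1 u0 u1" "f 0 u0 u1"] sym(2)[of "f 1 u0 u1" "f 0 u0 u1"]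
    show a: "Q1 (f 0 u0 u1) (f 0 u0 u1) = 0" using e[of 0 1 u0 u1] by (simp add: bil)
    show b: "Q0 (f 1 u0 u1) (f 1 u0 u1) = 0" using e[of 1 0 u0 u1] by (simp add: bil)
    have c: "Q0 (f 0 u0 u1) (f 0 u0 u1) + 2 * Q0 (f 0 u0 u1) (f 1 u0 u1) =
        2 * Q1 (f 0 u0 u1) (f 1 u0 u1) + Q1 (f 1 u0 u1) (f 1 u0 u1)"
      using e[of 1 1 u0 u1] by (simp add: bil sy a b algebra_simps)
    have d: "2 * Q0 (f 0 u0 u1) (f 1 u0 u1) - Q0 (f 0 u0 u1) (f 0 u0 u1) =
        Q1 (f 1 u0 u1) (f 1 u0 u1) - 2 * Q1 (f 0 u0 u1) (f 1 u0 u1)"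
      using e[of "-1" 1 u0 u1] by (simp add: bil sy a b algebra_simps)
    show "Q0 (f 0 u0 u1) (f 0 u0 u1) = 2 * Q1 (f 0 u0 u1) (f 1 u0 u1)"
      "2 * Q0 (f 0 u0 u1) (f 1 u0 u1) = Q1 (f 1 u0 u1) (f 1 u0 u1)"
      using c d by algebra+
  qed
  define a b c d where abcd: "a = \<omega> 0 0" "b = \<omega> 0 1" "c = \<omega> 1 0" "d = \<omega> 1 1"
  have n: "a \<noteq> 0" "b \<noteq> 0" "c \<noteq> 0" "d \<noteq> 0" and det': "a * d - b * c \<noteq> 0"
    using nz det by (simp_all add: abcd)
  define p1 p2 p3 p4 p5 p6 where p: "p1 = Q0 (V 0 0) (V 0 0)" "p2 = Q0 (V 0 0) (V 0 1)" "p3 = Q0 (V 0 1) (V 0 1)"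
    "p4 = Q0 (V 0 0) (V 1 0)" "p5 = Q0 (V 0 1) (V 1 0)" "p6 = Q0 (V 1 0) (V 1 0)"
  define r1 r2 r3 r4 r5 r6 where r: "r1 = Q1 (V 0 0) (V 0 0)" "r2 = Q1 (V 0 0) (V 0 1)" "r3 = Q1 (V 0 1) (V 0 1)"
    "r4 = Q1 (V 0 0) (V 1 0)" "r5 = Q1 (V 0 1) (V 1 0)" "r6 = Q1 (V 1 0) (V 1 0)"
  have s: "Q0 (V 0 1) (V 0 0) = p2" "Q0 (V 1 0) (V 0 0) = p4" "Q0 (V 1 0) (V 0 1) = p5"
    "Q1 (V 0 1) (V 0 0) = r2" "Q1 (V 1 0) (V 0 0) = r4" "Q1 (V 1 0) (V 0 1) = r5"
    by (simp_all add: p r sym(1)[of "V 0 1" "V 0 0"] sym(1)[of "V 1 0"] sym(2)[of "V 0 1" "V 0 0"] sym(2)[of "V 1 0"])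
  have Qf: "Q0 (f 0 u0 u1) (f 0 u0 u1) = a * a * u0 * u0 * p1 + 2 * a * b * u0 * u1 * p2 + b * b * u1 * u1 * p3"
    "Q1 (f 0 u0 u1) (f 0 u0 u1) = a * a * u0 * u0 * r1 + 2 * a * b * u0 * u1 * r2 + b * b * u1 * u1 * r3"
    "Q0 (f 0 u0 u1) (f 1 u0 u1) = a * c * u0 * u0 * p4 + a * d * u0 * u1 * (p4 + p2 - p1)
       + b * c * u0 * u1 * p5 + b * d * u1 * u1 * (p5 + p3 - p2)"
    "Q1 (f 0 u0 u1) (f 1 u0 u1) = a * c * u0 * u0 * r4 + a * d * u0 * u1 * (r4 + r2 - r1)
       + b * c * u0 * u1 * r5 + b * d * u1 * u1 * (r5 + r3 - r2)"
    "Q0 (f 1 u0 u1) (f 1 u0 u1) = c * c * u0 * u0 * p6 + 2 * c * d * u0 * u1 * (p6 + p5 - p4)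
       + d * d * u1 * u1 * (p6 + p3 + p1 + 2 * p5 - 2 * p4 - 2 * p2)"
    "Q1 (f 1 u0 u1) (f 1 u0 u1) = c * c * u0 * u0 * r6 + 2 * c * d * u0 * u1 * (r6 + r5 - r4)
       + d * d * u1 * u1 * (r6 + r3 + r1 + 2 * r5 - 2 * r4 - 2 * r2)" for u0 u1
    unfolding f_def abcd[symmetric] V bil s p[symmetric] r[symmetric] by algebra+
  note q' = q[unfolded Qf]
  have r123: "r1 = 0" "r3 = 0" "r2 = 0"
    using q'(1)[of 1 0] q'(1)[of 0 1] q'(1)[of 1 1] n by simp_all
  have p6: "p6 = 0" using q'(2)[of 1 0] n by simp
  have p2: "p1 + p3 - 2 * p2 + 2 * p5 - 2 * p4 = 0"
  proof -
    have "d * d * (p1 + p3 - 2 * p2 + 2 * p5 - 2 * p4) = 0"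
      using q'(2)[of 0 1] unfolding p6 by algebra
    then show ?thesis using n by simp
  qed
  have p5: "p5 = p4"
  proof -
    have "2 * (c * d * (p5 - p4)) = 0"
      using q'(2)[of 1 1] q'(2)[of 0 1] unfolding p6 by algebra
    then show ?thesis using n by simp
  qed
  have p3: "p3 = 2 * p2 - p1" using p2 p5 by algebra
  have e1: "a * p1 = 2 * c * r4"
    using q'(3)[of 1 0] n by simp
  have e2: "b * (2 * p2 - p1) = 2 * d * r5"
    using q'(3)[of 0 1] n by (simp add: r123 p3)
  have e3: "a * b * p2 = a * d * r4 + b * c * r5"
  proof -
    have "2 * (a * b * p2) = 2 * (a * d * r4 + b * c * r5)"
      using q'(3)[of 1 1] q'(3)[of 1 0] q'(3)[of 0 1] unfolding r123 by algebra
    then show ?thesis by (rule mult_left_cancel[THEN iffD1, rotated]) simp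
  qed
  \<comment> \<open>Eliminating \<open>p1\<close> and \<open>p2\<close> from \<open>e1\<close>,
    \<open>e2\<close>, \<open>e3\<close> leaves the difference times the determinant.\<close>
  have r5: "r5 = r4"
  proof -
    have "(a * d - b * c) * (r5 - r4) = 0" using e1 e2 e3 by algebra
    then show ?thesis using det' by simp
  qed
  have e4: "2 * a * p4 = c * r6" using q'(4)[of 1 0] n by (simp add: mult.assoc)
  have e5: "2 * b * (p4 + p2 - p1) = d * r6"
  proof -
    have "d * (2 * b * (p4 + p2 - p1)) = d * (d * r6)"
      using q'(4)[of 0 1] unfolding r123 p3 p5 r5 by algebra
    then show ?thesis using n by simp
  qed
  have e6: "a * d * (p4 + p2 - p1) + b * c * p4 = c * d * r6"
  proof -
    have "2 * (a * d * (p4 + p2 - p1) + b * c * p4) = 2 * (c * d * r6)"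
      using q'(4)[of 1 1] q'(4)[of 1 0] q'(4)[of 0 1] unfolding r123 p5 r5 by algebra
    then show ?thesis by (rule mult_left_cancel[THEN iffD1, rotated]) simp
  qed
  \<comment> \<open>Here \<open>p4\<close> and \<open>p2 - p1\<close> are eliminated from
    \<open>e4\<close>, \<open>e5\<close>, \<open>e6\<close>.\<close>
  have "(a * d - b * c) * (a * d - b * c) * r6 = 0" using e4 e5 e6 by algebra
  then have r6: "r6 = 0" using det' by simp
  have p4: "p4 = 0" using e4 n r6 by simp
  have p21: "p2 = p1" using e5 n by (simp add: r6 p4)
  have "(a * d - b * c) * r4 = 0"
  proof -
    have "2 * ((a * d - b * c) * r4) = 0" using e1 e2 unfolding p21 r5 by algebra
    then show ?thesis by simp
  qed
  then have r4: "r4 = 0" using det' by simp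
  have p1: "p1 = 0" using e1 n r4 by simp
  note all0 = r123 p6 p5 p3 r5 r6 p4 p21 r4 p1
  show ?thesis
    using two_cases[of j] two_cases[of k] two_cases[of j'] two_cases[of k']
    by (auto simp: V bil s p[symmetric] r[symmetric] all0)
qed

subsection \<open>Extending rational identities\<close>

text \<open>A predicate on functions, so that polynomiality along a line follows from closure rules
  without writing the polynomial down.\<close>

definition polyfun :: "(complex \<Rightarrow> complex) \<Rightarrow> bool" where
  "polyfun f \<longleftrightarrow> (\<exists>p. \<forall>z. f z = poly p z)"

lemma polyfun_const: "polyfun (\<lambda>z. c)"
  unfolding polyfun_def by (rule exI[of _ "[:c:]"]) simp

lemma polyfun_linear: "polyfun (\<lambda>z. a + z * b)"
  unfolding polyfun_def by (rule exI[of _ "[:a, b:]"]) simp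

lemma polyfun_add: "polyfun f \<Longrightarrow> polyfun g \<Longrightarrow> polyfun (\<lambda>z. f z + g z)"
  unfolding polyfun_def by (metis poly_add)

lemma polyfun_diff: "polyfun f \<Longrightarrow> polyfun g \<Longrightarrow> polyfun (\<lambda>z. f z - g z)"
  unfolding polyfun_def by (metis poly_diff)

lemma polyfun_mult: "polyfun f \<Longrightarrow> polyfun g \<Longrightarrow> polyfun (\<lambda>z. f z * g z)"
  unfolding polyfun_def by (metis poly_mult)

lemma polyfun_power: "polyfun f \<Longrightarrow> polyfun (\<lambda>z. f z ^ n)"
  unfolding polyfun_def by (metis poly_power)

lemma polyfun_sum: "(\<And>a. a \<in> A \<Longrightarrow> polyfun (f a)) \<Longrightarrow> polyfun (\<lambda>z. \<Sum>a\<in>A. f a z)"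
  by (induction A rule: infinite_finite_induct) (auto intro: polyfun_const polyfun_add)

lemma polyfun_prod: "(\<And>a. a \<in> A \<Longrightarrow> polyfun (f a)) \<Longrightarrow> polyfun (\<lambda>z. \<Prod>a\<in>A. f a z)"
  by (induction A rule: infinite_finite_induct) (auto intro: polyfun_const polyfun_mult)

lemma polyfun_peval: "(\<And>i. polyfun (\<lambda>z. x z $ i)) \<Longrightarrow> polyfun (\<lambda>z. peval F (x z))"
  unfolding peval_def by (intro polyfun_sum polyfun_mult polyfun_const polyfun_prod polyfun_power)

text \<open>The product of the two polynomials vanishes everywhere, and the first is not the zero
  polynomial.\<close>

lemma polyfun_mult_eq_zero:
  assumes "polyfun f" "polyfun g" "\<And>z. f z \<noteq> 0 \<Longrightarrow> g z = 0" "f z0 \<noteq> 0"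
  shows "g z = 0"
proof -
  obtain p q where pq: "\<And>z. f z = poly p z" "\<And>z. g z = poly q z"
    using assms(1,2) unfolding polyfun_def by metis
  have "poly (p * q) z = 0" for z using assms(3)[of z] pq by auto
  then have "p * q = 0" using poly_all_0_iff_0 by blast
  moreover have "p \<noteq> 0" using assms(4) pq by auto
  ultimately show ?thesis using pq by simp
qed

lemma vec_nonzero_nth: "x \<noteq> 0 \<Longrightarrow> \<exists>i. x $ i \<noteq> (0::complex)"
  by (auto simp: vec_eq_iff)

text \<open>The identity between rational maps, valid where the composite is defined, extends to all
  arguments along the line joining them to a point of definedness.\<close>

lemma mutually_inverse_identities:
  assumes inv: "mutually_inverse (trilinear w P) (pencil A) (pencil B) (pencil C)"
  shows "peval (A 0) (trilinear w P s t u) * s $ 1 = peval (A 1) (trilinear w P s t u) * s $ 0"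
    and "peval (B 0) (trilinear w P s t u) * t $ 1 = peval (B 1) (trilinear w P s t u) * t $ 0"
proof -
  define f where "f = trilinear w P"
  define dom where "dom s t u \<longleftrightarrow> s \<noteq> 0 \<and> t \<noteq> 0 \<and> u \<noteq> 0 \<and> f s t u \<noteq> 0 \<and> pencil A (f s t u) \<noteq> 0 \<and>
    pencil B (f s t u) \<noteq> 0 \<and> pencil C (f s t u) \<noteq> 0" for s t u
  note inv_unfolded = inv[unfolded mutually_inverse_def Let_def, folded f_def, folded dom_def]
  have inv': "\<forall>s t u. dom s t u \<longrightarrow>
      proj_eq (pencil A (f s t u)) s \<and> proj_eq (pencil B (f s t u)) t \<and> proj_eq (pencil C (f s t u)) u"
    by (rule inv_unfolded[THEN conjunct2, THEN conjunct1])
  obtain s0 t0 u0 where d0: "dom s0 t0 u0"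
    using inv_unfolded[THEN conjunct1] by blast
  have eq: "proj_eq (pencil A (f s t u)) s" "proj_eq (pencil B (f s t u)) t" if "dom s t u" for s t u
    using inv' that by simp_all
  have pe: "x $ 0 * y $ 1 = x $ 1 * y $ 0" if "proj_eq x y" for x y :: "complex^2"
    using that by (auto simp: proj_eq_def)
  obtain i1 i2 i3 i4 i5 i6 i7 where nz: "s0 $ i1 \<noteq> 0" "t0 $ i2 \<noteq> 0" "u0 $ i3 \<noteq> 0" "f s0 t0 u0 $ i4 \<noteq> 0"
    "pencil A (f s0 t0 u0) $ i5 \<noteq> 0" "pencil B (f s0 t0 u0) $ i6 \<noteq> 0" "pencil C (f s0 t0 u0) $ i7 \<noteq> 0"
    using d0 unfolding dom_def by (metis vec_nonzero_nth)
  define S T U where "S z = s0 + z *s (s - s0)" and "T z = t0 + z *s (t - t0)" and "U z = u0 + z *s (u - u0)" for z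
  have lin: "polyfun (\<lambda>z. S z $ i)" "polyfun (\<lambda>z. T z $ i)" "polyfun (\<lambda>z. U z $ i)" for i
    unfolding S_def T_def U_def vector_add_component vector_smult_component by (rule polyfun_linear)+
  have f: "polyfun (\<lambda>z. f (S z) (T z) (U z) $ i)" for i
    unfolding f_def trilinear_def sum_component vector_smult_component
    by (intro polyfun_sum polyfun_mult polyfun_const lin)
  have pen: "polyfun (\<lambda>z. pencil A (f (S z) (T z) (U z)) $ i)" for A i
    unfolding pencil_def vec_lambda_beta by (intro polyfun_peval f)
  \<comment> \<open>The product of one coordinate of each of the seven vectors in
    \<open>dom\<close>, chosen nonzero at \<open>z = 0\<close>. Where \<open>G\<close> is nonzero
    the composite is defined.\<close>
  define G where "G z = S z $ i1 * T z $ i2 * U z $ i3 * f (S z) (T z) (U z) $ i4 *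
    pencil A (f (S z) (T z) (U z)) $ i5 * pencil B (f (S z) (T z) (U z)) $ i6 * pencil C (f (S z) (T z) (U z)) $ i7" for z
  have G: "polyfun G" unfolding G_def by (intro polyfun_mult lin f pen)
  have G0: "G 0 \<noteq> 0" using nz by (simp add: G_def S_def T_def U_def)
  have dom: "dom (S z) (T z) (U z)" if "G z \<noteq> 0" for z
    using that unfolding G_def dom_def by auto
  have at1: "S 1 = s" "T 1 = t" "U 1 = u" by (simp_all add: S_def T_def U_def)
  have "pencil A (f (S z) (T z) (U z)) $ 0 * S z $ 1 - pencil A (f (S z) (T z) (U z)) $ 1 * S z $ 0 = 0" for z
    by (rule polyfun_mult_eq_zero[OF G _ _ G0]; (intro polyfun_diff polyfun_mult pen lin)?)
       (use eq[OF dom] pe in simp)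
  from this[of 1] show "peval (A 0) (trilinear w P s t u) * s $ 1 = peval (A 1) (trilinear w P s t u) * s $ 0"
    unfolding at1 by (simp add: pencil_def f_def)
  have "pencil B (f (S z) (T z) (U z)) $ 0 * T z $ 1 - pencil B (f (S z) (T z) (U z)) $ 1 * T z $ 0 = 0" for z
    by (rule polyfun_mult_eq_zero[OF G _ _ G0]; (intro polyfun_diff polyfun_mult pen lin)?)
       (use eq[OF dom] pe in simp)
  from this[of 1] show "peval (B 0) (trilinear w P s t u) * t $ 1 = peval (B 1) (trilinear w P s t u) * t $ 0"
    unfolding at1 by (simp add: pencil_def f_def)
qed

subsection \<open>Boundary planes and quadrics\<close>

lemma zariski_closure_vanish:
  assumes "homogeneous d F" "\<And>v. v \<in> S \<Longrightarrow> peval F v = 0" "x \<in> zariski_closure S"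
  shows "peval F x = 0"
  using assms unfolding zariski_closure_def by blast

lemma zariski_closure_superset: "x \<in> S \<Longrightarrow> x \<in> zariski_closure S"
  unfolding zariski_closure_def by blast

lemma is_plane_form:
  assumes "is_plane S"
  obtains \<sigma> where "\<sigma> \<noteq> 0" "S = {x. lform \<sigma> x = 0}"
proof -
  obtain F where F: "homogeneous 1 F" "irreducible F" "S = {x. peval F x = 0}"
    using assms by (auto simp: is_surface_def)
  obtain \<sigma> where \<sigma>: "F = lpoly \<sigma>" using homogeneous_1[OF F(1)] .
  have "\<sigma> \<noteq> 0" using F(2) \<sigma> by (auto simp: irreducible_def lpoly_def)
  then show ?thesis using that F(3) \<sigma> by (simp add: peval_lpoly)
qed

text \<open>A linear form that vanishes on \<open>S\<close> vanishes on its closure, and no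
  irreducible quadric lies in a plane.\<close>

lemma quadric_closure_spanning:
  assumes "is_quadric (zariski_closure S)" "\<And>v. v \<in> S \<Longrightarrow> lform c v = 0"
  shows "c = 0"
proof (rule ccontr)
  assume "c \<noteq> 0"
  obtain F where F: "homogeneous 2 F" "irreducible F" "zariski_closure S = {x. peval F x = 0}"
    using assms(1) by (auto simp: is_surface_def)
  have "lform c x = 0" if "peval F x = 0" for x
    using zariski_closure_vanish[OF homogeneous_lpoly[of c], of S x] assms(2) that F(3)
    by (auto simp: peval_lpoly)
  then show False using irreducible_quadric_not_in_plane[OF F(1,2) \<open>c \<noteq> 0\<close>] by blast
qed

lemma lform_kernel_proportional:
  assumes "\<sigma> \<noteq> 0" "\<And>x. lform \<sigma> x = 0 \<Longrightarrow> lform \<tau> x = 0"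
  obtains c where "\<tau> = c *s \<sigma>"
proof -
  obtain e where e: "lform \<sigma> e \<noteq> 0" using lform_eq_zero_imp assms(1) by blast
  define c where "c = lform \<tau> e / lform \<sigma> e"
  have "lform (\<tau> - c *s \<sigma>) x = 0" for x
  proof -
    have "lform \<sigma> (x - (lform \<sigma> x / lform \<sigma> e) *s e) = 0" using e by (simp add: lform_simps)
    then have "lform \<tau> (x - (lform \<sigma> x / lform \<sigma> e) *s e) = 0" by (rule assms(2))
    then show ?thesis by (simp add: lform_simps lform_simps_left c_def field_simps)
  qed
  then have "\<tau> - c *s \<sigma> = 0" by (rule lform_eq_zero_imp)
  then show ?thesis using that[of c] by simp
qed

text \<open>The form \<open>c\<close> is a left null vector of the matrix with columns
  \<open>v1\<close>, ..., \<open>v4\<close>; a singular square matrix also has a right null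
  vector.\<close>

lemma hyperplane_dependent:
  fixes c v1 v2 v3 v4 :: "complex^4"
  assumes "c \<noteq> 0" "lform c v1 = 0" "lform c v2 = 0" "lform c v3 = 0" "lform c v4 = 0"
  obtains x1 x2 x3 x4 where "x1 *s v1 + x2 *s v2 + x3 *s v3 + x4 *s v4 = 0"
    "x1 \<noteq> 0 \<or> x2 \<noteq> 0 \<or> x3 \<noteq> 0 \<or> x4 \<noteq> 0"
proof -
  define v :: "4 \<Rightarrow> complex^4" where
    "v i = (if i = 1 then v1 else if i = 2 then v2 else if i = 3 then v3 else v4)" for i
  define M :: "complex^4^4" where "M = (\<chi> i j. v j $ i)"
  have v: "v 1 = v1" "v 2 = v2" "v 3 = v3" "v 4 = v4"
    by (simp_all add: v_def)
  have mult: "M *v x = x $ 1 *s v1 + x $ 2 *s v2 + x $ 3 *s v3 + x $ 4 *s v4" for x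
    by (simp add: vec_eq_iff matrix_vector_mult_def M_def sum_4 v mult.commute)
  have "\<not> (\<forall>x. M *v x = 0 \<longrightarrow> x = 0)"
  proof
    assume "\<forall>x. M *v x = 0 \<longrightarrow> x = 0"
    then obtain B where "B ** M = mat 1"
      unfolding matrix_left_invertible_ker[symmetric] by blast
    then have MB: "M ** B = mat 1" by (simp add: matrix_left_right_inverse)
    have "lform c (v j) = 0" for j using assms(2-) by (simp add: v_def)
    then have "c v* M = 0"
      by (simp add: vec_eq_iff vector_matrix_mult_def M_def lform_def mult.commute)
    then have "c v* (M ** B) = 0" by (simp add: vector_matrix_mul_assoc[symmetric])
    then show False using \<open>c \<noteq> 0\<close> by (simp add: MB)
  qed
  then obtain x where x: "M *v x = 0" "x \<noteq> 0" by blast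
  then show ?thesis using that[of "x $ 1" "x $ 2" "x $ 3" "x $ 4"] mult[of x]
    by (auto simp: vec_eq_iff forall_4)
qed

lemma cvec_simps:
  "cvec p $ i = of_real (p $ i)" "cvec p = 0 \<longleftrightarrow> p = 0"
  "lform (cvec n) (cvec p) = of_real (n \<bullet> p)"
  by (simp_all add: cvec_def vec_eq_iff lform_def inner_vec_def)

lemma hyperplane_lform: "hyperplane n = {x. lform (cvec n) x = 0}"
  by (simp add: hyperplane_def lform_def cvec_def)

text \<open>With a nonzero third coefficient, \<open>r\<close> would lie on the line through
  \<open>p\<close> and \<open>q\<close>, and the two joins, of equal dimension, would
  coincide.\<close>

lemma join_independent:
  assumes "is_line (join p q)" "is_line (join p r)" "join p q \<noteq> join p r"
    and eq: "x *s cvec p + y *s cvec q + z *s cvec r = 0"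
  shows "x = 0 \<and> y = 0 \<and> z = 0"
proof -
  have "z = 0"
  proof (rule ccontr)
    assume "z \<noteq> 0"
    then have "cvec r = (- x / z) *s cvec p + (- y / z) *s cvec q"
      using eq by (simp add: vec_eq_iff field_simps eq_neg_iff_add_eq_0)
    then have "cvec r \<in> join p q" unfolding join_def mem_span_pair by blast
    then have "join p r \<subseteq> join p q"
      unfolding join_def by (intro vec.span_minimal) (auto intro: vec.span_base)
    then have "join p r = join p q"
      using assms(1,2) unfolding is_line_def by (intro vec.subspace_dim_equal) auto
    then show False using assms(3) by simp
  qed
  then show ?thesis using is_line_span_independent[of "cvec p" "cvec q" x y] assms(1) eq
    by (simp add: join_def)
qed

text \<open>The real and imaginary parts of a relation between real vectors are again relations, and
  one of them is nontrivial. The scaling factors have to be real since the weights are.\<close>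

lemma real_relation:
  assumes "x1 *s cvec p1 + x2 *s cvec p2 + x3 *s cvec p3 + x4 *s cvec p4 = 0"
    "x1 \<noteq> 0 \<or> x2 \<noteq> 0 \<or> x3 \<noteq> 0 \<or> x4 \<noteq> 0"
  obtains y1 y2 y3 y4 :: real where
    "of_real y1 *s cvec p1 + of_real y2 *s cvec p2 + of_real y3 *s cvec p3 + of_real y4 *s cvec p4 = 0"
    "y1 \<noteq> 0 \<or> y2 \<noteq> 0 \<or> y3 \<noteq> 0 \<or> y4 \<noteq> 0"
proof -
  have comp: "x1 * of_real (p1 $ i) + x2 * of_real (p2 $ i) + x3 * of_real (p3 $ i) + x4 * of_real (p4 $ i) = 0" for i
    using assms(1) by (simp add: vec_eq_iff cvec_simps)
  have re: "of_real (Re x1) *s cvec p1 + of_real (Re x2) *s cvec p2 + of_real (Re x3) *s cvec p3 + of_real (Re x4) *s cvec p4 = 0"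
    using comp by (auto simp: vec_eq_iff cvec_simps complex_eq_iff)
  have im: "of_real (Im x1) *s cvec p1 + of_real (Im x2) *s cvec p2 + of_real (Im x3) *s cvec p3 + of_real (Im x4) *s cvec p4 = 0"
    using comp by (auto simp: vec_eq_iff cvec_simps complex_eq_iff)
  show ?thesis
    using that[OF re] that[OF im] assms(2) by (auto simp: complex_eq_iff)
qed

subsection \<open>Scaffold maps\<close>

locale scaffold_map =
  fixes w :: weights and P :: control_points and r :: "2 \<Rightarrow> (complex^4) set" and \<theta> \<rho> :: "2 \<Rightarrow> real^4"
  assumes P0: "P i j k $ 0 = 1"
    and nondegenerate: "nondegenerate w P"
    and scaffold: "scaffold w P r"
    and theta_plane: "plane_through (\<theta> l) (y_line P) (r l)"
    and rho_plane: "plane_through (\<rho> l) (z_line P) (r l)"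
begin

definition E :: "2 \<Rightarrow> 2 \<Rightarrow> 2 \<Rightarrow> complex^4" where
  "E i j k = of_real (w i j k) *s cvec (P i j k)"

lemma trilinear_E: "trilinear w P s t u = (\<Sum>i\<in>UNIV. \<Sum>j\<in>UNIV. \<Sum>k\<in>UNIV. (s $ i * t $ j * u $ k) *s E i j k)"
  unfolding trilinear_def E_def by (intro sum.cong) (simp_all add: algebra_simps)

lemma lform_trilinear:
  "lform c (trilinear w P s t u) = (\<Sum>i\<in>UNIV. \<Sum>j\<in>UNIV. \<Sum>k\<in>UNIV. s $ i * t $ j * u $ k * lform c (E i j k))"
  by (simp add: trilinear_E lform_sum lform_simps)

lemma trilinear_axis: "trilinear w P (axis i 1) (axis j 1) (axis k 1) = E i j k"
  using two_cases[of i] two_cases[of j] two_cases[of k]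
  by (auto simp: trilinear_E sum_2' axis_def)

lemma cvec_P_nonzero: "cvec (P i j k) \<noteq> 0"
  using P0[of i j k] by (auto simp: cvec_simps vec_eq_iff intro: exI[of _ 0])

lemma E_spanning_T:
  assumes "\<And>i k. lform c (E i j k) = 0"
  shows "c = 0"
proof (rule quadric_closure_spanning)
  show "is_quadric (zariski_closure {x. x \<noteq> 0 \<and> (\<exists>s u. x = trilinear w P s (axis j 1) u)})"
    using scaffold unfolding scaffold_def T_surf_def by blast
  show "lform c v = 0" if "v \<in> {x. x \<noteq> 0 \<and> (\<exists>s u. x = trilinear w P s (axis j 1) u)}" for v
    using that assms by (auto simp: lform_trilinear axis_def intro!: sum.neutral)
qed

lemma E_spanning_Y:
  assumes "\<And>i j. lform c (E i j k) = 0"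
  shows "c = 0"
proof (rule quadric_closure_spanning)
  show "is_quadric (zariski_closure {x. x \<noteq> 0 \<and> (\<exists>s t. x = trilinear w P s t (axis k 1))})"
    using scaffold unfolding scaffold_def Y_surf_def by blast
  show "lform c v = 0" if "v \<in> {x. x \<noteq> 0 \<and> (\<exists>s t. x = trilinear w P s t (axis k 1))}" for v
    using that assms by (auto simp: lform_trilinear axis_def intro!: sum.neutral)
qed

text \<open>With a zero weight only three vectors would remain to span the quadric
  \<open>T_surf w P j\<close>, and three vectors always lie in a plane.\<close>

lemma weight_nonzero: "w i j k \<noteq> 0"
proof
  assume "w i j k = 0"
  then have z: "E i j k = 0" by (simp add: E_def)
  obtain i' where i': "i' \<noteq> i" using ex_other_2 by blast
  obtain k' where k': "k' \<noteq> k" using ex_other_2 by blast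
  obtain c where c: "c \<noteq> 0" "lform (E i j k') c = 0" "lform (E i' j k) c = 0" "lform (E i' j k') c = 0"
    using common_zero_of_three_forms .
  have "lform c (E a j b) = 0" for a b
    unfolding lform_commute[of c] using other_2[OF i', of a] other_2[OF k', of b] c(2-) z
    by (elim disjE) (simp_all add: lform_simps_left)
  then show False using E_spanning_T[of c j] c(1) by blast
qed

lemma lines:
  "is_line (s_line P j k)" "is_line (t_line P i k)" "is_line (u_line P i j)"
proof -
  have "\<forall>L\<in>set (boundary_lines P). is_line L"
    using nondegenerate unfolding nondegenerate_def by simp
  moreover have "s_line P j k \<in> set (boundary_lines P)"
    using two_cases[of j] two_cases[of k] by (elim disjE) (simp_all add: boundary_lines_def)
  moreover have "t_line P i k \<in> set (boundary_lines P)"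
    using two_cases[of i] two_cases[of k] by (elim disjE) (simp_all add: boundary_lines_def)
  moreover have "u_line P i j \<in> set (boundary_lines P)"
    using two_cases[of i] two_cases[of j] by (elim disjE) (simp_all add: boundary_lines_def)
  ultimately show "is_line (s_line P j k)" "is_line (t_line P i k)" "is_line (u_line P i j)"
    by blast+
qed

lemma lines_distinct:
  "u_line P i j \<noteq> t_line P i k"
  "s_line P j k = s_line P j' k' \<Longrightarrow> j = j' \<and> k = k'"
proof -
  have d: "distinct (boundary_lines P)"
    using nondegenerate unfolding nondegenerate_def by simp
  have "t_line P i k \<noteq> u_line P i j"
    using two_cases[of i] two_cases[of j] two_cases[of k] d
    by (elim disjE) (simp_all add: boundary_lines_def)
  then show "u_line P i j \<noteq> t_line P i k" by simp
  have ss: "s_line P 0 0 \<noteq> s_line P 0 1" "s_line P 0 0 \<noteq> s_line P 1 0" "s_line P 0 0 \<noteq> s_line P 1 1"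
    "s_line P 0 1 \<noteq> s_line P 1 0" "s_line P 0 1 \<noteq> s_line P 1 1" "s_line P 1 0 \<noteq> s_line P 1 1"
    using d by (simp_all add: boundary_lines_def)
  show "s_line P j k = s_line P j' k' \<Longrightarrow> j = j' \<and> k = k'"
    using two_cases[of j] two_cases[of k] two_cases[of j'] two_cases[of k'] ss ss[symmetric]
    by (elim disjE) simp_all
qed

lemma triple_independent:
  assumes "j \<noteq> j'" "k \<noteq> k'"
    and "x *s cvec (P i j k) + y *s cvec (P i j k') + z *s cvec (P i j' k) = 0"
  shows "x = 0 \<and> y = 0 \<and> z = 0"
proof (rule join_independent)
  have comm: "join p q = join q p" for p q by (simp add: join_def insert_commute)
  have u: "join (P i j k) (P i j k') = u_line P i j"
    using assms(2) two_cases[of k] two_cases[of k'] comm by (auto simp: u_line_def)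
  have t: "join (P i j k) (P i j' k) = t_line P i k"
    using assms(1) two_cases[of j] two_cases[of j'] comm by (auto simp: t_line_def)
  show "is_line (join (P i j k) (P i j k'))" "is_line (join (P i j k) (P i j' k))"
    "join (P i j k) (P i j k') \<noteq> join (P i j k) (P i j' k)"
    unfolding u t using lines lines_distinct by auto
qed (rule assms(3))

lemma plane_forms:
  obtains \<sigma> where "\<And>i. \<sigma> i \<noteq> 0" "\<And>i. Sigma_surf w P i = {x. lform (\<sigma> i) x = 0}"
proof -
  have "\<forall>i. \<exists>c. c \<noteq> 0 \<and> Sigma_surf w P i = {x. lform c x = 0}"
    using scaffold is_plane_form unfolding scaffold_def by metis
  then show ?thesis using that by metis
qed

lemma E_in_plane: "E i j k \<in> Sigma_surf w P i"
  unfolding Sigma_surf_def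
proof (rule zariski_closure_superset)
  have "E i j k \<noteq> 0"
    using weight_nonzero[of i j k] cvec_P_nonzero[of i j k] by (simp add: E_def)
  then show "E i j k \<in> {x. x \<noteq> 0 \<and> (\<exists>t u. x = trilinear w P (axis i 1) t u)}"
    unfolding trilinear_axis[symmetric] by blast
qed

lemma plane_form_P:
  assumes "Sigma_surf w P i = {x. lform c x = 0}"
  shows "lform c (cvec (P i j k)) = 0"
  using E_in_plane[of i j k] weight_nonzero[of i j k] unfolding assms by (simp add: E_def lform_simps)

text \<open>The four control points lie in a plane, so they satisfy a real relation. No coefficient
  vanishes, because any three of the points are independent by
  \<open>triple_independent\<close>.\<close>

lemma scaling_exists:
  "\<exists>c :: 2 \<Rightarrow> 2 \<Rightarrow> real. (\<forall>j k. c j k \<noteq> 0) \<and>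
     of_real (c 1 1) *s cvec (P i 1 1) =
     of_real (c 1 0) *s cvec (P i 1 0) + of_real (c 0 1) *s cvec (P i 0 1) - of_real (c 0 0) *s cvec (P i 0 0)"
proof -
  obtain \<sigma> where s: "\<And>i. \<sigma> i \<noteq> 0" "\<And>i. Sigma_surf w P i = {x. lform (\<sigma> i) x = 0}"
    using plane_forms by blast
  obtain x1 x2 x3 x4 where
    "x1 *s cvec (P i 0 0) + x2 *s cvec (P i 0 1) + x3 *s cvec (P i 1 0) + x4 *s cvec (P i 1 1) = 0"
    "x1 \<noteq> 0 \<or> x2 \<noteq> 0 \<or> x3 \<noteq> 0 \<or> x4 \<noteq> 0"
    by (rule hyperplane_dependent[OF s(1)[of i], of "cvec (P i 0 0)" "cvec (P i 0 1)" "cvec (P i 1 0)" "cvec (P i 1 1)"])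
       (use plane_form_P[OF s(2)] in auto)
  then obtain y1 y2 y3 y4 :: real where y:
    "of_real y1 *s cvec (P i 0 0) + of_real y2 *s cvec (P i 0 1) + of_real y3 *s cvec (P i 1 0) + of_real y4 *s cvec (P i 1 1) = 0"
    "y1 \<noteq> 0 \<or> y2 \<noteq> 0 \<or> y3 \<noteq> 0 \<or> y4 \<noteq> 0"
    by (rule real_relation)
  have "y1 \<noteq> 0"
    using y triple_independent[of 1 0 1 0 "of_real y4" i "of_real y3" "of_real y2"] by (auto simp: algebra_simps)
  moreover have "y2 \<noteq> 0"
    using y triple_independent[of 1 0 0 1 "of_real y3" i "of_real y4" "of_real y1"] by (auto simp: algebra_simps)
  moreover have "y3 \<noteq> 0"
    using y triple_independent[of 0 1 1 0 "of_real y2" i "of_real y1" "of_real y4"] by (auto simp: algebra_simps)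
  moreover have "y4 \<noteq> 0"
    using y triple_independent[of 0 1 0 1 "of_real y1" i "of_real y2" "of_real y3"] by (auto simp: algebra_simps)
  \<comment> \<open>The coefficients of the relation themselves are the scaling factors, with the
    sign changed at the two mixed indices.\<close>
  ultimately show ?thesis
    using y(1)
    by (intro exI[of _ "\<lambda>j k. if j = 0 then (if k = 0 then y1 else - y2) else (if k = 0 then - y3 else y4)"])
       (auto simp: vec_eq_iff algebra_simps add_eq_0_iff2)
qed

end

section \<open>Normalized control points\<close>

locale scaled_scaffold = scaffold_map +
  fixes c :: "2 \<Rightarrow> 2 \<Rightarrow> 2 \<Rightarrow> real" and \<sigma> :: "2 \<Rightarrow> complex^4"
  assumes c_nonzero: "c i j k \<noteq> 0"
    and c_alternating: "of_real (c i 1 1) *s cvec (P i 1 1) =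
      of_real (c i 1 0) *s cvec (P i 1 0) + of_real (c i 0 1) *s cvec (P i 0 1) - of_real (c i 0 0) *s cvec (P i 0 0)"
    and sigma_nonzero: "\<sigma> i \<noteq> 0" and sigma_surf: "Sigma_surf w P i = {x. lform (\<sigma> i) x = 0}"
begin

definition v :: "2 \<Rightarrow> 2 \<Rightarrow> 2 \<Rightarrow> complex^4" where
  "v i j k = of_real (c i j k) *s cvec (P i j k)"

text \<open>The weights relative to the scaled points \<open>v\<close>: the trilinear map has
  weights \<omega> and vertices \<open>v\<close>.\<close>

definition \<omega> :: "2 \<Rightarrow> 2 \<Rightarrow> 2 \<Rightarrow> real" where
  "\<omega> i j k = w i j k / c i j k"

lemma omega_nonzero: "\<omega> i j k \<noteq> 0"
  by (simp add: \<omega>_def c_nonzero weight_nonzero)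

lemma E_v: "E i j k = of_real (\<omega> i j k) *s v i j k"
  using c_nonzero[of i j k] by (simp add: E_def v_def \<omega>_def)

lemma lform_v_eq_0: "lform d (v i j k) = 0 \<longleftrightarrow> lform d (E i j k) = 0"
  by (simp add: E_v lform_simps omega_nonzero)

sublocale frame v \<sigma>
proof
  show "v i 1 1 = v i 1 0 + v i 0 1 - v i 0 0" for i
    unfolding v_def by (rule c_alternating)
  show "x = 0 \<and> y = 0 \<and> z = 0" if "x *s v i 0 0 + y *s v i 0 1 + z *s v i 1 0 = 0" for x i y z
    using triple_independent[of 0 1 0 1 "x * of_real (c i 0 0)" i "y * of_real (c i 0 1)" "z * of_real (c i 1 0)"]
      that c_nonzero by (simp add: v_def)
  show "d = 0" if "\<And>i k. lform d (v i j k) = 0" for d j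
    using that E_spanning_T[of d j] by (simp add: lform_v_eq_0)
  show "d = 0" if "\<And>i j. lform d (v i j k) = 0" for d k
    using that E_spanning_Y[of d k] by (simp add: lform_v_eq_0)
  show "lform (\<sigma> i) (v i j k) = 0" for i j k
    using plane_form_P[OF sigma_surf] by (simp add: v_def lform_simps)
  show "\<sigma> i \<noteq> 0" for i by (rule sigma_nonzero)
qed

lemma v_in_join: "v i j k \<in> join (P i j k) q" "v i j k \<in> join q (P i j k)"
  unfolding v_def join_def by (auto intro: vec.span_scale vec.span_base)

text \<open>By the alternating relation the same vector is a difference along both edges
  \<open>u_line P i 0\<close> and \<open>u_line P i 1\<close>, so it represents their intersection
  point.\<close>

lemma diff_in_y_line: "v i 0 1 - v i 0 0 \<in> y_line P"
proof -
  have eq: "v i 0 1 - v i 0 0 = v i 1 1 - v i 1 0" by (simp add: alternating)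
  have "v i 0 1 - v i 0 0 \<in> u_line P i 0"
    using v_in_join(2)[of i 0 1 "P i 0 0"] v_in_join(1)[of i 0 0 "P i 0 1"]
    unfolding u_line_def join_def by (rule vec.span_diff)
  moreover have "v i 0 1 - v i 0 0 \<in> u_line P i 1"
    unfolding eq using v_in_join(2)[of i 1 1 "P i 1 0"] v_in_join(1)[of i 1 0 "P i 1 1"]
    unfolding u_line_def join_def by (rule vec.span_diff)
  ultimately show ?thesis
    unfolding y_line_def using two_cases[of i] by (intro vec.span_base) auto
qed

lemma diff_in_z_line: "v i 1 0 - v i 0 0 \<in> z_line P"
proof -
  have eq: "v i 1 0 - v i 0 0 = v i 1 1 - v i 0 1" by (simp add: alternating)
  have "v i 1 0 - v i 0 0 \<in> t_line P i 0"
    using v_in_join(2)[of i 1 0 "P i 0 0"] v_in_join(1)[of i 0 0 "P i 1 0"]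
    unfolding t_line_def join_def by (rule vec.span_diff)
  moreover have "v i 1 0 - v i 0 0 \<in> t_line P i 1"
    unfolding eq using v_in_join(2)[of i 1 1 "P i 0 1"] v_in_join(1)[of i 0 1 "P i 1 1"]
    unfolding t_line_def join_def by (rule vec.span_diff)
  ultimately show ?thesis
    unfolding z_line_def using two_cases[of i] by (intro vec.span_base) auto
qed

lemma plane_through_forms:
  assumes "plane_through n L M"
  shows "cvec n \<noteq> 0" "z \<in> L \<Longrightarrow> lform (cvec n) z = 0" "z \<in> M \<Longrightarrow> lform (cvec n) z = 0"
  using assms unfolding plane_through_def hyperplane_lform by (auto simp: cvec_simps)

lemma transversal: "transversal v \<sigma> (r l) (cvec (\<theta> l)) (cvec (\<rho> l))"
proof unfold_locales
  note th = plane_through_forms[OF theta_plane[of l]] and rh = plane_through_forms[OF rho_plane[of l]]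
  show "is_line (r l)" using scaffold unfolding scaffold_def by blast
  show "\<exists>x y. (x \<noteq> 0 \<or> y \<noteq> 0) \<and> x *s v 0 j k + y *s v 1 j k \<in> r l" for j k
  proof -
    obtain z where z: "z \<noteq> 0" "z \<in> s_line P j k" "z \<in> r l"
      using scaffold unfolding scaffold_def meets_def by blast
    then obtain x y where xy: "z = x *s cvec (P 0 j k) + y *s cvec (P 1 j k)"
      unfolding s_line_def join_def mem_span_pair by blast
    then have "z = (x / of_real (c 0 j k)) *s v 0 j k + (y / of_real (c 1 j k)) *s v 1 j k"
      using c_nonzero by (simp add: v_def)
    then show ?thesis
      using z by (intro exI[of _ "x / of_real (c 0 j k)"] exI[of _ "y / of_real (c 1 j k)"]) auto
  qed
  show "cvec (\<theta> l) \<noteq> 0" "z \<in> r l \<Longrightarrow> lform (cvec (\<theta> l)) z = 0" for z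
    using th by auto
  show "cvec (\<rho> l) \<noteq> 0" "z \<in> r l \<Longrightarrow> lform (cvec (\<rho> l)) z = 0" for z
    using rh by auto
  show "lform (cvec (\<theta> l)) (v i j 1) = lform (cvec (\<theta> l)) (v i j 0)" for i j
    using th(2)[OF diff_in_y_line[of i]] two_cases[of j] by (auto simp: alternating lform_simps)
  show "lform (cvec (\<rho> l)) (v i 1 k) = lform (cvec (\<rho> l)) (v i 0 k)" for i k
    using rh(2)[OF diff_in_z_line[of i]] two_cases[of k] by (auto simp: alternating lform_simps)
qed

text \<open>The point where \<open>r 0\<close> meets the intersection of the two boundary planes
  supplies the vector \<open>z\<close> of \<open>plane_forms_proportional\<close>.\<close>

lemma forms_proportional:
  "\<exists>\<mu>. \<mu> \<noteq> 0 \<and> (\<forall>j k. lform (\<sigma> 0) (v 1 j k) = \<mu> * lform (\<sigma> 1) (v 0 j k))"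
proof -
  interpret t: transversal v \<sigma> "r 0" "cvec (\<theta> 0)" "cvec (\<rho> 0)" by (rule transversal)
  obtain z where z: "z \<noteq> 0" "z \<in> r 0" "z \<in> Sigma_surf w P 0 \<inter> Sigma_surf w P 1"
    using scaffold unfolding scaffold_def meets_def by blast
  then have "lform (\<sigma> 0) z = 0" "lform (\<sigma> 1) z = 0" by (auto simp: sigma_surf)
  from t.plane_forms_proportional[OF z(1,2) this] show ?thesis by metis
qed

text \<open>If \<open>v 0 j k\<close> lies in plane 1, then \<open>v 1 j k\<close> lies in plane 0
  by proportionality. The edge is then contained in both planes and equals their intersection line,
  while the four edges are distinct.\<close>

lemma exceptional_edge_unique:
  assumes "lform (\<sigma> 1) (v 0 j k) = 0" "lform (\<sigma> 1) (v 0 j' k') = 0"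
  shows "j = j' \<and> k = k'"
proof -
  obtain \<mu> where "\<mu> \<noteq> 0" and \<mu>: "\<And>j k. lform (\<sigma> 0) (v 1 j k) = \<mu> * lform (\<sigma> 1) (v 0 j k)"
    using forms_proportional by blast
  have "s_line P j k = Sigma_surf w P 0 \<inter> Sigma_surf w P 1" if "lform (\<sigma> 1) (v 0 j k) = 0" for j k
  proof -
    have "lform (\<sigma> 0) (v 1 j k) = 0" using \<mu> that by simp
    then have "lform (\<sigma> l) (cvec (P i j k)) = 0" for i l
      using that sigma(1)[of 0 j k] sigma(1)[of 1 j k] two_cases[of i] two_cases[of l] c_nonzero
      by (auto simp: v_def lform_simps)
    then have "s_line P j k \<subseteq> Sigma_surf w P 0 \<inter> Sigma_surf w P 1"
      by (auto simp: s_line_def join_def mem_span_pair sigma_surf lform_simps)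
    moreover have "is_line (Sigma_surf w P 0 \<inter> Sigma_surf w P 1)"
      using scaffold unfolding scaffold_def by blast
    ultimately show ?thesis
      using lines(1)[of j k] unfolding is_line_def by (intro vec.subspace_dim_equal) auto
  qed
  then show ?thesis using lines_distinct(2) assms by metis
qed

section \<open>Rank one and birationality\<close>

definition rank_one :: bool where
  "rank_one \<longleftrightarrow> (\<exists>(a::real^2) (b::real^2) (g::real^2). \<forall>i j k. \<omega> i j k = a $ i * b $ j * g $ k)"

lemma trilinear_v:
  "trilinear w P s t u = (\<Sum>i\<in>UNIV. \<Sum>j\<in>UNIV. \<Sum>k\<in>UNIV. (of_real (\<omega> i j k) * s $ i * t $ j * u $ k) *s v i j k)"
  unfolding trilinear_E E_v by (intro sum.cong) (simp_all add: algebra_simps)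

lemma rank_one_imp_birational:
  assumes rank_one
  shows "birational_of_type w P (1, 2, 2)"
proof -
  obtain a b g :: "real^2" where abg: "\<And>i j k. \<omega> i j k = a $ i * b $ j * g $ k"
    using assms unfolding rank_one_def by blast
  have nz: "cvec a $ i \<noteq> 0" "cvec b $ i \<noteq> 0" "cvec g $ i \<noteq> 0" for i
    using omega_nonzero[of i i i] abg[of i i i] by (auto simp: cvec_simps)
  obtain \<mu> where \<mu>: "\<mu> \<noteq> 0" "\<And>j k. lform (\<sigma> 0) (v 1 j k) = \<mu> * lform (\<sigma> 1) (v 0 j k)"
    using forms_proportional by blast
  define p where "p = (\<lambda>s t u. \<Sum>i\<in>UNIV. \<Sum>j\<in>UNIV. \<Sum>k\<in>UNIV. (s $ i * t $ j * u $ k) *s v i j k)"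
  obtain A B C where hom: "\<forall>i. homogeneous 1 (A i)" "\<forall>i. homogeneous 2 (B i)" "\<forall>i. homogeneous 2 (C i)"
    and ncf: "no_common_factor (A 0) (A 1)" "no_common_factor (B 0) (B 1)" "no_common_factor (C 0) (C 1)"
    and inv: "mutually_inverse p (pencil A) (pencil B) (pencil C)"
    using inverse_exists[OF \<mu>] unfolding p_def by blast
  \<comment> \<open>Dividing each component by the rank-one factor makes the new pencil, after
    \<open>vscale\<close>, equal to the old one.\<close>
  define sc where "sc x F = (\<lambda>i. Poly_Mapping.single 0 (inverse (cvec x $ i)) * F i)" for x :: "real^2" and F :: "2 \<Rightarrow> poly4"
  have hom': "homogeneous d (sc x F i)" if "\<forall>i. homogeneous d (F i)" for d x F i
    using homogeneous_mult[of 0 "Poly_Mapping.single 0 (inverse (cvec x $ i))" d "F i"] that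
    by (simp add: sc_def homogeneous_single)
  have pen: "vscale (cvec x) (pencil (sc x F) y) = pencil F y" if "\<And>i. cvec x $ i \<noteq> 0" for x F y
    using that by (simp add: vscale_def pencil_def sc_def vec_eq_iff peval_simps(3) peval_const)
  have f: "trilinear w P s t u = p (vscale (cvec a) s) (vscale (cvec b) t) (vscale (cvec g) u)" for s t u
    unfolding trilinear_v p_def by (intro sum.cong) (simp_all add: abg vscale_def cvec_simps algebra_simps)
  have "mutually_inverse (trilinear w P) (pencil (sc a A)) (pencil (sc b B)) (pencil (sc g C))"
    by (rule mutually_inverse_scale[OF f nz inv pen[OF nz(1)] pen[OF nz(2)] pen[OF nz(3)]])
  moreover have "no_common_factor (sc a A 0) (sc a A 1)" "no_common_factor (sc b B 0) (sc b B 1)"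
    "no_common_factor (sc g C 0) (sc g C 1)"
    unfolding sc_def using nz by (intro no_common_factor_scale ncf; simp)+
  ultimately show ?thesis
    unfolding birational_of_type_def prod.case
    using hom'[OF hom(1)] hom'[OF hom(2)] hom'[OF hom(3)] by blast
qed

text \<open>The boundary surface is the closure of the image and also the whole plane, so vanishing
  on the image suffices.\<close>

lemma plane_image_vanish:
  assumes "homogeneous d F" "\<And>t u. peval F (trilinear w P (axis i 1) t u) = 0" "lform (\<sigma> i) x = 0"
  shows "peval F x = 0"
  using zariski_closure_vanish[OF assms(1), of "{x. x \<noteq> 0 \<and> (\<exists>t u. x = trilinear w P (axis i 1) t u)}" x]
    assms(2,3) sigma_surf[of i] by (auto simp: Sigma_surf_def)

lemma birational_imp_rank_one:
  assumes "birational_of_type w P (1, 2, 2)"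
  shows rank_one
proof -
  obtain A B C :: "2 \<Rightarrow> poly4" where
    hom: "homogeneous 1 (A i)" "homogeneous 2 (B i)"
    and ncf: "no_common_factor (A 0) (A 1)" "no_common_factor (B 0) (B 1)"
    and inv: "mutually_inverse (trilinear w P) (pencil A) (pencil B) (pencil C)" for i
    using assms unfolding birational_of_type_def prod.case by blast
  note id = mutually_inverse_identities[OF inv]
  have ax: "axis (0::2) (1::complex) $ 0 = 1" "axis (0::2) (1::complex) $ 1 = 0"
    "axis (1::2) (1::complex) $ 0 = 0" "axis (1::2) (1::complex) $ 1 = 1"
    by (simp_all add: axis_def)

  \<comment> \<open>Otherwise \<open>conics_vanish\<close> makes both \<open>B 0\<close> and
    \<open>B 1\<close> vanish on the boundary plane \<open>i\<close>, and its equation becomes a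
    common factor.\<close>
  have det: "\<omega> i 0 0 * \<omega> i 1 1 = \<omega> i 0 1 * \<omega> i 1 0" for i
  proof (rule ccontr)
    assume det: "\<omega> i 0 0 * \<omega> i 1 1 \<noteq> \<omega> i 0 1 * \<omega> i 1 0"
    obtain Q0 where Q0: "symmetric_bilinear Q0" "\<And>x. peval (B 0) x = Q0 x x"
      using homogeneous_2[OF hom(2)] by blast
    obtain Q1 where Q1: "symmetric_bilinear Q1" "\<And>x. peval (B 1) x = Q1 x x"
      using homogeneous_2[OF hom(2)] by blast
    have tri: "trilinear w P (axis i 1) t u = (of_real (\<omega> i 0 0) * t $ 0 * u $ 0) *s v i 0 0 +
        (of_real (\<omega> i 0 1) * t $ 0 * u $ 1) *s v i 0 1 + (of_real (\<omega> i 1 0) * t $ 1 * u $ 0) *s v i 1 0 +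
        (of_real (\<omega> i 1 1) * t $ 1 * u $ 1) *s v i 1 1" for t u
      using two_cases[of i] by (auto simp: trilinear_v sum_2' ax)
    have van: "Q0 (v i j k) (v i j' k') = 0 \<and> Q1 (v i j k) (v i j' k') = 0" for j k j' k'
    proof (rule conics_vanish[OF Q0(1) Q1(1), of "v i" "\<lambda>j k. of_real (\<omega> i j k)"])
      show "complex_of_real (\<omega> i 0 0) * of_real (\<omega> i 1 1) \<noteq> of_real (\<omega> i 0 1) * of_real (\<omega> i 1 0)"
        using det by (metis of_real_eq_iff of_real_mult)
      fix t0 t1 u0 u1 x
      assume "x = (of_real (\<omega> i 0 0) * t0 * u0) *s v i 0 0 + (of_real (\<omega> i 0 1) * t0 * u1) *s v i 0 1 +
        (of_real (\<omega> i 1 0) * t1 * u0) *s v i 1 0 + (of_real (\<omega> i 1 1) * t1 * u1) *s v i 1 1"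
      then have "x = trilinear w P (axis i 1) (vec2 t0 t1) (vec2 u0 u1)" by (simp add: tri)
      then show "t1 * Q0 x x = t0 * Q1 x x"
        using id(2)[of "axis i 1" "vec2 t0 t1" "vec2 u0 u1"] Q0(2) Q1(2) by (simp add: mult.commute)
    qed (use omega_nonzero alternating in auto)
    have "peval (B l) (trilinear w P (axis i 1) t u) = 0" for l t u
      using two_cases[of l] Q0(2) Q1(2) van
      by (auto simp: tri symmetric_bilinear_simps[OF Q0(1)] symmetric_bilinear_simps[OF Q1(1)])
    then have "lform (\<sigma> i) x = 0 \<Longrightarrow> peval (B l) x = 0" for l x
      using plane_image_vanish[OF hom(2)] by blast
    then have "lpoly (\<sigma> i) dvd B l" for l
      using lpoly_dvd_quadratic[OF hom(2) sigma_nonzero] by (metis dvd_triv_left)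
    then show False
      using ncf(2) not_unit_lpoly unfolding no_common_factor_def by blast
  qed

  obtain \<alpha>0 \<alpha>1 where \<alpha>: "A 0 = lpoly \<alpha>0" "A 1 = lpoly \<alpha>1"
    using homogeneous_1 hom(1) by metis
  have id1: "lform \<alpha>0 (trilinear w P s t u) * s $ 1 = lform \<alpha>1 (trilinear w P s t u) * s $ 0" for s t u
    using id(1) by (simp add: \<alpha> peval_lpoly)
  have "lform (\<sigma> 0) x = 0 \<Longrightarrow> lform \<alpha>1 x = 0" for x
    using plane_image_vanish[OF homogeneous_lpoly[of \<alpha>1], of 0 x] id1[of "axis 0 1"] by (simp add: peval_lpoly ax)
  then obtain c0 where c0: "\<alpha>1 = c0 *s \<sigma> 0"
    using lform_kernel_proportional[OF sigma_nonzero] by blast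
  have "lform (\<sigma> 1) x = 0 \<Longrightarrow> lform \<alpha>0 x = 0" for x
    using plane_image_vanish[OF homogeneous_lpoly[of \<alpha>0], of 1 x] id1[of "axis 1 1"] by (simp add: peval_lpoly ax)
  then obtain c1 where c1: "\<alpha>0 = c1 *s \<sigma> 1"
    using lform_kernel_proportional[OF sigma_nonzero] by blast
  have lp0: "lpoly 0 = 0" by (simp add: lpoly_def)
  \<comment> \<open>If one of the two linear forms were zero, the other would be a common factor
    that is not a unit.\<close>
  have "c0 \<noteq> 0"
    using ncf(1) not_unit_lpoly[of \<alpha>0] lp0 unfolding no_common_factor_def \<alpha> c0 by (metis dvd_0_right dvd_refl vec.scale_zero_left)
  have "c1 \<noteq> 0"
    using ncf(1) not_unit_lpoly[of \<alpha>1] lp0 unfolding no_common_factor_def \<alpha> c1 by (metis dvd_0_right dvd_refl vec.scale_zero_left)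
  obtain \<mu> where \<mu>: "\<mu> \<noteq> 0" "\<And>j k. lform (\<sigma> 0) (v 1 j k) = \<mu> * lform (\<sigma> 1) (v 0 j k)"
    using forms_proportional by blast
  \<comment> \<open>The linear identity at \<open>s = (1, 1)\<close> on a single edge. Each plane
    form sees only the end of the edge in the other plane, and \<mu> relates the two values.\<close>
  have edge: "c1 * of_real (\<omega> 0 j k) * lform (\<sigma> 1) (v 0 j k) = c0 * of_real (\<omega> 1 j k) * (\<mu> * lform (\<sigma> 1) (v 0 j k))" for j k
  proof -
    have tri: "trilinear w P (vec2 1 1) (axis j 1) (axis k 1) = of_real (\<omega> 0 j k) *s v 0 j k + of_real (\<omega> 1 j k) *s v 1 j k"
      using two_cases[of j] two_cases[of k] by (auto simp: trilinear_v sum_2' ax)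
    show ?thesis
      using id1[of "vec2 1 1" "axis j 1" "axis k 1"]
      unfolding tri by (auto simp: c0 c1 lform_simps lform_simps_left sigma \<mu>(2) mult_ac)
  qed
  define K where "K = c1 / (c0 * \<mu>)"
  have K: "complex_of_real (\<omega> 1 j k) = K * of_real (\<omega> 0 j k)" if "lform (\<sigma> 1) (v 0 j k) \<noteq> 0" for j k
    using edge[of j k] that \<open>c0 \<noteq> 0\<close> \<mu>(1) by (simp add: K_def field_simps)
  define q where "q j k = \<omega> 1 j k / \<omega> 0 j k" for j k
  have Kq: "K = of_real (q j k)" if "lform (\<sigma> 1) (v 0 j k) \<noteq> 0" for j k
    using K[OF that] omega_nonzero[of 0 j k] by (simp add: q_def field_simps)
  have qq: "q j k = q j' k'" if "lform (\<sigma> 1) (v 0 j k) \<noteq> 0" "lform (\<sigma> 1) (v 0 j' k') \<noteq> 0" for j k j' k'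
    using Kq[OF that(1)] Kq[OF that(2)] by simp
  have qdet: "q 0 0 * q 1 1 = q 0 1 * q 1 0"
    using det[of 0] det[of 1] omega_nonzero by (simp add: q_def field_simps)
  have qn: "q j k \<noteq> 0" for j k by (simp add: q_def omega_nonzero)
  \<comment> \<open>At most one edge lies in both planes, so three of the ratios agree by
    \<open>qq\<close>; \<open>qdet\<close> then determines the fourth.\<close>
  have "q 0 1 = q 0 0 \<and> q 1 0 = q 0 0 \<and> q 1 1 = q 0 0"
  proof -
    consider (00) "lform (\<sigma> 1) (v 0 0 1) \<noteq> 0" "lform (\<sigma> 1) (v 0 1 0) \<noteq> 0" "lform (\<sigma> 1) (v 0 1 1) \<noteq> 0"
      | (01) "lform (\<sigma> 1) (v 0 0 0) \<noteq> 0" "lform (\<sigma> 1) (v 0 1 0) \<noteq> 0" "lform (\<sigma> 1) (v 0 1 1) \<noteq> 0"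
      | (10) "lform (\<sigma> 1) (v 0 0 0) \<noteq> 0" "lform (\<sigma> 1) (v 0 0 1) \<noteq> 0" "lform (\<sigma> 1) (v 0 1 1) \<noteq> 0"
      | (11) "lform (\<sigma> 1) (v 0 0 0) \<noteq> 0" "lform (\<sigma> 1) (v 0 0 1) \<noteq> 0" "lform (\<sigma> 1) (v 0 1 0) \<noteq> 0"
      using exceptional_edge_unique by (metis zero_neq_one)
    then show ?thesis
    proof cases
      case 00
      then show ?thesis using qq[of 0 1 1 0] qq[of 0 1 1 1] qdet qn[of 1 1] by simp
    next
      case 01
      then show ?thesis using qq[of 0 0 1 0] qq[of 0 0 1 1] qdet qn[of 1 1] by simp
    next
      case 10
      then show ?thesis using qq[of 0 0 0 1] qq[of 0 0 1 1] qdet qn[of 1 1] by simp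
    next
      case 11
      then show ?thesis using qq[of 0 0 0 1] qq[of 0 0 1 0] qdet qn[of 1 0] by simp
    qed
  qed
  then have "q j k = q 0 0" for j k
    using two_cases[of j] two_cases[of k] by (elim disjE) simp_all
  then have w1: "\<omega> 1 j k = q 0 0 * \<omega> 0 j k" for j k
    using omega_nonzero[of 0] by (simp add: q_def field_simps)
  \<comment> \<open>The matrix \<open>\<omega> 0 j k\<close> is singular with nonzero entries, hence
    its normalized first column times its first row; \<open>a\<close> carries the constant ratio of
    the two slices.\<close>
  define a b g :: "real^2" where "a = vec2 1 (q 0 0)" and "b = vec2 1 (\<omega> 0 1 0 / \<omega> 0 0 0)" and "g = vec2 (\<omega> 0 0 0) (\<omega> 0 0 1)"
  have "\<omega> 0 j k = b $ j * g $ k" for j k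
    using det[of 0] omega_nonzero[of 0 0 0] two_cases[of j] two_cases[of k]
    by (auto simp: b_def g_def field_simps)
  then have "\<omega> i j k = a $ i * b $ j * g $ k" for i j k
    using two_cases[of i] w1[of j k] by (auto simp: a_def)
  then show ?thesis unfolding rank_one_def by blast
qed

section \<open>Weight conditions and rank one\<close>

lemma lform_real: "lform (cvec n) (v i j k) = of_real ((n \<bullet> P i j k) * c i j k)"
  by (simp add: v_def lform_simps cvec_simps)

text \<open>The ratio between the two boundary planes is the same constant for \<theta> and \<rho>,
  which gives the common \<open>A\<close>. Sharing it is what allows one point
  \<open>\<alpha> l\<close> in both conditions of index \<open>l\<close>.\<close>

lemma plane_values:
  "\<exists>(A::real^2) (\<tau>::real^2) (\<kappa>::real^2). (\<forall>i. A $ i \<noteq> 0 \<and> \<tau> $ i \<noteq> 0 \<and> \<kappa> $ i \<noteq> 0) \<and>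
     (\<forall>i j k. (\<theta> l \<bullet> P i j k) * c i j k = A $ i * \<tau> $ j) \<and>
     (\<forall>i j k. (\<rho> l \<bullet> P i j k) * c i j k = A $ i * \<kappa> $ k)"
proof -
  interpret t: transversal v \<sigma> "r l" "cvec (\<theta> l)" "cvec (\<rho> l)" by (rule transversal)
  define h where "h i j k = (\<theta> l \<bullet> P i j k) * c i j k" for i j k
  define h' where "h' i j k = (\<rho> l \<bullet> P i j k) * c i j k" for i j k
  have hv: "lform (cvec (\<theta> l)) (v i j k) = of_real (h i j k)" "lform (cvec (\<rho> l)) (v i j k) = of_real (h' i j k)" for i j k
    by (simp_all add: h_def h'_def lform_real)
  define C where "C = h 1 0 0 / h 0 0 0"
  have nz: "h i j k \<noteq> 0" "h' i j k \<noteq> 0" for i j k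
    using t.theta_nonzero[of i j k] t.rho_nonzero[of i j k] by (simp_all add: hv)
  have ratio: "h 1 j k = C * h 0 j k" "h' 1 j k = C * h' 0 j k" for j k
    using t.ratio(2,3)[of j k] unfolding hv C_def of_real_divide[symmetric] of_real_mult[symmetric] of_real_eq_iff by auto
  have const: "h i j k = h i j 0" "h' i j k = h' i 0 k" for i j k
    using t.theta_const[of i j k] t.rho_const[of i j k] unfolding hv of_real_eq_iff by auto
  define A \<tau> \<kappa> :: "real^2" where "A = vec2 1 C" and "\<tau> = (\<chi> j. h 0 j 0)" and "\<kappa> = (\<chi> k. h' 0 0 k)"
  have "h i j k = A $ i * \<tau> $ j" for i j k
    using two_cases[of i] ratio(1)[of j 0] const(1)[of i j k] by (elim disjE) (simp_all add: A_def \<tau>_def)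
  moreover have "h' i j k = A $ i * \<kappa> $ k" for i j k
    using two_cases[of i] ratio(2)[of 0 k] const(2)[of i j k] by (elim disjE) (simp_all add: A_def \<kappa>_def)
  moreover have "A $ i \<noteq> 0" for i
    using nz two_cases[of i] by (elim disjE) (simp_all add: A_def C_def)
  moreover have "\<tau> $ i \<noteq> 0" "\<kappa> $ i \<noteq> 0" for i
    using nz by (simp_all add: \<tau>_def \<kappa>_def)
  ultimately show ?thesis
    unfolding h_def[symmetric] h'_def[symmetric] by blast
qed

text \<open>Multiplying by \<open>n \<bullet> P i j k\<close> clears the denominator in
  \<open>Delta\<close>, and the scaling factors \<open>c\<close> cancel in
  \<open>\<omega> i j k * h i j k\<close>.\<close>

lemma weights_factor_omega:
  assumes h: "\<And>i j k. (n \<bullet> P i j k) * c i j k = h i j k" "\<And>i j k. h i j k \<noteq> 0"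
  shows "weights_factor w a b g (Delta P n) \<longleftrightarrow>
    (\<exists>C. C \<noteq> 0 \<and> (\<forall>i j k. \<omega> i j k * h i j k = C * (a $ i * b $ j * g $ k)))"
proof -
  have "w i j k = C * (a $ i * b $ j * g $ k * Delta P n i j k) \<longleftrightarrow>
      \<omega> i j k * h i j k = C * (a $ i * b $ j * g $ k)" for C i j k
  proof -
    have nP: "n \<bullet> P i j k \<noteq> 0" using h(1)[of i j k] h(2)[of i j k] by auto
    have "\<omega> i j k * h i j k = w i j k * (n \<bullet> P i j k)"
      using c_nonzero[of i j k] by (simp add: \<omega>_def h(1)[symmetric])
    then show ?thesis using nP by (auto simp: Delta_def field_simps)
  qed
  then show ?thesis unfolding weights_factor_def by simp
qed

lemma weights_factor_imp_rank_one:
  assumes "weights_factor w a b g (Delta P (\<theta> l)) \<or> weights_factor w a b g (Delta P (\<rho> l))"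
  shows rank_one
proof -
  obtain A \<tau> \<kappa> :: "real^2" where nz: "\<And>i. A $ i \<noteq> 0" "\<And>i. \<tau> $ i \<noteq> 0" "\<And>i. \<kappa> $ i \<noteq> 0"
    and th: "\<And>i j k. (\<theta> l \<bullet> P i j k) * c i j k = A $ i * \<tau> $ j"
    and rh: "\<And>i j k. (\<rho> l \<bullet> P i j k) * c i j k = A $ i * \<kappa> $ k"
    using plane_values[of l] by blast
  from assms show ?thesis
  proof
    assume "weights_factor w a b g (Delta P (\<theta> l))"
    then obtain C where "\<And>i j k. \<omega> i j k * (A $ i * \<tau> $ j) = C * (a $ i * b $ j * g $ k)"
      unfolding weights_factor_omega[OF th no_zero_divisors[OF nz(1,2)]] by blast
    then have "\<omega> i j k = (\<chi> i. C * a $ i / A $ i) $ i * (\<chi> j. b $ j / \<tau> $ j) $ j * g $ k" for i j k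
      using nz by (simp add: field_simps)
    then show ?thesis unfolding rank_one_def by blast
  next
    assume "weights_factor w a b g (Delta P (\<rho> l))"
    then obtain C where "\<And>i j k. \<omega> i j k * (A $ i * \<kappa> $ k) = C * (a $ i * b $ j * g $ k)"
      unfolding weights_factor_omega[OF rh no_zero_divisors[OF nz(1,3)]] by blast
    then have "\<omega> i j k = (\<chi> i. C * a $ i / A $ i) $ i * b $ j * (\<chi> k. g $ k / \<kappa> $ k) $ k" for i j k
      using nz by (simp add: field_simps)
    then show ?thesis unfolding rank_one_def by blast
  qed
qed

text \<open>The values in \<open>plane_values\<close> are products as well, so they multiply into
  the factors of \<omega>: \<open>A l\<close> into \<open>a\<close>, \<open>\<tau> l\<close> into
  \<open>b\<close>, and \<open>\<kappa> l\<close> into \<open>g\<close>.\<close>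

lemma rank_one_imp_weights_factor:
  assumes rank_one
  shows "\<exists>(\<alpha> :: 2 \<Rightarrow> real^2) (\<beta> :: 3 \<Rightarrow> real^2) (\<gamma> :: 3 \<Rightarrow> real^2).
    P1_points \<alpha> \<and> P1_points \<beta> \<and> P1_points \<gamma> \<and>
    weights_factor w (\<alpha> 0) (\<beta> 0) (\<gamma> 2) (Delta P (\<theta> 0)) \<and>
    weights_factor w (\<alpha> 1) (\<beta> 1) (\<gamma> 2) (Delta P (\<theta> 1)) \<and>
    weights_factor w (\<alpha> 0) (\<beta> 2) (\<gamma> 0) (Delta P (\<rho> 0)) \<and>
    weights_factor w (\<alpha> 1) (\<beta> 2) (\<gamma> 1) (Delta P (\<rho> 1))"
proof -
  obtain a b g :: "real^2" where abg: "\<And>i j k. \<omega> i j k = a $ i * b $ j * g $ k"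
    using assms unfolding rank_one_def by blast
  have nz: "a $ i \<noteq> 0" "b $ i \<noteq> 0" "g $ i \<noteq> 0" for i
    using omega_nonzero[of i i i] abg[of i i i] by auto
  have "\<forall>l. \<exists>x::(real^2) \<times> (real^2) \<times> (real^2). case x of (A, \<tau>, \<kappa>) \<Rightarrow>
     (\<forall>i. A $ i \<noteq> 0 \<and> \<tau> $ i \<noteq> 0 \<and> \<kappa> $ i \<noteq> 0) \<and>
     (\<forall>i j k. (\<theta> l \<bullet> P i j k) * c i j k = A $ i * \<tau> $ j) \<and>
     (\<forall>i j k. (\<rho> l \<bullet> P i j k) * c i j k = A $ i * \<kappa> $ k)"
    using plane_values by simp
  from choice[OF this] obtain X :: "2 \<Rightarrow> (real^2) \<times> (real^2) \<times> (real^2)" where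
    X: "\<And>l. case X l of (A, \<tau>, \<kappa>) \<Rightarrow>
     (\<forall>i. A $ i \<noteq> 0 \<and> \<tau> $ i \<noteq> 0 \<and> \<kappa> $ i \<noteq> 0) \<and>
     (\<forall>i j k. (\<theta> l \<bullet> P i j k) * c i j k = A $ i * \<tau> $ j) \<and>
     (\<forall>i j k. (\<rho> l \<bullet> P i j k) * c i j k = A $ i * \<kappa> $ k)"
    by blast
  define A \<tau> \<kappa> where "A l = fst (X l)" and "\<tau> l = fst (snd (X l))" and "\<kappa> l = snd (snd (X l))" for l
  have n: "A l $ i \<noteq> 0" "\<tau> l $ i \<noteq> 0" "\<kappa> l $ i \<noteq> 0"
    and th: "(\<theta> l \<bullet> P i j k) * c i j k = A l $ i * \<tau> l $ j"
    and rh: "(\<rho> l \<bullet> P i j k) * c i j k = A l $ i * \<kappa> l $ k" for l i j k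
    using X[of l] by (simp_all add: A_def \<tau>_def \<kappa>_def split_beta)
  define \<alpha> where "\<alpha> l = (\<chi> i. a $ i * A l $ i)" for l
  \<comment> \<open>Index 2 holds the unmodified factor, used with the planes whose values do not
    depend on \<open>j\<close>. The conditional carries the indices 0 and 1 from type
    \<open>3\<close> to type \<open>2\<close>.\<close>
  define \<beta> :: "3 \<Rightarrow> real^2" where
    "\<beta> m = (if m = 2 then b else \<chi> j. b $ j * \<tau> (if m = 0 then 0 else 1) $ j)" for m
  define \<gamma> :: "3 \<Rightarrow> real^2" where
    "\<gamma> m = (if m = 2 then g else \<chi> k. g $ k * \<kappa> (if m = 0 then 0 else 1) $ k)" for m
  have \<beta>: "\<beta> 0 = (\<chi> j. b $ j * \<tau> 0 $ j)" "\<beta> 1 = (\<chi> j. b $ j * \<tau> 1 $ j)" "\<beta> 2 = b"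
    and \<gamma>: "\<gamma> 0 = (\<chi> k. g $ k * \<kappa> 0 $ k)" "\<gamma> 1 = (\<chi> k. g $ k * \<kappa> 1 $ k)" "\<gamma> 2 = g"
    by (simp_all add: \<beta>_def \<gamma>_def)
  have "P1_points \<alpha>" "P1_points \<beta>" "P1_points \<gamma>"
    unfolding P1_points_def using nz n
    by (auto simp: \<alpha>_def \<beta>_def \<gamma>_def vec_eq_iff)
  moreover have "weights_factor w (\<alpha> l) (\<chi> j. b $ j * \<tau> l $ j) g (Delta P (\<theta> l))" for l
    unfolding weights_factor_omega[OF th no_zero_divisors[OF n(1,2)]]
    by (intro exI[of _ 1]) (simp add: \<alpha>_def abg algebra_simps)
  moreover have "weights_factor w (\<alpha> l) b (\<chi> k. g $ k * \<kappa> l $ k) (Delta P (\<rho> l))" for l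
    unfolding weights_factor_omega[OF rh no_zero_divisors[OF n(1,3)]]
    by (intro exI[of _ 1]) (simp add: \<alpha>_def abg algebra_simps)
  ultimately show ?thesis
    unfolding \<beta>[symmetric] by (intro exI[of _ \<alpha>] exI[of _ \<beta>] exI[of _ \<gamma>]) (simp add: \<beta> \<gamma>)
qed

end

section \<open>Choice of the scaling and the equivalence of all conditions\<close>

lemma (in scaffold_map) scaled_scaffold_exists:
  "\<exists>c \<sigma>. scaled_scaffold w P r \<theta> \<rho> c \<sigma>"
proof -
  obtain \<sigma> where s: "\<And>i. \<sigma> i \<noteq> 0" "\<And>i. Sigma_surf w P i = {x. lform (\<sigma> i) x = 0}"
    using plane_forms by blast
  have "\<forall>i. \<exists>c :: 2 \<Rightarrow> 2 \<Rightarrow> real. (\<forall>j k. c j k \<noteq> 0) \<and>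
     of_real (c 1 1) *s cvec (P i 1 1) =
     of_real (c 1 0) *s cvec (P i 1 0) + of_real (c 0 1) *s cvec (P i 0 1) - of_real (c 0 0) *s cvec (P i 0 0)"
    by (intro allI scaling_exists)
  from choice[OF this] obtain c :: "2 \<Rightarrow> 2 \<Rightarrow> 2 \<Rightarrow> real" where
    c: "\<forall>i. (\<forall>j k. c i j k \<noteq> 0) \<and>
     of_real (c i 1 1) *s cvec (P i 1 1) =
     of_real (c i 1 0) *s cvec (P i 1 0) + of_real (c i 0 1) *s cvec (P i 0 1) - of_real (c i 0 0) *s cvec (P i 0 0)"
    ..
  have "scaled_scaffold w P r \<theta> \<rho> c \<sigma>"
    by unfold_locales (use c s in simp_all)
  then show ?thesis by blast
qed

theorem corollary5p7:
  fixes w :: weights and P :: control_points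
    and r :: "2 \<Rightarrow> (complex^4) set"
    and \<theta> \<rho> :: "2 \<Rightarrow> real^4"
  assumes "\<And>i j k. P i j k $ 0 = 1"
    and "nondegenerate w P"
    and "scaffold w P r"
    and "\<And>l. plane_through (\<theta> l) (y_line P) (r l)"
    and "\<And>l. plane_through (\<rho> l) (z_line P) (r l)"
  shows "(birational_of_type w P (1, 2, 2) \<longleftrightarrow>
          (\<exists>(\<alpha> :: 2 \<Rightarrow> real^2) (\<beta> :: 3 \<Rightarrow> real^2) (\<gamma> :: 3 \<Rightarrow> real^2).
            P1_points \<alpha> \<and> P1_points \<beta> \<and> P1_points \<gamma> \<and>
            (weights_factor w (\<alpha> 0) (\<beta> 0) (\<gamma> 2) (Delta P (\<theta> 0)) \<or>
             weights_factor w (\<alpha> 1) (\<beta> 1) (\<gamma> 2) (Delta P (\<theta> 1)) \<or>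
             weights_factor w (\<alpha> 0) (\<beta> 2) (\<gamma> 0) (Delta P (\<rho> 0)) \<or>
             weights_factor w (\<alpha> 1) (\<beta> 2) (\<gamma> 1) (Delta P (\<rho> 1)))))
       \<and>
         ((\<exists>(\<alpha> :: 2 \<Rightarrow> real^2) (\<beta> :: 3 \<Rightarrow> real^2) (\<gamma> :: 3 \<Rightarrow> real^2).
            P1_points \<alpha> \<and> P1_points \<beta> \<and> P1_points \<gamma> \<and>
            (weights_factor w (\<alpha> 0) (\<beta> 0) (\<gamma> 2) (Delta P (\<theta> 0)) \<or>
             weights_factor w (\<alpha> 1) (\<beta> 1) (\<gamma> 2) (Delta P (\<theta> 1)) \<or>
             weights_factor w (\<alpha> 0) (\<beta> 2) (\<gamma> 0) (Delta P (\<rho> 0)) \<or>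
             weights_factor w (\<alpha> 1) (\<beta> 2) (\<gamma> 1) (Delta P (\<rho> 1))))
         \<longrightarrow>
          (\<exists>(\<alpha> :: 2 \<Rightarrow> real^2) (\<beta> :: 3 \<Rightarrow> real^2) (\<gamma> :: 3 \<Rightarrow> real^2).
            P1_points \<alpha> \<and> P1_points \<beta> \<and> P1_points \<gamma> \<and>
            (weights_factor w (\<alpha> 0) (\<beta> 0) (\<gamma> 2) (Delta P (\<theta> 0)) \<and>
             weights_factor w (\<alpha> 1) (\<beta> 1) (\<gamma> 2) (Delta P (\<theta> 1)) \<and>
             weights_factor w (\<alpha> 0) (\<beta> 2) (\<gamma> 0) (Delta P (\<rho> 0)) \<and>
             weights_factor w (\<alpha> 1) (\<beta> 2) (\<gamma> 1) (Delta P (\<rho> 1)))))"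
proof -
  interpret scaffold_map w P r \<theta> \<rho> by unfold_locales (fact assms)+
  obtain c \<sigma> where "scaled_scaffold w P r \<theta> \<rho> c \<sigma>"
    using scaled_scaffold_exists by blast
  then interpret scaled_scaffold w P r \<theta> \<rho> c \<sigma> .
  let ?disj = "\<exists>(\<alpha> :: 2 \<Rightarrow> real^2) (\<beta> :: 3 \<Rightarrow> real^2) (\<gamma> :: 3 \<Rightarrow> real^2).
      P1_points \<alpha> \<and> P1_points \<beta> \<and> P1_points \<gamma> \<and>
      (weights_factor w (\<alpha> 0) (\<beta> 0) (\<gamma> 2) (Delta P (\<theta> 0)) \<or>
       weights_factor w (\<alpha> 1) (\<beta> 1) (\<gamma> 2) (Delta P (\<theta> 1)) \<or>
       weights_factor w (\<alpha> 0) (\<beta> 2) (\<gamma> 0) (Delta P (\<rho> 0)) \<or>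
       weights_factor w (\<alpha> 1) (\<beta> 2) (\<gamma> 1) (Delta P (\<rho> 1)))"
  have "?disj \<Longrightarrow> rank_one"
    using weights_factor_imp_rank_one by blast
  moreover have "rank_one \<Longrightarrow> ?disj"
    using rank_one_imp_weights_factor by blast
  moreover have "birational_of_type w P (1, 2, 2) \<longleftrightarrow> rank_one"
    using birational_imp_rank_one rank_one_imp_birational by blast
  ultimately show ?thesis
    using rank_one_imp_weights_factor by blast
qed

end
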